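(* Let $\Gamma=(V,E)$ be a simplicial graph of finite dimension, let $\{G_v\mid v\in V\}$ be a family of nontrivial groups, and let $G_\Gamma$ be the associated graph product, regarded as a discrete group. Let $L$ be a (Hausdorff) locally compact group and $\varphi:L\to G_\Gamma$ an abstract (not necessarily continuous) homomorphism. Then either $\varphi$ is continuous, or there exist a nonempty clique $S\subseteq V$ and $g\in G_\Gamma$ such that $\varphi(L)\subseteq g\,G_{S\cup\operatorname{lk}(S)}\,g^{-1}$. Moreover, if for every $v\in V$ the composite $r_v\circ\varphi:L\to G_v$ is continuous (with $G_v$ discrete), then $\varphi$ is continuous.
   Context: A simplicial graph $\Gamma=(V,E)$ has vertex set $V$ (possibly infinite) and edges $E$ being $2$-element subsets of $V$. A subset $S\subseteq V$ is a clique if every two distinct elements of $S$ are joined by an edge. $\Gamma$ has finite dimension if there is a uniform upper bound on the cardinalities of cliques. The graph product is $G_\Gamma=\left(\ast_{u\in V}G_u\right)/\langle\langle [G_v,G_w] \text{ for } \{v,w\}\in E\rangle\rangle$. For $S\subseteq V$, $G_S$ denotes the subgroup of $G_\Gamma$ generated by the $G_v$, $v\in S$. The link of $S\subseteq V$ is $\operatorname{lk}(S)=\{w\in V\mid \{v,w\}\in E \text{ for all } v\in S\}$. For $v\in V$, $r_v:G_\Gamma\to G_v$ is the retraction homomorphism obtained by sending $G_u$ to the identity for all $u\neq v$ and restricting to the identity on $G_v$. *)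

theory Defs
  imports "HOL-Analysis.Analysis" "HOL-Algebra.Algebra"
begin

definition simplicial_graph :: "'v set \<Rightarrow> 'v set set \<Rightarrow> bool" where
  "simplicial_graph V E \<longleftrightarrow> (\<forall>e\<in>E. \<exists>v w. v \<in> V \<and> w \<in> V \<and> v \<noteq> w \<and> e = {v, w})"

definition clique :: "'v set \<Rightarrow> 'v set set \<Rightarrow> 'v set \<Rightarrow> bool" where
  "clique V E S \<longleftrightarrow> S \<subseteq> V \<and> (\<forall>v\<in>S. \<forall>w\<in>S. v \<noteq> w \<longrightarrow> {v, w} \<in> E)"

definition finite_dimension :: "'v set \<Rightarrow> 'v set set \<Rightarrow> bool" where
  "finite_dimension V E \<longleftrightarrow> (\<exists>N::nat. \<forall>S. clique V E S \<longrightarrow> finite S \<and> card S \<le> N)"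

definition link :: "'v set \<Rightarrow> 'v set set \<Rightarrow> 'v set \<Rightarrow> 'v set" where
  "link V E S = {w \<in> V. \<forall>v\<in>S. {v, w} \<in> E}"

definition gp_words :: "'v set \<Rightarrow> ('v \<Rightarrow> 'g monoid) \<Rightarrow> ('v \<times> 'g) list set" where
  "gp_words V G = {xs. \<forall>(v, g) \<in> set xs. v \<in> V \<and> g \<in> carrier (G v)}"

inductive gp_step :: "'v set \<Rightarrow> 'v set set \<Rightarrow> ('v \<Rightarrow> 'g monoid) \<Rightarrow>
    ('v \<times> 'g) list \<Rightarrow> ('v \<times> 'g) list \<Rightarrow> bool" for V E G where
  del: "\<lbrakk>xs \<in> gp_words V G; ys \<in> gp_words V G; v \<in> V\<rbrakk> \<Longrightarrow>
        gp_step V E G (xs @ [(v, \<one>\<^bsub>G v\<^esub>)] @ ys) (xs @ ys)"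
| merge: "\<lbrakk>xs \<in> gp_words V G; ys \<in> gp_words V G; v \<in> V; g \<in> carrier (G v); h \<in> carrier (G v)\<rbrakk> \<Longrightarrow>
        gp_step V E G (xs @ [(v, g), (v, h)] @ ys) (xs @ [(v, g \<otimes>\<^bsub>G v\<^esub> h)] @ ys)"
| swap: "\<lbrakk>xs \<in> gp_words V G; ys \<in> gp_words V G; v \<in> V; w \<in> V; {v, w} \<in> E;
          g \<in> carrier (G v); h \<in> carrier (G w)\<rbrakk> \<Longrightarrow>
        gp_step V E G (xs @ [(v, g), (w, h)] @ ys) (xs @ [(w, h), (v, g)] @ ys)"

definition gp_rel :: "'v set \<Rightarrow> 'v set set \<Rightarrow> ('v \<Rightarrow> 'g monoid) \<Rightarrow>
    (('v \<times> 'g) list \<times> ('v \<times> 'g) list) set" where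
  "gp_rel V E G = {(xs, ys). xs \<in> gp_words V G \<and> ys \<in> gp_words V G \<and>
                              (symclp (gp_step V E G))\<^sup>*\<^sup>* xs ys}"

definition graph_product :: "'v set \<Rightarrow> 'v set set \<Rightarrow> ('v \<Rightarrow> 'g monoid) \<Rightarrow>
    ('v \<times> 'g) list set monoid" where
  "graph_product V E G =
     \<lparr> carrier = gp_words V G // gp_rel V E G,
       mult = (\<lambda>A B. \<Union>{gp_rel V E G `` {xs @ ys} | xs ys. xs \<in> A \<and> ys \<in> B}),
       one = gp_rel V E G `` {[]} \<rparr>"

definition gp_emb :: "'v set \<Rightarrow> 'v set set \<Rightarrow> ('v \<Rightarrow> 'g monoid) \<Rightarrow> 'v \<Rightarrow> 'g \<Rightarrow>
    ('v \<times> 'g) list set" where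
  "gp_emb V E G v g = gp_rel V E G `` {[(v, g)]}"

definition gp_sub :: "'v set \<Rightarrow> 'v set set \<Rightarrow> ('v \<Rightarrow> 'g monoid) \<Rightarrow> 'v set \<Rightarrow>
    ('v \<times> 'g) list set set" where
  "gp_sub V E G S = generate (graph_product V E G) (\<Union>v\<in>S. gp_emb V E G v ` carrier (G v))"

definition gp_retr_word :: "('v \<Rightarrow> 'g monoid) \<Rightarrow> 'v \<Rightarrow> ('v \<times> 'g) list \<Rightarrow> 'g" where
  "gp_retr_word G v xs =
     foldr (\<lambda>p acc. if fst p = v then snd p \<otimes>\<^bsub>G v\<^esub> acc else acc) xs (\<one>\<^bsub>G v\<^esub>)"

definition gp_retr :: "('v \<Rightarrow> 'g monoid) \<Rightarrow> 'v \<Rightarrow> ('v \<times> 'g) list set \<Rightarrow> 'g" where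
  "gp_retr G v A = gp_retr_word G v (SOME xs. xs \<in> A)"

definition topological_group :: "'a monoid \<Rightarrow> 'a topology \<Rightarrow> bool" where
  "topological_group L T \<longleftrightarrow> group L \<and> topspace T = carrier L \<and>
     continuous_map (prod_topology T T) T (\<lambda>(x, y). x \<otimes>\<^bsub>L\<^esub> y) \<and>
     continuous_map T T (m_inv L)"

definition locally_compact_group :: "'a monoid \<Rightarrow> 'a topology \<Rightarrow> bool" where
  "locally_compact_group L T \<longleftrightarrow> topological_group L T \<and> Hausdorff_space T \<and>
     locally_compact_space T"

end

theory Submission
  imports Defs
begin

text \<open>
  For every vertex \<open>v\<close> the graph product is the amalgam of \<open>G\<^bsub>V - {v}\<^esub>\<close> and \<open>G\<^bsub>{v} \<union> lk v\<^esub>\<close> over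
  \<open>G\<^bsub>lk v\<^esub>\<close>; it acts on the Bass--Serre tree \<open>T\<^sub>v\<close>, where distances count the \<open>v\<close>-letters of reduced
  words. Finite dimension bounds the diameters of the connected components of the complements of
  finite subgraphs. Therefore an element fixing a long part of an axis, measured in periods, fixes the whole
  axis, with a constant that does not depend on \<open>v\<close>.

  Suppose that arbitrarily small elements \<open>x\<^sub>n\<close> of \<open>L\<close> act without a fixed point on some trees \<open>T\<^sub>v\<close>.
  By compactness the equations \<open>y\<^sub>n = w\<^sub>n(x\<^sub>n, y\<^sub>n\<^sub>+\<^sub>1)\<close> have a common solution, for words \<open>w\<^sub>n\<close> whose
  value is hyperbolic as soon as one argument is, and which double the translation length
  of \<open>y\<^sub>n\<^sub>+\<^sub>1\<close>. Then the translation lengths of \<open>\<phi>(y\<^sub>0)\<close> on the trees are unbounded, although they are at most twice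
  its word length. So a neighbourhood of the identity acts elliptically on all trees.

  A nontrivial element that is elliptic on all trees has, for some \<open>u\<close>, exactly one fixed point in
  \<open>T\<^sub>u\<close>, and that is a coset of \<open>G\<^bsub>{u} \<union> lk u\<^esub>\<close>; an element \<open>b\<close> such that \<open>b\<close> and \<open>ab\<close> are elliptic
  fixes the unique fixed point of \<open>a\<close>. If one vertex \<open>u\<close> arises from arbitrarily small elements of
  \<open>L\<close>, then \<open>\<phi>(L)\<close> fixes that coset; otherwise arbitrarily large cliques arise.
\<close>

section \<open>Trees\<close>

text \<open>The elements \<open>x\<^sub>n\<close> may be hyperbolic on different trees, and
  \<open>V\<close> may be infinite, so no single tree sees the whole sequence. This shapes the
  words: \<open>x\<^sub>n\<close> alone must make \<open>y\<^sub>n\<close> hyperbolic on its own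
  tree, and every earlier word must transport and double this, whatever its first argument does
  there. It is also why the rigidity constant must not depend on the tree: the exponents are chosen
  before it is known on which trees later elements act hyperbolically. The order of choices is
  essential. The power \<open>P\<close> of the first argument depends on the clique bound alone,
  because \<open>x\<^sub>n\<close> is picked so small that its power \<open>6 * P\<close>, the value
  of the word at the identity, stays in a neighbourhood fixed before. The power \<open>Q\<close> of
  the second argument may then grow with the word lengths of powers of the image of
  \<open>x\<^sub>n\<close>, which bound the displacement of the base vertices of all trees at once.
  The unique fixed coset at \<open>u\<close> is witnessed by a nontrivial value of the retraction to
  \<open>G u\<close>. Continuity of the composite excludes this near the identity, which gives the
  last claim.\<close>

locale tree =
  fixes verts :: "'p set" and adj :: "'p \<Rightarrow> 'p \<Rightarrow> bool" and d :: "'p \<Rightarrow> 'p \<Rightarrow> nat"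
    and col :: "'p \<Rightarrow> bool"
  assumes adj_verts: "adj x y \<Longrightarrow> x \<in> verts \<and> y \<in> verts"
    and adj_sym: "adj x y \<Longrightarrow> adj y x"
    and adj_col: "adj x y \<Longrightarrow> col x \<noteq> col y"
    and d_zero: "\<lbrakk>x \<in> verts; y \<in> verts\<rbrakk> \<Longrightarrow> d x y = 0 \<longleftrightarrow> x = y"
    and d_sym: "\<lbrakk>x \<in> verts; y \<in> verts\<rbrakk> \<Longrightarrow> d x y = d y x"
    and d_adj: "\<lbrakk>p \<in> verts; adj x y\<rbrakk> \<Longrightarrow> d p x = Suc (d p y) \<or> d p y = Suc (d p x)"
    and closer: "\<lbrakk>p \<in> verts; x \<in> verts; p \<noteq> x\<rbrakk> \<Longrightarrow> \<exists>y. adj x y \<and> d p x = Suc (d p y)"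
    and closer_unique: "\<lbrakk>p \<in> verts; adj x y; adj x z; d p x = Suc (d p y); d p x = Suc (d p z)\<rbrakk> \<Longrightarrow> y = z"
begin

lemma d_self [simp]: "x \<in> verts \<Longrightarrow> d x x = 0"
  using d_zero by blast

text \<open>A tree is encoded by levels: seen from any base, adjacent vertices differ by one, and
  each vertex other than the base has exactly one nearer neighbour. So the triangle inequality is
  derived, by walking from \<open>z\<close> towards \<open>y\<close>.\<close>

lemma d_tri:
  assumes "x \<in> verts" "y \<in> verts" "z \<in> verts"
  shows "d x z \<le> d x y + d y z"
  using assms
proof (induction "d y z" arbitrary: z)
  case 0
  then show ?case using d_zero by auto
next
  case (Suc n)
  then have "y \<noteq> z" using d_zero by (metis Zero_not_Suc)
  then obtain z' where z': "adj z z'" "d y z = Suc (d y z')" using closer Suc.prems by blast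
  then have "d x z' \<le> d x y + d y z'" using Suc adj_verts by (metis Suc_inject)
  moreover have "d x z \<le> Suc (d x z')" using d_adj[OF Suc.prems(1) z'(1)] by linarith
  ultimately show ?case using z' by linarith
qed

lemma d_adj_one: "adj x y \<Longrightarrow> d x y = 1"
  using d_adj[of x x y] d_zero[of x x] adj_verts[of x y] by auto

lemma d_parity:
  assumes "x \<in> verts" "y \<in> verts"
  shows "even (d x y) \<longleftrightarrow> col x = col y"
  using assms
proof (induction "d x y" arbitrary: y)
  case 0
  then show ?case using d_zero by auto
next
  case (Suc n)
  then have "x \<noteq> y" using d_zero by (metis Zero_not_Suc)
  then obtain y' where y': "adj y y'" "d x y = Suc (d x y')" using closer Suc.prems by blast
  then have "even (d x y') \<longleftrightarrow> col x = col y'" using Suc adj_verts by (metis Suc_inject)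
  then show ?case using y' adj_col[OF y'(1)] by auto
qed

text \<open>Once a path without backtracking steps away from \<open>p\<close>, it never turns back:
  the vertex just left is the only neighbour nearer to \<open>p\<close>, and the path does not
  return to it.\<close>

lemma away:
  assumes p: "p \<in> verts"
    and adj: "\<And>i. i < n \<Longrightarrow> adj (f i) (f (Suc i))"
    and nb: "\<And>i. Suc (Suc i) \<le> n \<Longrightarrow> f i \<noteq> f (Suc (Suc i))"
    and start: "n > 0 \<Longrightarrow> d p (f 1) = Suc (d p (f 0))"
    and i: "i \<le> n"
  shows "d p (f i) = d p (f 0) + i"
proof -
  have "i < n \<Longrightarrow> d p (f (Suc i)) = Suc (d p (f i))" for i
  proof (induction i)
    case 0
    then show ?case using start by simp
  next
    case (Suc i)
    then have 1: "d p (f (Suc i)) = Suc (d p (f i))" by simp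
    have a: "adj (f (Suc i)) (f i)" "adj (f (Suc i)) (f (Suc (Suc i)))"
      using adj[of i] adj[of "Suc i"] adj_sym Suc by auto
    have "f i \<noteq> f (Suc (Suc i))" using nb Suc by auto
    then have "d p (f (Suc i)) \<noteq> Suc (d p (f (Suc (Suc i))))"
      using closer_unique[OF p a] 1 by auto
    then show ?case using d_adj[OF p a(2)] by auto
  qed
  then show ?thesis using i by (induction i) auto
qed

section \<open>Bi-infinite geodesics and the projection to them\<close>

definition line :: "(int \<Rightarrow> 'p) \<Rightarrow> bool" where
  "line A \<longleftrightarrow> (\<forall>i. adj (A i) (A (i + 1)) \<and> A i \<noteq> A (i + 2))"

lemma line_verts: "line A \<Longrightarrow> A i \<in> verts"
  unfolding line_def using adj_verts by blast

lemma line_away_up: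
  assumes A: "line A" and p: "p \<in> verts" and s: "d p (A (c + 1)) = Suc (d p (A c))"
  shows "d p (A (c + int n)) = d p (A c) + n"
proof -
  have "d p ((\<lambda>n. A (c + int n)) n) = d p ((\<lambda>n. A (c + int n)) 0) + n"
  proof (rule away[OF p, of n])
    fix i
    have "adj (A (c + int i)) (A (c + int i + 1)) \<and> A (c + int i) \<noteq> A (c + int i + 2)"
      using A unfolding line_def by blast
    moreover have "c + int i + 1 = c + int (Suc i)" "c + int i + 2 = c + int (Suc (Suc i))" by simp_all
    ultimately show "adj (A (c + int i)) (A (c + int (Suc i)))" "A (c + int i) \<noteq> A (c + int (Suc (Suc i)))"
      by metis+
  qed (use s in \<open>auto\<close>)
  then show ?thesis by simp
qed

lemma line_rev: "line A \<Longrightarrow> line (\<lambda>i. A (- i))"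
proof -
  assume A: "line A"
  have "adj (A (- i)) (A (- (i + 1)))" for i
  proof -
    have "adj (A (- (i + 1))) (A (- (i + 1) + 1))" using A unfolding line_def by blast
    then show ?thesis using adj_sym by simp
  qed
  moreover have "A (- i) \<noteq> A (- (i + 2))" for i
  proof -
    have "A (-(i+2)) \<noteq> A (-(i+2) + 2)" using A unfolding line_def by blast
    then show ?thesis by (simp add: algebra_simps)
  qed
  ultimately show ?thesis unfolding line_def by blast
qed

lemma line_away_down:
  assumes A: "line A" and p: "p \<in> verts" and s: "d p (A (c - 1)) = Suc (d p (A c))"
  shows "d p (A (c - int n)) = d p (A c) + n"
  using line_away_up[OF line_rev[OF A] p, of "- c" n] s
  by (simp add: algebra_simps)

definition is_foot :: "(int \<Rightarrow> 'p) \<Rightarrow> 'p \<Rightarrow> int \<Rightarrow> bool" where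
  "is_foot A p c \<longleftrightarrow> (\<forall>i. int (d p (A i)) = int (d p (A c)) + \<bar>i - c\<bar>)"

text \<open>At an index of minimal distance to \<open>p\<close> both line neighbours are farther
  from \<open>p\<close>, and \<open>away\<close> propagates this along both rays.\<close>

lemma foot_exists:
  assumes A: "line A" and p: "p \<in> verts"
  shows "\<exists>c. is_foot A p c"
proof -
  obtain c where c: "\<And>i. d p (A c) \<le> d p (A i)"
    using ex_has_least_nat[of "\<lambda>_. True" undefined "\<lambda>i. d p (A i)"] by auto
  have a: "adj (A c) (A (c + 1))" "adj (A (c - 1)) (A (c - 1 + 1))"
    using A unfolding line_def by blast+
  have s: "d p (A (c + 1)) = Suc (d p (A c))" "d p (A (c - 1)) = Suc (d p (A c))"
    using d_adj[OF p a(1)] d_adj[OF p a(2)] c[of "c+1"] c[of "c-1"] by auto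
  have "int (d p (A i)) = int (d p (A c)) + \<bar>i - c\<bar>" for i
  proof (cases "i \<ge> c")
    case True
    then show ?thesis using line_away_up[OF A p s(1), of "nat (i - c)"] by simp
  next
    case False
    then show ?thesis using line_away_down[OF A p s(2), of "nat (c - i)"] by simp
  qed
  then show ?thesis unfolding is_foot_def by blast
qed

definition foot :: "(int \<Rightarrow> 'p) \<Rightarrow> 'p \<Rightarrow> int" where
  "foot A p = (SOME c. is_foot A p c)"

lemma is_foot_foot: "line A \<Longrightarrow> p \<in> verts \<Longrightarrow> is_foot A p (foot A p)"
  unfolding foot_def using foot_exists someI_ex by metis

lemma foot_d: "line A \<Longrightarrow> p \<in> verts \<Longrightarrow> int (d p (A i)) = int (d p (A (foot A p))) + \<bar>i - foot A p\<bar>"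
  using is_foot_foot unfolding is_foot_def by blast

lemma is_foot_unique: "is_foot A p a \<Longrightarrow> is_foot A p b \<Longrightarrow> a = b"
proof -
  assume a: "is_foot A p a" and b: "is_foot A p b"
  have "int (d p (A b)) = int (d p (A a)) + \<bar>b - a\<bar>" using a unfolding is_foot_def by blast
  moreover have "int (d p (A a)) = int (d p (A b)) + \<bar>a - b\<bar>" using b unfolding is_foot_def by blast
  ultimately show ?thesis by linarith
qed

lemma foot_eq: "line A \<Longrightarrow> p \<in> verts \<Longrightarrow> is_foot A p c \<Longrightarrow> foot A p = c"
  using is_foot_foot is_foot_unique by blast

lemma line_d: assumes A: "line A" shows "int (d (A i) (A j)) = \<bar>i - j\<bar>"
proof -
  let ?c = "foot A (A i)"
  have "int (d (A i) (A i)) = int (d (A i) (A ?c)) + \<bar>i - ?c\<bar>"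
    using foot_d[OF A line_verts[OF A]] by blast
  then have "?c = i" using d_zero[of "A i" "A i"] line_verts[OF A] by auto
  then show ?thesis using foot_d[OF A line_verts[OF A], of i j] line_verts[OF A, of i] by simp
qed

lemma foot_line: "line A \<Longrightarrow> foot A (A i) = i"
  by (rule foot_eq) (simp_all add: line_verts is_foot_def line_d abs_minus_commute)

lemma geodesic_path:
  assumes "x \<in> verts" "y \<in> verts"
  shows "\<exists>f. f 0 = x \<and> f (d x y) = y \<and> (\<forall>i<d x y. adj (f i) (f (Suc i))) \<and>
    (\<forall>i\<le>d x y. d x (f i) = i \<and> f i \<in> verts)"
  using assms
proof (induction "d x y" arbitrary: y)
  case 0
  then show ?case using d_zero by (intro exI[of _ "\<lambda>_. x"]) auto
next
  case (Suc n)
  then have "x \<noteq> y" using d_zero by (metis Zero_not_Suc)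
  then obtain y' where y': "adj y y'" "d x y = Suc (d x y')" using closer Suc.prems by blast
  then obtain f where f: "f 0 = x" "f n = y'" "\<forall>i<n. adj (f i) (f (Suc i))"
    "\<forall>i\<le>n. d x (f i) = i \<and> f i \<in> verts"
    using Suc adj_verts by (metis Suc_inject)
  define h where "h = f(Suc n := y)"
  have hl: "h i = f i" if "i \<le> n" for i using that unfolding h_def by simp
  have hn: "h (Suc n) = y" unfolding h_def by simp
  have dn: "d x y = Suc n" using Suc.hyps(2) by simp
  have "adj (h i) (h (Suc i))" if "i < Suc n" for i
  proof (cases "i = n")
    case True
    then show ?thesis using hl hn f(2) adj_sym[OF y'(1)] by simp
  next
    case False
    then show ?thesis using that hl f(3) by simp
  qed
  moreover have "d x (h i) = i \<and> h i \<in> verts" if "i \<le> Suc n" for i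
  proof (cases "i = Suc n")
    case True
    then show ?thesis using hn dn Suc.prems(2) by simp
  next
    case False
    then show ?thesis using that hl f(4) by simp
  qed
  moreover have "h 0 = x" using hl f(1) by simp
  ultimately show ?case unfolding dn using hn by blast
qed

text \<open>The geodesic from the foot of \<open>q\<close> to \<open>q\<close> leaves the line at
  once. So it does not start with the line neighbour leading back to the foot of \<open>p\<close>,
  the only neighbour nearer to \<open>p\<close>, and hence runs away from \<open>p\<close> all the
  way.\<close>

lemma d_feet:
  assumes A: "line A" and p: "p \<in> verts" and q: "q \<in> verts"
    and ne: "foot A p \<noteq> foot A q"
  shows "int (d p q) = int (d p (A (foot A p))) + \<bar>foot A p - foot A q\<bar> + int (d (A (foot A q)) q)"
proof -
  define a where "a = foot A p"
  define b where "b = foot A q"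
  have Xv: "A i \<in> verts" for i using line_verts[OF A] .
  obtain f where f: "f 0 = A b" "f (d (A b) q) = q" "\<forall>i<d (A b) q. adj (f i) (f (Suc i))"
    "\<forall>i\<le>d (A b) q. d (A b) (f i) = i \<and> f i \<in> verts"
    using geodesic_path[OF Xv q] by blast
  define n where "n = d (A b) q"
  \<comment> \<open>The line neighbour in the direction of the foot of \<open>p\<close>: nearer to
    \<open>p\<close>, but farther from \<open>q\<close>.\<close>
  define y where "y = (if a < b then A (b - 1) else A (b + 1))"
  have "adj (A b) (A (b + 1))" "adj (A (b - 1)) (A (b - 1 + 1))"
    using A unfolding line_def by blast+
  then have ya: "adj (A b) y" unfolding y_def using adj_sym by simp
  have yp: "d p (A b) = Suc (d p y)"
  proof -
    have "int (d p (A b)) = int (d p (A a)) + \<bar>b - a\<bar>" unfolding a_def by (rule foot_d[OF A p])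
    moreover have "int (d p y) = int (d p (A a)) + \<bar>b - a\<bar> - 1"
    proof (cases "a < b")
      case True
      then show ?thesis using foot_d[OF A p, of "b - 1", folded a_def] True unfolding y_def if_P[OF True] by linarith
    next
      case False
      then have "b < a" using ne a_def b_def by linarith
      then show ?thesis using foot_d[OF A p, of "b + 1", folded a_def] \<open>b < a\<close> unfolding y_def if_not_P[OF False] by linarith
    qed
    ultimately show ?thesis by linarith
  qed
  have yq: "d q y = Suc (d q (A b))"
  proof -
    have "d q (A (b - 1)) = Suc (d q (A b))" "d q (A (b + 1)) = Suc (d q (A b))"
      using foot_d[OF A q, of "b - 1", folded b_def] foot_d[OF A q, of "b + 1", folded b_def]
      by linarith+
    then show ?thesis unfolding y_def by simp
  qed
  have st: "d p (f 1) = Suc (d p (f 0))" if n0: "n > 0"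
  proof -
    have adj1: "adj (A b) (f 1)" using f n0 n_def by force
    have "f 1 \<noteq> y"
    proof
      assume "f 1 = y"
      have "d (f 0) q = n" using f n_def by simp
      have "d q (f n) = 0" using f n_def d_zero q by simp
      have "k \<le> n \<Longrightarrow> d q (f (n - k)) \<le> k" for k
      proof (induction k)
        case 0 then show ?case using f n_def d_zero q by simp
      next
        case (Suc k)
        then have "adj (f (n - Suc k)) (f (n - k))" using f(3) n_def
          by (metis Suc_diff_Suc Suc_le_lessD diff_less n0 zero_less_Suc)
        then show ?case using d_adj[OF q, of "f (n - Suc k)" "f (n - k)"] Suc by force
      qed
      from this[of "n - 1"] n0 have "d q (f 1) \<le> n - 1" by simp
      then show False using yq \<open>f 1 = y\<close> n_def d_sym[OF q Xv[of b]] n0 by (metis Suc_n_not_le_n diff_le_self le_trans)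
    qed
    then have "d p (A b) \<noteq> Suc (d p (f 1))"
      using closer_unique[OF p adj1 ya _ yp] by blast
    then show ?thesis using d_adj[OF p adj1] f(1) by auto
  qed
  have "d p (f n) = d p (f 0) + n"
  proof (rule away[OF p, of n])
    fix i assume "Suc (Suc i) \<le> n"
    then have "d (A b) (f i) = i" "d (A b) (f (Suc (Suc i))) = Suc (Suc i)"
      using f(4) n_def by auto
    then show "f i \<noteq> f (Suc (Suc i))" by force
  qed (use f n_def st in auto)
  then have "d p q = d p (A b) + n" using f n_def by simp
  moreover have "int (d p (A b)) = int (d p (A a)) + \<bar>b - a\<bar>" unfolding a_def by (rule foot_d[OF A p])
  ultimately show ?thesis unfolding a_def[symmetric] b_def[symmetric] n_def by linarith
qed

lemma foot_lipschitz:
  assumes "line A" "p \<in> verts" "q \<in> verts"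
  shows "\<bar>foot A p - foot A q\<bar> \<le> int (d p q)"
  using d_feet[OF assms] by (cases "foot A p = foot A q") (simp, linarith)

section \<open>Betweenness\<close>

definition btw :: "'p \<Rightarrow> 'p \<Rightarrow> 'p \<Rightarrow> bool" where
  "btw p z x \<longleftrightarrow> p \<in> verts \<and> z \<in> verts \<and> x \<in> verts \<and> d p z + d z x = d p x"

text \<open>A step of the start that does not go towards \<open>z\<close> leaves the geodesic and
  lengthens the distances to \<open>z\<close> and to \<open>x\<close> alike, so \<open>z\<close>
  stays on the geodesic as long as the start has not moved past it.\<close>

lemma btw_merge:
  assumes "btw p z x" "p' \<in> verts" "d p p' \<le> d p z"
  shows "btw p' z x"
  using assms
proof (induction "d p p'" arbitrary: p)
  case 0
  then show ?case using d_zero unfolding btw_def by auto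
next
  case (Suc n)
  have vs: "p \<in> verts" "z \<in> verts" "x \<in> verts" and bt: "d p z + d z x = d p x"
    using Suc.prems unfolding btw_def by auto
  have "p' \<noteq> p" using Suc d_zero vs by (metis Zero_not_Suc)
  then obtain p1 where p1: "adj p p1" "d p' p = Suc (d p' p1)"
    using closer[OF Suc.prems(2) vs(1)] by blast
  have p1v: "p1 \<in> verts" using adj_verts p1 by blast
  have n1: "n = d p1 p'" using Suc.hyps(2) p1 d_sym[OF Suc.prems(2) vs(1)] d_sym[OF Suc.prems(2) p1v] by linarith
  have pz: "p \<noteq> z" using Suc.prems(3) Suc.hyps(2) d_zero vs by (metis Zero_not_Suc le_zero_eq)
  have "btw p1 z x \<and> d p1 p' \<le> d p1 z"
  proof (cases "d z p = Suc (d z p1)")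
    case True
    have t: "d p1 x \<le> d p1 z + d z x" using d_tri p1v vs by blast
    have sy: "d z p = d p z" "d z p1 = d p1 z" "d x p = d p x" "d x p1 = d p1 x" by (auto intro: d_sym simp: vs p1v)
    have "d x p = Suc (d x p1)" using d_adj[OF vs(3) p1(1)] t True bt sy by linarith
    then have "d p1 z + d z x = d p1 x" "d p1 p' \<le> d p1 z"
      using True sy bt n1 Suc.prems(3) Suc.hyps(2) by linarith+
    then show ?thesis unfolding btw_def using vs p1v by blast
  next
    case False
    then have F: "d z p1 = Suc (d z p)" using d_adj[OF vs(2) p1(1)] by blast
    obtain y where y: "adj p y" "d z p = Suc (d z y)" using closer[OF vs(2) vs(1)] pz by blast
    have yv: "y \<in> verts" using y adj_verts by blast
    have t: "d y x \<le> d y z + d z x" using d_tri yv vs by blast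
    have sy: "d z p = d p z" "d z p1 = d p1 z" "d x p = d p x" "d x p1 = d p1 x" "d x y = d y x" "d z y = d y z" by (auto intro: d_sym simp: vs p1v yv)
    have yx: "d x p = Suc (d x y)" using d_adj[OF vs(3) y(1)] t y bt sy by linarith
    have "y \<noteq> p1" using F y by auto
    then have "d x p1 = Suc (d x p)" using closer_unique[OF vs(3) y(1) p1(1) yx] d_adj[OF vs(3) p1(1)] by auto
    then have "d p1 z + d z x = d p1 x" "d p1 p' \<le> d p1 z"
      using F sy bt n1 Suc.prems(3) Suc.hyps(2) by linarith+
    then show ?thesis unfolding btw_def using vs p1v by blast
  qed
  then show ?case using Suc.hyps(1)[OF n1] Suc.prems(2) by blast
qed

text \<open>Both geodesics leave \<open>p\<close> through the same vertex, the only neighbour nearer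
  to \<open>x\<close>.\<close>

lemma btw_unique:
  assumes "btw p z x" "btw p z' x" "d z x = d z' x"
  shows "z = z'"
  using assms
proof (induction "d p z" arbitrary: p)
  case 0
  then show ?case using d_zero unfolding btw_def by (metis add_0 add_right_cancel)
next
  case (Suc n)
  have vs: "p \<in> verts" "z \<in> verts" "x \<in> verts" "z' \<in> verts" and bt: "d p z + d z x = d p x"
     "d p z' + d z' x = d p x"
    using Suc.prems unfolding btw_def by auto
  have eq: "d p z' = d p z" using bt Suc.prems(3) by simp
  have ne: "p \<noteq> z" "p \<noteq> z'" using Suc.hyps(2) eq d_zero vs by (metis Zero_not_Suc)+
  have *: "\<exists>y. adj p y \<and> d w p = Suc (d w y) \<and> d x p = Suc (d x y) \<and> btw y w x"
    if w: "w \<in> verts" "p \<noteq> w" "d p w + d w x = d p x" for w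
  proof -
    obtain y where y: "adj p y" "d w p = Suc (d w y)" using closer w vs by metis
    have yv: "y \<in> verts" using y adj_verts by blast
    have t: "d y x \<le> d y w + d w x" using d_tri yv vs w by blast
    have sy: "d w p = d p w" "d x p = d p x" "d x y = d y x" "d w y = d y w" by (auto intro: d_sym simp: vs w(1) yv)
    have yx: "d x p = Suc (d x y)" using d_adj[OF vs(3) y(1)] t y w(3) sy by linarith
    then have "d y w + d w x = d y x" using y w(3) sy by linarith
    then show ?thesis using y yx yv w vs unfolding btw_def by blast
  qed
  obtain y where y: "adj p y" "d z p = Suc (d z y)" "d x p = Suc (d x y)" "btw y z x"
    using *[OF vs(2) ne(1) bt(1)] by blast
  obtain y' where y': "adj p y'" "d z' p = Suc (d z' y')" "d x p = Suc (d x y')" "btw y' z' x"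
    using *[OF vs(4) ne(2) bt(2)] by blast
  have "y = y'" using closer_unique[OF vs(3) y(1) y'(1) y(3) y'(3)] .
  moreover have "n = d y z" using Suc.hyps(2) y(2) d_sym[OF vs(1,2)] d_sym[OF vs(2) conjunct2[OF adj_verts[OF y(1)]]] by linarith
  ultimately show ?case using Suc.hyps(1) y(4) y'(4) Suc.prems(3) by blast
qed

lemma btw_line:
  assumes A: "line A" and p: "p \<in> verts" and q: "q \<in> verts"
    and i: "foot A p \<le> i \<and> i \<le> foot A q \<or> foot A q \<le> i \<and> i \<le> foot A p"
    and ne: "foot A p \<noteq> foot A q"
  shows "btw p (A i) q"
proof -
  have "int (d p (A i)) + int (d (A i) q) = int (d p q)"
    using d_feet[OF A p q ne] foot_d[OF A p, of i] foot_d[OF A q, of i] i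
      d_sym[OF q line_verts[OF A, of i]] d_sym[OF q line_verts[OF A, of "foot A q"]] by linarith
  then show ?thesis unfolding btw_def using p q line_verts[OF A] by (metis of_nat_add of_nat_eq_iff)
qed

end

section \<open>Groups acting on trees\<close>

locale tree_act = tree verts adj d col + group Gr
  for verts :: "'p set" and adj d col and Gr :: "('a, 'b) monoid_scheme" (structure) +
  fixes act :: "'a \<Rightarrow> 'p \<Rightarrow> 'p"
  assumes act_closed [simp]: "\<lbrakk>g \<in> carrier Gr; x \<in> verts\<rbrakk> \<Longrightarrow> act g x \<in> verts"
    and act_mult: "\<lbrakk>g \<in> carrier Gr; h \<in> carrier Gr; x \<in> verts\<rbrakk> \<Longrightarrow> act (g \<otimes> h) x = act g (act h x)"
    and act_one [simp]: "x \<in> verts \<Longrightarrow> act \<one> x = x"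
    and act_adj: "\<lbrakk>g \<in> carrier Gr; adj x y\<rbrakk> \<Longrightarrow> adj (act g x) (act g y)"
    and act_col: "\<lbrakk>g \<in> carrier Gr; x \<in> verts\<rbrakk> \<Longrightarrow> col (act g x) = col x"
begin

lemma act_inv [simp]:
  assumes "g \<in> carrier Gr" "x \<in> verts"
  shows "act (inv g) (act g x) = x" "act g (act (inv g) x) = x"
  using assms act_mult[of "inv g" g x] act_mult[of g "inv g" x] by auto

lemma act_inj: "\<lbrakk>g \<in> carrier Gr; x \<in> verts; y \<in> verts\<rbrakk> \<Longrightarrow> act g x = act g y \<longleftrightarrow> x = y"
  by (metis act_inv(1))

lemma d_act_le:
  assumes g: "g \<in> carrier Gr" and "x \<in> verts" "y \<in> verts"
  shows "d (act g x) (act g y) \<le> d x y"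
  using assms(2,3)
proof (induction "d x y" arbitrary: y)
  case 0
  then show ?case using d_zero g by (metis act_closed le_refl)
next
  case (Suc n)
  then have "x \<noteq> y" using d_zero by (metis Zero_not_Suc)
  then obtain y' where y': "adj y y'" "d x y = Suc (d x y')" using closer Suc.prems by blast
  have y'v: "y' \<in> verts" using y' adj_verts by blast
  have "d (act g x) (act g y') \<le> d x y'" using Suc y' y'v by (metis Suc_inject)
  moreover have "d (act g x) (act g y) \<le> Suc (d (act g x) (act g y'))"
    using d_adj[OF act_closed[OF g Suc.prems(1)] act_adj[OF g y'(1)]] by linarith
  ultimately show ?case using y' by linarith
qed

lemma d_act [simp]:
  assumes g: "g \<in> carrier Gr" and x: "x \<in> verts" and y: "y \<in> verts"
  shows "d (act g x) (act g y) = d x y"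
proof -
  have "d (act (inv g) (act g x)) (act (inv g) (act g y)) \<le> d (act g x) (act g y)"
    using d_act_le[of "inv g" "act g x" "act g y"] g x y by (metis act_closed inv_closed)
  then show ?thesis using d_act_le[OF g x y] act_inv(1)[OF g x] act_inv(1)[OF g y] by simp
qed

lemma act_pow_Suc: "\<lbrakk>g \<in> carrier Gr; x \<in> verts\<rbrakk> \<Longrightarrow> act (g [^] Suc n) x = act g (act (g [^] n) x)"
  by (subst nat_pow_Suc2) (simp_all add: act_mult)

section \<open>Axes and translation lengths\<close>

definition is_axis :: "'a \<Rightarrow> (int \<Rightarrow> 'p) \<Rightarrow> int \<Rightarrow> bool" where
  "is_axis g A \<tau> \<longleftrightarrow> line A \<and> \<tau> > 0 \<and> (\<forall>i. act g (A i) = A (i + \<tau>))"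

lemma is_axisD: "is_axis g A \<tau> \<Longrightarrow> line A" "is_axis g A \<tau> \<Longrightarrow> \<tau> > 0"
  "is_axis g A \<tau> \<Longrightarrow> act g (A i) = A (i + \<tau>)"
  unfolding is_axis_def by auto

lemma axis_pow:
  assumes g: "g \<in> carrier Gr" and A: "is_axis g A \<tau>"
  shows "act (g [^] (n::nat)) (A i) = A (i + int n * \<tau>)"
proof (induction n)
  case 0
  then show ?case using line_verts[OF is_axisD(1)[OF A]] by simp
next
  case (Suc n)
  then show ?case using act_pow_Suc[OF g line_verts[OF is_axisD(1)[OF A]]] is_axisD(3)[OF A]
    by (simp add: algebra_simps)
qed

text \<open>The path serves as one period. Its translates under the powers of \<open>g\<close> fit
  together to a line once there is no backtracking where one translate follows another.\<close>

lemma axis_from_path: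
  assumes g: "g \<in> carrier Gr" and m: "m \<ge> 1"
    and f: "\<And>i. i < m \<Longrightarrow> adj (f i) (f (Suc i))"
    and nb: "\<And>i. Suc (Suc i) \<le> m \<Longrightarrow> f i \<noteq> f (Suc (Suc i))"
    and fm: "f m = act g (f 0)" and nbm: "act g (f 1) \<noteq> f (m - 1)"
  shows "\<exists>A. is_axis g A (int m) \<and> A 0 = f 0 \<and> A 1 = f 1"
proof -
  define A where "A i = act (g [^] (i div int m)) (f (nat (i mod int m)))" for i :: int
  have m0: "int m > 0" using m by simp
  have fv: "f i \<in> verts" if "i \<le> m" for i
  proof (cases "i < m")
    case True
    then show ?thesis using f adj_verts by blast
  next
    case False
    then show ?thesis using f[of "m - 1"] adj_verts[of "f (m - 1)" "f m"] that m by simp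
  qed
  have pw: "g [^] (k::int) \<in> carrier Gr" for k using g by simp
  have gk: "act (g [^] (k + 1)) x = act (g [^] k) (act g x)" if "x \<in> verts" for k :: int and x
    using act_mult[OF pw[of k] g that] int_pow_mult[OF g, of k 1] g by (simp add: int_pow_1)
  have gk': "act g (act (g [^] k) x) = act (g [^] (k + 1)) x" if "x \<in> verts" for k :: int and x
  proof -
    have "g \<otimes> g [^] k = g [^] (k + 1)" using int_pow_mult[OF g, of 1 k] g by (simp add: int_pow_1 add.commute)
    then show ?thesis using act_mult[OF g pw[of k] that] by simp
  qed
  have dec: "\<exists>k r. i = k * int m + int r \<and> r < m" for i
    using m0 by (intro exI[of _ "i div int m"] exI[of _ "nat (i mod int m)"]) (auto simp: nat_less_iff)
  have Aform: "A (k * int m + int r) = act (g [^] k) (f r)" if "r \<le> m" for k r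
  proof (cases "r = m")
    case True
    have "k * int m + int r = (k + 1) * int m" using True by (simp add: algebra_simps)
    then have "A (k * int m + int r) = act (g [^] (k + 1)) (f 0)" unfolding A_def using m0 by simp
    then show ?thesis using True fm gk[OF fv[of 0]] by simp
  next
    case False
    then show ?thesis unfolding A_def using that by simp
  qed
  have "adj (A i) (A (i + 1)) \<and> A i \<noteq> A (i + 2) \<and> act g (A i) = A (i + int m)" for i
  proof -
    obtain k r where kr: "i = k * int m + int r" "r < m" using dec by blast
    have e0: "A i = act (g [^] k) (f r)" using kr Aform by simp
    have "i + 1 = k * int m + int (Suc r)" using kr by simp
    then have e1: "A (i + 1) = act (g [^] k) (f (Suc r))" using Aform[of "Suc r" k] kr by (metis Suc_leI)
    have 1: "adj (A i) (A (i + 1))" using e0 e1 act_adj[OF pw f] kr by simp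
    have 2: "A i \<noteq> A (i + 2)"
    proof (cases "Suc (Suc r) \<le> m")
      case True
      have "i + 2 = k * int m + int (Suc (Suc r))" using kr by simp
      then have "A (i + 2) = act (g [^] k) (f (Suc (Suc r)))" using Aform[OF True] by metis
      then show ?thesis using e0 nb[OF True] act_inj[OF pw fv fv] True kr by simp
    next
      case False
      then have r: "r = m - 1" using kr by simp
      have "i + 2 = (k + 1) * int m + int 1" using kr r m by (simp add: algebra_simps)
      then have "A (i + 2) = act (g [^] (k + 1)) (f 1)" using Aform[of 1 "k + 1"] m by metis
      then have "A (i + 2) = act (g [^] k) (act g (f 1))" using gk fv m by simp
      then show ?thesis using e0 r nbm act_inj[OF pw fv act_closed[OF g fv]] m by auto
    qed
    have "i + int m = (k + 1) * int m + int r" using kr by (simp add: algebra_simps)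
    then have "A (i + int m) = act (g [^] (k + 1)) (f r)" using Aform kr by (metis less_imp_le)
    then have 3: "act g (A i) = A (i + int m)" using e0 gk' fv kr by simp
    show ?thesis using 1 2 3 by blast
  qed
  then have "is_axis g A (int m)" unfolding is_axis_def line_def using m by auto
  moreover have "A 0 = f 0" "A 1 = f 1" using Aform[of 0 0] Aform[of 1 0] m fv by auto
  ultimately show ?thesis by blast
qed

definition elliptic :: "'a \<Rightarrow> bool" where
  "elliptic g \<longleftrightarrow> (\<exists>x\<in>verts. act g x = x)"

text \<open>A vertex of minimal displacement lies on an axis: if the geodesic to its image and the
  translate of that geodesic backtracked at their junction, the second vertex \<open>f 1\<close>
  would be moved by at most \<open>m - 2\<close>.\<close>

lemma elliptic_or_axis:
  assumes g: "g \<in> carrier Gr" and ne: "\<not> elliptic g" and v0: "v0 \<in> verts"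
  shows "\<exists>A \<tau>. is_axis g A \<tau>"
proof -
  obtain x where x: "x \<in> verts" "\<And>y. y \<in> verts \<Longrightarrow> d x (act g x) \<le> d y (act g y)"
    using ex_has_least_nat[of "\<lambda>x. x \<in> verts" v0 "\<lambda>x. d x (act g x)"] v0 by blast
  define m where "m = d x (act g x)"
  have "m \<noteq> 0" using ne x g d_zero unfolding elliptic_def m_def by (metis act_closed)
  \<comment> \<open>Preserving colours makes displacements even, which rules out the inversion of an
    edge.\<close>
  moreover have "even m" using d_parity[OF x(1) act_closed[OF g x(1)]] act_col[OF g x(1)] m_def by simp
  ultimately have m2: "m \<ge> 2" by auto
  obtain f where f: "f 0 = x" "f m = act g x" "\<forall>i<m. adj (f i) (f (Suc i))"
    "\<forall>i\<le>m. d x (f i) = i \<and> f i \<in> verts"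
    using geodesic_path[OF x(1) act_closed[OF g x(1)]] unfolding m_def by blast
  have "act g (f 1) \<noteq> f (m - 1)"
  proof
    assume eq: "act g (f 1) = f (m - 1)"
    have f1: "f 1 \<in> verts" using f(4) m2 by simp
    have "d (f 1) (f (Suc i)) \<le> i" if "Suc i \<le> m" for i
      using that
    proof (induction i)
      case 0
      then show ?case using f1 by simp
    next
      case (Suc i)
      then have "adj (f (Suc i)) (f (Suc (Suc i)))" using f(3) by simp
      then show ?case using d_adj[OF f1, of "f (Suc i)" "f (Suc (Suc i))"] Suc by force
    qed
    from this[of "m - 2"] have "d (f 1) (f (m - 1)) \<le> m - 2" using m2
      by (metis Suc_1 Suc_diff_Suc diff_le_self le_imp_less_Suc less_le_trans lessI plus_1_eq_Suc le_add_diff_inverse Suc_le_lessD)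
    moreover have "m \<le> d (f 1) (act g (f 1))" using x(2)[OF f1] m_def by simp
    ultimately show False using eq m2 by simp
  qed
  moreover have "f i \<noteq> f (Suc (Suc i))" if "Suc (Suc i) \<le> m" for i
  proof -
    have "d x (f i) = i" "d x (f (Suc (Suc i))) = Suc (Suc i)" using f(4) that by auto
    then show ?thesis by force
  qed
  ultimately show ?thesis using axis_from_path[OF g, of m f] f m2 by fastforce
qed

lemma foot_act_axis:
  assumes g: "g \<in> carrier Gr" and A: "is_axis g A \<tau>" and p: "p \<in> verts"
  shows "foot A (act g p) = foot A p + \<tau>"
proof (rule foot_eq[OF is_axisD(1)[OF A] act_closed[OF g p]], unfold is_foot_def, intro allI)
  fix i
  have v: "A j \<in> verts" for j using line_verts[OF is_axisD(1)[OF A]] .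
  have *: "d (act g p) (A j) = d p (A (j - \<tau>))" for j
    using d_act[OF g p v[of "j - \<tau>"]] is_axisD(3)[OF A, of "j - \<tau>"] by simp
  show "int (d (act g p) (A i)) = int (d (act g p) (A (foot A p + \<tau>))) + \<bar>i - (foot A p + \<tau>)\<bar>"
    unfolding * using foot_d[OF is_axisD(1)[OF A] p, of "i - \<tau>"] by (simp add: algebra_simps)
qed

lemma foot_act_axis_pow:
  assumes g: "g \<in> carrier Gr" and A: "is_axis g A \<tau>" and p: "p \<in> verts"
  shows "foot A (act (g [^] (n::nat)) p) = foot A p + int n * \<tau>"
proof (induction n)
  case 0
  then show ?case using p by simp
next
  case (Suc n)
  have v: "act (g [^] n) p \<in> verts" using g p by simp
  show ?case using foot_act_axis[OF g A v] Suc act_pow_Suc[OF g p, of n] by (simp add: algebra_simps)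
qed

lemma axis_period_le:
  assumes g: "g \<in> carrier Gr" and A: "is_axis g A \<tau>" and p: "p \<in> verts"
  shows "\<tau> \<le> int (d p (act g p))"
  using foot_lipschitz[OF is_axisD(1)[OF A] p act_closed[OF g p]] foot_act_axis[OF g A p] by linarith

lemma axis_not_elliptic:
  assumes g: "g \<in> carrier Gr" and A: "is_axis g A \<tau>"
  shows "\<not> elliptic g"
proof
  assume "elliptic g"
  then obtain p where p: "p \<in> verts" "act g p = p" unfolding elliptic_def by blast
  then show False using axis_period_le[OF g A p(1)] is_axisD(2)[OF A] by simp
qed

text \<open>If \<open>q\<close> has distance \<open>H\<close> from the axis, then \<open>g\<close>
  moves it by \<open>2 * H + \<tau>\<close> and the square of \<open>g\<close> by
  \<open>2 * H + 2 * \<tau>\<close>, so doubling forces \<open>H = 0\<close>. This places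
  \<open>q\<close> on whichever axis is given.\<close>

lemma on_axis:
  assumes g: "g \<in> carrier Gr" and A: "is_axis g A \<tau>" and q: "q \<in> verts"
    and e: "d q (act g (act g q)) = 2 * d q (act g q)"
  shows "\<exists>i. q = A i"
proof -
  define a where "a = foot A q"
  define H where "H = int (d q (A a))"
  have L: "line A" and t: "\<tau> > 0" using is_axisD[OF A] by auto
  have v: "A j \<in> verts" for j using line_verts[OF L] .
  have gq: "act g q \<in> verts" "act g (act g q) \<in> verts" using g q by auto
  have f1: "foot A (act g q) = a + \<tau>" using foot_act_axis[OF g A q] a_def by simp
  have f2: "foot A (act g (act g q)) = a + 2 * \<tau>" using foot_act_axis[OF g A gq(1)] f1 by simp
  have h1: "int (d (A (a + \<tau>)) (act g q)) = H"
    using d_act[OF g v[of a] q] is_axisD(3)[OF A, of a] d_sym[OF q v[of a]] H_def by simp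
  have h2: "int (d (A (a + 2 * \<tau>)) (act g (act g q))) = H"
    using d_act[OF g v[of "a + \<tau>"] gq(1)] is_axisD(3)[OF A, of "a + \<tau>"] h1 by (simp add: algebra_simps)
  have "int (d q (act g q)) = H + \<tau> + H"
    using d_feet[OF L q gq(1)] f1 h1 a_def H_def t by auto
  moreover have "int (d q (act g (act g q))) = H + 2 * \<tau> + H"
    using d_feet[OF L q gq(2)] f2 h2 a_def H_def t by auto
  ultimately have "H = 0" using e by linarith
  then show ?thesis using d_zero q v H_def by auto
qed

section \<open>Fixing, reversing and pushing parts of a line\<close>

lemma fix_between:
  assumes z: "z \<in> carrier Gr" and b: "btw p w x" and "act z p = p" "act z x = x"
  shows "act z w = w"
proof -
  have vs: "p \<in> verts" "w \<in> verts" "x \<in> verts" "d p w + d w x = d p x" using b unfolding btw_def by auto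
  have "d p (act z w) = d p w" "d (act z w) x = d w x"
    using d_act[OF z vs(1,2)] d_act[OF z vs(2,3)] assms by auto
  then have "btw p (act z w) x" unfolding btw_def using vs z by auto
  then show ?thesis using btw_unique[OF _ b] \<open>d (act z w) x = d w x\<close> by blast
qed

lemma fix_line_between:
  assumes z: "z \<in> carrier Gr" and A: "line A" and "act z (A i) = A i" "act z (A j) = A j"
    and "i \<le> k" "k \<le> j"
  shows "act z (A k) = A k"
proof (rule fix_between[OF z _ assms(3,4)])
  have "int (d (A i) (A k)) + int (d (A k) (A j)) = int (d (A i) (A j))"
    using line_d[OF A] assms(5,6) by simp
  then show "btw (A i) (A k) (A j)" unfolding btw_def using line_verts[OF A]
    by (metis of_nat_add of_nat_eq_iff)
qed

text \<open>The geodesic from \<open>p\<close> to \<open>x\<close> runs up the line, the one from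
  \<open>p\<close> to \<open>act g x\<close> runs down. The image of the first starts near
  \<open>p\<close> and also ends in \<open>act g x\<close>, so by \<open>btw_merge\<close> it joins
  the second after at most \<open>d p (act g p)\<close> steps; there \<open>g\<close> reverses the
  line. Comparing distances to \<open>act g x\<close> gives \<sigma>.\<close>

lemma reverse_segment:
  assumes A: "line A" and g: "g \<in> carrier Gr" and p: "p \<in> verts" and x: "x \<in> verts"
    and fx: "foot A x \<ge> foot A p + E + 1" and fgx: "foot A (act g x) \<le> foot A p - E - 1"
    and E: "E \<ge> 0"
  shows "\<exists>\<sigma>. \<forall>i. foot A p - E - 1 + int (d p (act g p)) \<le> i \<and> i \<le> foot A p - int (d p (act g p)) \<longrightarrow>
           act g (A (\<sigma> - i)) = A i"
proof -
  define c where "c = foot A p"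
  define l where "l = int (d p (act g p))"
  \<comment> \<open>The deviation of the reversal from the reflection at \<open>c\<close>, at most
    the displacement of \<open>p\<close>.\<close>
  define e where "e = int (d p x) - int (d p (act g x))"
  have v: "A j \<in> verts" for j using line_verts[OF A] .
  have gp: "act g p \<in> verts" and gx: "act g x \<in> verts" using g p x by auto
  have e': "\<bar>e\<bar> \<le> l"
  proof -
    have "d (act g p) (act g x) = d p x" using d_act g p x by simp
    moreover have "d (act g p) (act g x) \<le> d (act g p) p + d p (act g x)"
      "d p (act g x) \<le> d p (act g p) + d (act g p) (act g x)" using d_tri p gp gx by blast+
    ultimately show ?thesis unfolding e_def l_def using d_sym[OF p gp] by linarith
  qed
  have "act g (A (2 * c + e - i)) = A i" if i: "c - E - 1 + l \<le> i" "i \<le> c - l" for i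
  proof -
    define j where "j = 2 * c + e - i"
    have j: "c \<le> j" "j \<le> c + E + 1" using i e' unfolding j_def by linarith+
    have b1: "btw p (A i) (act g x)"
      by (rule btw_line[OF A p gx]) (use i fgx E l_def c_def in linarith)+
    have di: "int (d p (A i)) = int (d p (A c)) + (c - i)"
      using foot_d[OF A p, of i] i l_def unfolding c_def by linarith
    have b2: "btw (act g p) (A i) (act g x)"
      by (rule btw_merge[OF b1 gp]) (use di i l_def in linarith)
    have b3: "btw p (A j) x"
      by (rule btw_line[OF A p x]) (use j fx E c_def in linarith)+
    have dj: "int (d p (A j)) = int (d p (A c)) + (j - c)"
      using foot_d[OF A p, of j] j unfolding c_def by linarith
    have b4: "btw (act g p) (act g (A j)) (act g x)"
      using b3 unfolding btw_def using g p x v by simp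
    have "int (d (act g (A j)) (act g x)) = int (d (A j) x)" using g x v by simp
    moreover have "int (d (A j) x) = int (d p x) - int (d p (A j))" using b3 unfolding btw_def by linarith
    moreover have "int (d (A i) (act g x)) = int (d p (act g x)) - int (d p (A i))" using b1 unfolding btw_def by linarith
    ultimately have "d (act g (A j)) (act g x) = d (A i) (act g x)"
      using di dj unfolding j_def e_def by linarith
    then show ?thesis using btw_unique[OF b4 b2] j_def by simp
  qed
  then show ?thesis unfolding c_def l_def by blast
qed

definition flips :: "'a \<Rightarrow> (int \<Rightarrow> 'p) \<Rightarrow> bool" where
  "flips g A \<longleftrightarrow> (\<exists>\<sigma>. \<forall>i. act g (A i) = A (\<sigma> - i))"

text \<open>A weak form of acylindricity: an element fixing a sufficiently long part of an axis, measured
  in periods, fixes the whole axis.\<close>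

definition rigid_axes :: "nat \<Rightarrow> bool" where
  "rigid_axes m \<longleftrightarrow> (\<forall>t A \<tau> z a. t \<in> carrier Gr \<longrightarrow> z \<in> carrier Gr \<longrightarrow> is_axis t A \<tau> \<longrightarrow>
     (\<forall>i. a \<le> i \<and> i \<le> a + int m * \<tau> \<longrightarrow> act z (A i) = A i) \<longrightarrow> (\<forall>i. act z (A i) = A i))"

text \<open>If a point far up the line went far down, \<open>g\<close> would reverse a segment of
  more than \<open>m + 1\<close> periods. There \<open>g t g\<^sup>-\<^sup>1\<close> translates
  downwards, so \<open>z\<close> fixes \<open>m\<close> periods and by rigidity the whole line; the
  reversal then spreads from period to period. The first summand of \<open>E\<close> pays for the
  loss at the two ends in \<open>reverse_segment\<close>.\<close>

lemma flips_or_pushes: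
  assumes m: "rigid_axes m" and t: "t \<in> carrier Gr" and A: "is_axis t A \<tau>"
    and g: "g \<in> carrier Gr" and p: "p \<in> verts"
    and E: "E = 2 * int (d p (act g p)) + (int m + 1) * \<tau>"
    and nf: "\<not> flips g A" and x: "x \<in> verts" and fx: "foot A x \<ge> foot A p + E + 1"
  shows "foot A (act g x) \<ge> foot A p - E"
proof (rule ccontr)
  assume "\<not> ?thesis"
  then have fgx: "foot A (act g x) \<le> foot A p - E - 1" by simp
  have L: "line A" and tau: "\<tau> > 0" using is_axisD[OF A] by auto
  have v: "A j \<in> verts" for j using line_verts[OF L] .
  have E0: "E \<ge> 0" using E tau by simp
  define a where "a = foot A p - E - 1 + int (d p (act g p))"
  define b where "b = foot A p - int (d p (act g p))"
  obtain \<sigma> where s: "\<And>i. a \<le> i \<Longrightarrow> i \<le> b \<Longrightarrow> act g (A (\<sigma> - i)) = A i"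
    using reverse_segment[OF L g p x fx fgx E0] unfolding a_def b_def by blast
  have ab: "b - a = (int m + 1) * \<tau> + 1" unfolding a_def b_def E by simp
  define z where "z = g \<otimes> t \<otimes> inv g \<otimes> t"
  have zc: "z \<in> carrier Gr" unfolding z_def using g t by simp
  have zact: "act z y = act g (act t (act (inv g) (act t y)))" if "y \<in> verts" for y
    unfolding z_def using that g t by (simp add: act_mult)
  have inv: "act (inv g) (A i) = A (\<sigma> - i)" if "a \<le> i" "i \<le> b" for i
    using s[OF that] act_inv(1)[OF g v, of "\<sigma> - i"] by simp
  have "act z (A i) = A i" if "a \<le> i" "i \<le> a + int m * \<tau>" for i
  proof -
    have "i + \<tau> \<le> b" using that ab by (simp add: algebra_simps)
    then have "act (inv g) (A (i + \<tau>)) = A (\<sigma> - (i + \<tau>))" using inv that tau by simp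
    then show ?thesis using zact[OF v] is_axisD(3)[OF A] s[of i] \<open>i + \<tau> \<le> b\<close> that tau by simp
  qed
  then have zfix: "act z (A i) = A i" for i
    using m t A zc unfolding rigid_axes_def by blast
  have shift: "act t (act (inv g) (A (i + \<tau>))) = act (inv g) (A i)" for i
  proof -
    have "act g (act t (act (inv g) (A (i + \<tau>)))) = A i"
      using zfix[of i] zact[OF v] is_axisD(3)[OF A] by simp
    then show ?thesis using act_inv(1)[OF g, of "act t (act (inv g) (A (i + \<tau>)))"] g t v by simp
  qed
  define Q where "Q i \<longleftrightarrow> act (inv g) (A i) = A (\<sigma> - i)" for i
  have up: "Q i \<Longrightarrow> Q (i + \<tau>)" for i
  proof -
    assume "Q i"
    then have "act t (act (inv g) (A (i + \<tau>))) = act t (A (\<sigma> - (i + \<tau>)))"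
      using shift[of i] is_axisD(3)[OF A] unfolding Q_def by simp
    then show ?thesis unfolding Q_def using act_inj[OF t] g v by simp
  qed
  have down: "Q i \<Longrightarrow> Q (i - \<tau>)" for i
    using shift[of "i - \<tau>"] is_axisD(3)[OF A, of "\<sigma> - i"] unfolding Q_def
    by (simp add: algebra_simps)
  have up': "Q i \<Longrightarrow> Q (i + int n * \<tau>)" for i n
  proof (induction n)
    case (Suc n)
    then show ?case using up[of "i + int n * \<tau>"] by (simp add: algebra_simps)
  qed simp
  have down': "Q i \<Longrightarrow> Q (i - int n * \<tau>)" for i n
  proof (induction n)
    case (Suc n)
    then show ?case using down[of "i - int n * \<tau>"] by (simp add: algebra_simps)
  qed simp
  \<comment> \<open>The segment from \<open>a\<close> to \<open>b\<close> meets every residue class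
    modulo \<tau>.\<close>
  have Qall: "Q i" for i
  proof -
    define r where "r = a + (i - a) mod \<tau>"
    have mm: "0 \<le> (i - a) mod \<tau>" "(i - a) mod \<tau> < \<tau>" using tau by auto
    have "0 \<le> int m * \<tau>" using tau by simp
    moreover have "b = a + int m * \<tau> + \<tau> + 1" using ab by (simp add: algebra_simps)
    ultimately have "a \<le> r" "r \<le> b" using mm unfolding r_def by linarith+
    then have "Q r" using inv unfolding Q_def by simp
    have ir: "i = r + ((i - a) div \<tau>) * \<tau>" unfolding r_def
      using div_mult_mod_eq[of "i - a" \<tau>] by simp
    show ?thesis
    proof (cases "(i - a) div \<tau> \<ge> 0")
      case True
      then show ?thesis using up'[OF \<open>Q r\<close>, of "nat ((i - a) div \<tau>)"] ir by simp
    next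
      case False
      then show ?thesis using down'[OF \<open>Q r\<close>, of "nat (- ((i - a) div \<tau>))"] ir by simp
    qed
  qed
  have "act g (A i) = A (\<sigma> - i)" for i
    using Qall[of "\<sigma> - i"] act_inv(2)[OF g v[of "\<sigma> - i"]] unfolding Q_def by simp
  then show False using nf unfolding flips_def by blast
qed

text \<open>The half tree beyond \<open>j\<close> is mapped deep into itself. Each further power of
  \<open>g\<close> puts another stretch of length \<open>s\<close> between a point outside and the
  image of a point inside, so orbits escape at speed at least \<open>s\<close>. This excludes fixed
  points and bounds the period from below.\<close>

lemma skewer:
  assumes A: "line A" and g: "g \<in> carrier Gr" and s: "s \<ge> 1"
    and push: "\<And>x. x \<in> verts \<Longrightarrow> foot A x \<ge> j \<Longrightarrow> foot A (act g x) \<ge> j + s"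
  shows "\<exists>B \<tau>. is_axis g B \<tau> \<and> \<tau> \<ge> s"
proof -
  have v: "A j \<in> verts" for j using line_verts[OF A] .
  have it: "act (g [^] n) x \<in> verts \<and> foot A (act (g [^] n) x) \<ge> j" if "x \<in> verts" "foot A x \<ge> j" for n :: nat and x
  proof (induction n)
    case (Suc n)
    then show ?case using push[of "act (g [^] n) x"] act_pow_Suc[OF g that(1)] g s by simp
  qed (use that in simp)
  have key: "int (d y (act (g [^] n) x)) \<ge> int n * s"
    if "y \<in> verts" "foot A y \<le> j - 1" "x \<in> verts" "foot A x \<ge> j" for y x and n :: nat
    using that
  proof (induction n arbitrary: y)
    case 0
    then show ?case by simp
  next
    case (Suc n)
    define w where "w = A (j + s - 1)"
    define u where "u = act (g [^] Suc n) x"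
    have wv: "w \<in> verts" and uv: "u \<in> verts" unfolding w_def u_def using v g Suc.prems by auto
    have u: "u = act g (act (g [^] n) x)" unfolding u_def using act_pow_Suc[OF g Suc.prems(3)] .
    have fu: "foot A u \<ge> j + s" using push it[OF Suc.prems(3,4), of n] u by simp
    have b: "btw y w u" unfolding w_def
      by (rule btw_line[OF A Suc.prems(1) uv]) (use fu Suc.prems s in linarith)+
    have fw: "foot A w = j + s - 1" unfolding w_def using foot_line[OF A] .
    \<comment> \<open>The foot of \<open>w\<close> is just below \<open>j + s\<close>, so the
      preimage of \<open>w\<close> lies outside the half tree and the induction hypothesis applies
      to it.\<close>
    have "foot A (act (inv g) w) \<le> j - 1"
    proof (rule ccontr)
      assume "\<not> ?thesis"
      then have "foot A (act g (act (inv g) w)) \<ge> j + s" using push[of "act (inv g) w"] g wv by simp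
      then show False using fw g wv by simp
    qed
    then have "int n * s \<le> int (d (act (inv g) w) (act (g [^] n) x))"
      using Suc.IH[of "act (inv g) w"] g wv Suc.prems by simp
    also have "d (act (inv g) w) (act (g [^] n) x) = d w u"
    proof -
      have "act (g [^] n) x \<in> verts" using g Suc.prems by simp
      then show ?thesis using d_act[OF g, of "act (inv g) w" "act (g [^] n) x"] u g wv by simp
    qed
    finally have 1: "int n * s \<le> int (d w u)" .
    have "s \<le> int (d y w)"
      using foot_lipschitz[OF A Suc.prems(1) wv] fw Suc.prems(2) by linarith
    then show ?case using 1 b unfolding btw_def u_def by (simp add: algebra_simps)
  qed
  define y where "y = A (j - 1)"
  define x where "x = A j"
  have yv: "y \<in> verts" and xv: "x \<in> verts" unfolding y_def x_def using v by auto
  have key': "int n * s \<le> int (d y (act (g [^] n) x))" for n :: nat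
    using key[of y x n] yv xv foot_line[OF A] unfolding y_def x_def by simp
  have ne: "\<not> elliptic g"
  proof
    assume "elliptic g"
    then obtain q where q: "q \<in> verts" "act g q = q" unfolding elliptic_def by blast
    have qn: "act (g [^] n) q = q" for n :: nat
      by (induction n) (use act_pow_Suc[OF g q(1)] q in auto)
    have "int n * s \<le> int (d y q) + int (d q x)" for n :: nat
    proof -
      have "d y (act (g [^] n) x) \<le> d y q + d q (act (g [^] n) x)" using d_tri yv q xv g by simp
      also have "d q (act (g [^] n) x) = d q x" using d_act[of "g [^] n" q x] qn g q xv by simp
      finally show ?thesis using key'[of n] by linarith
    qed
    from this[of "Suc (d y q + d q x)"] s show False
      by (smt (verit) mult_le_cancel_left1 of_nat_Suc of_nat_add of_nat_less_0_iff mult.commute mult_le_mono1 of_nat_0_le_iff)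
  qed
  then obtain B \<tau> where B: "is_axis g B \<tau>" using elliptic_or_axis[OF g _ yv] by blast
  have Bv: "B i \<in> verts" for i using line_verts[OF is_axisD(1)[OF B]] .
  have bd: "int n * s \<le> int (d y (B 0)) + int (d (B 0) x) + int n * \<tau>" for n :: nat
  proof -
    have "d y (act (g [^] n) x) \<le> d y (B 0) + d (B 0) (act (g [^] n) x)" using d_tri yv xv g Bv by simp
    moreover have "d (B 0) (act (g [^] n) x) \<le> d (B 0) (act (g [^] n) (B 0)) + d (act (g [^] n) (B 0)) (act (g [^] n) x)"
      by (rule d_tri) (use xv g Bv in simp_all)
    moreover have "int (d (B 0) (act (g [^] n) (B 0))) = int n * \<tau>"
      using axis_pow[OF g B, of n 0] line_d[OF is_axisD(1)[OF B], of 0 "int n * \<tau>"] is_axisD(2)[OF B] by simp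
    moreover have "d (act (g [^] n) (B 0)) (act (g [^] n) x) = d (B 0) x" using xv g Bv by simp
    ultimately show ?thesis using key'[of n] by linarith
  qed
  have "s \<le> \<tau>"
  proof (rule ccontr)
    assume "\<not> s \<le> \<tau>"
    then have "\<tau> + 1 \<le> s" by simp
    define n where "n = Suc (d y (B 0) + d (B 0) x)"
    have "int n * (\<tau> + 1) \<le> int n * s" using \<open>\<tau> + 1 \<le> s\<close> by (intro mult_left_mono) auto
    then have "int n \<le> int (d y (B 0)) + int (d (B 0) x)" using bd[of n] by (simp add: algebra_simps)
    then show False unfolding n_def by simp
  qed
  then show ?thesis using B by blast
qed

lemma foot_act_fix:
  assumes A: "line A" and z: "z \<in> carrier Gr" and f: "\<And>i. act z (A i) = A i" and x: "x \<in> verts"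
  shows "foot A (act z x) = foot A x"
proof (rule foot_eq[OF A act_closed[OF z x]], unfold is_foot_def, intro allI)
  fix i
  have *: "d (act z x) (A j) = d x (A j)" for j
    using d_act[OF z x line_verts[OF A, of j]] f by simp
  show "int (d (act z x) (A i)) = int (d (act z x) (A (foot A x))) + \<bar>i - foot A x\<bar>"
    unfolding * by (rule foot_d[OF A x])
qed

lemma flips_square:
  assumes A: "line A" and g: "g \<in> carrier Gr" and fl: "flips g A"
  shows "act (g \<otimes> g) (A i) = A i"
proof -
  obtain \<sigma> where "\<And>i. act g (A i) = A (\<sigma> - i)" using fl unfolding flips_def by blast
  then show ?thesis using act_mult[OF g g line_verts[OF A]] by simp
qed

definition pushes :: "'a \<Rightarrow> (int \<Rightarrow> 'p) \<Rightarrow> int \<Rightarrow> int \<Rightarrow> bool" where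
  "pushes g A j s \<longleftrightarrow> (\<forall>x\<in>verts. foot A x \<ge> j \<longrightarrow> foot A (act g x) \<ge> j + s)"

text \<open>Squaring makes a flipping \<open>h\<close> harmless: \<open>h \<otimes> h\<close> then
  fixes the line and leaves all feet in place, and the gain comes from \<open>f\<close>.\<close>

lemma squares_skewer:
  assumes A: "line A" and f: "f \<in> carrier Gr" and h: "h \<in> carrier Gr" and s: "s \<ge> 1"
    and pf: "pushes f A j s" and ph: "pushes h A j s \<or> flips h A"
  shows "\<exists>B \<tau>. is_axis (f \<otimes> f \<otimes> (h \<otimes> h)) B \<tau> \<and> \<tau> \<ge> s"
proof (rule skewer[OF A _ s])
  show "f \<otimes> f \<otimes> (h \<otimes> h) \<in> carrier Gr" using f h by simp
  fix x assume x: "x \<in> verts" "foot A x \<ge> j"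
  have 1: "foot A (act (h \<otimes> h) x) \<ge> j"
    using ph
  proof
    assume "pushes h A j s"
    then have "foot A (act h x) \<ge> j" "foot A (act h (act h x)) \<ge> j"
      using x h s unfolding pushes_def by (force, smt (verit) act_closed)
    then show ?thesis using act_mult h x by simp
  next
    assume "flips h A"
    then show ?thesis using foot_act_fix[OF A _ flips_square[OF A h] x(1)] x h by simp
  qed
  define y where "y = act (h \<otimes> h) x"
  have y: "y \<in> verts" "foot A y \<ge> j" unfolding y_def using 1 x h by auto
  have "foot A (act f y) \<ge> j + s" using pf y unfolding pushes_def by blast
  then have "foot A (act f (act f y)) \<ge> j + s" using pf y f s unfolding pushes_def by (smt (verit) act_closed)
  then show "foot A (act (f \<otimes> f \<otimes> (h \<otimes> h)) x) \<ge> j + s"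
    using act_mult[of "f \<otimes> f" "h \<otimes> h" x] act_mult[of f f y] f h x y unfolding y_def by simp
qed

end

text \<open>If \<open>b\<close> or \<open>t\<close> acts hyperbolically then so does this word, for suitable exponents: an axis can be
  reversed by at most one of \<open>b\<^sup>P\<close> and \<open>b\<^sup>2\<^sup>P\<close> (or \<open>t\<^sup>Q\<close> and \<open>t\<^sup>2\<^sup>Q\<close>), a square of a reversing factor
  fixes the axis, and the other factor pushes along it.\<close>

definition jword :: "('a, 'b) monoid_scheme \<Rightarrow> nat \<Rightarrow> nat \<Rightarrow> 'a \<Rightarrow> 'a \<Rightarrow> 'a" where
  "jword M P Q b t =
     ((b [^]\<^bsub>M\<^esub> P \<otimes>\<^bsub>M\<^esub> t [^]\<^bsub>M\<^esub> Q) \<otimes>\<^bsub>M\<^esub> (b [^]\<^bsub>M\<^esub> P \<otimes>\<^bsub>M\<^esub> t [^]\<^bsub>M\<^esub> Q)) \<otimes>\<^bsub>M\<^esub>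
     ((b [^]\<^bsub>M\<^esub> (2 * P) \<otimes>\<^bsub>M\<^esub> t [^]\<^bsub>M\<^esub> (2 * Q)) \<otimes>\<^bsub>M\<^esub> (b [^]\<^bsub>M\<^esub> (2 * P) \<otimes>\<^bsub>M\<^esub> t [^]\<^bsub>M\<^esub> (2 * Q)))"

context tree_act
begin

section \<open>Axes of the words\<close>

lemma pow_double: "g \<in> carrier Gr \<Longrightarrow> g [^] (2 * n :: nat) = g [^] n \<otimes> g [^] n"
  by (simp add: nat_pow_mult mult_2)

text \<open>If \<open>g1\<close> flips the axis, its square \<open>g2\<close> fixes it, so
  \<open>h\<close> translates while \<open>f \<otimes> f\<close> is trivial there. Otherwise
  \<open>f\<close> pushes and \<open>h\<close> pushes or flips. The index \<open>j\<close> is placed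
  so that the power of \<open>t\<close> carries its half tree beyond
  \<open>foot A p + E + 1\<close>, and \<open>g1\<close> or \<open>g2\<close> brings that back at
  most to \<open>foot A p - E\<close>, which is \<open>j + 2 * \<tau>\<close>.\<close>

lemma jword_axis_right:
  assumes m: "rigid_axes m" and b: "b \<in> carrier Gr" and t: "t \<in> carrier Gr"
    and A: "is_axis t A \<tau>" and p: "p \<in> verts"
    and l: "d p (act (b [^] P) p) \<le> l" "d p (act (b [^] (2 * P)) p) \<le> l"
    and Q: "Q \<ge> 4 * l + 2 * m + 5"
  shows "\<exists>B \<sigma>. is_axis (jword Gr P Q b t) B \<sigma> \<and> \<sigma> \<ge> 2 * \<tau>"
proof -
  have L: "line A" and tau: "\<tau> > 0" using is_axisD[OF A] by auto
  have v: "A j \<in> verts" for j using line_verts[OF L] .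
  define E where "E = 2 * int l + (int m + 1) * \<tau>"
  define j where "j = foot A p - E - 2 * \<tau>"
  define g1 where "g1 = b [^] P"
  define g2 where "g2 = b [^] (2 * P)"
  have gc: "g1 \<in> carrier Gr" "g2 \<in> carrier Gr" "g2 = g1 \<otimes> g1"
    unfolding g1_def g2_def using b pow_double by auto
  define f where "f = g1 \<otimes> t [^] Q"
  define h where "h = g2 \<otimes> t [^] (2 * Q)"
  have fc: "f \<in> carrier Gr" "h \<in> carrier Gr" unfolding f_def h_def using gc t by auto
  have Jeq: "jword Gr P Q b t = f \<otimes> f \<otimes> (h \<otimes> h)"
    unfolding jword_def f_def h_def g1_def g2_def ..
  \<comment> \<open>The right side is \<open>4 * l + (2 * m + 4) * \<tau> + 1\<close>, which
    \<open>4 * l + 2 * m + 5\<close> periods cover because \<open>\<tau> \<ge> 1\<close>.\<close>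
  have Qt: "int N * \<tau> \<ge> 2 * E + 1 + 2 * \<tau>" if "N \<ge> Q" for N
  proof -
    have "int N \<ge> 4 * int l + 2 * int m + 5" using Q that by linarith
    then have "int N * \<tau> \<ge> (4 * int l + 2 * int m + 5) * \<tau>" using tau by (intro mult_right_mono) auto
    moreover have "4 * int l * \<tau> \<ge> 4 * int l" using tau by (simp add: mult_le_cancel_left1)
    ultimately show ?thesis unfolding E_def using tau by (simp add: algebra_simps)
  qed
  have push: "pushes (g \<otimes> t [^] N) A j (2 * \<tau>)"
    if g: "g \<in> carrier Gr" "d p (act g p) \<le> l" "\<not> flips g A" "N \<ge> Q" for g N
    unfolding pushes_def
  proof (intro ballI impI)
    fix x assume x: "x \<in> verts" "j \<le> foot A x"
    define E' where "E' = 2 * int (d p (act g p)) + (int m + 1) * \<tau>"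
    have E': "E' \<le> E" unfolding E_def E'_def using g(2) by simp
    have y: "act (t [^] N) x \<in> verts" using t x by simp
    have "foot A (act (t [^] N) x) \<ge> foot A p + E' + 1"
      using foot_act_axis_pow[OF t A x(1), of N] Qt[OF g(4)] x(2) E' unfolding j_def by linarith
    then have "foot A (act g (act (t [^] N) x)) \<ge> foot A p - E'"
      using flips_or_pushes[OF m t A g(1) p E'_def g(3) y] by blast
    then show "j + 2 * \<tau> \<le> foot A (act (g \<otimes> t [^] N) x)"
      using act_mult[OF g(1), of "t [^] N" x] t x E' unfolding j_def by simp
  qed
  have flip: "flips (g \<otimes> t [^] N) A" if g: "g \<in> carrier Gr" "flips g A" for g and N :: nat
  proof -
    obtain \<sigma> where "\<And>i. act g (A i) = A (\<sigma> - i)" using g unfolding flips_def by blast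
    then have "act (g \<otimes> t [^] N) (A i) = A (\<sigma> - int N * \<tau> - i)" for i
      using act_mult[OF g(1) _ v, of "t [^] N"] t axis_pow[OF t A] by (simp add: algebra_simps)
    then show ?thesis unfolding flips_def by blast
  qed
  show ?thesis
  proof (cases "flips g1 A")
    case True
    have g2fix: "act g2 (A i) = A i" for i using flips_square[OF L gc(1) True] gc(3) by simp
    define w where "w = int (2 * Q) * \<tau>"
    have hA: "act h (A i) = A (i + w)" for i
      unfolding h_def w_def using act_mult[OF gc(2) _ v, of "t [^] (2 * Q)"] t axis_pow[OF t A] g2fix by simp
    have fA: "act (f \<otimes> f) (A i) = A i" for i
      using flips_square[OF L fc(1)] flip[OF gc(1) True] unfolding f_def by blast
    have "act (jword Gr P Q b t) (A i) = A (i + 2 * w)" for i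
      unfolding Jeq using act_mult[of "f \<otimes> f" "h \<otimes> h" "A i"] act_mult[of h h "A i"] fc v hA fA
      by (simp add: algebra_simps)
    moreover have "w \<ge> 1 * \<tau>" unfolding w_def using Q tau by (intro mult_right_mono) auto
    ultimately have "is_axis (jword Gr P Q b t) A (2 * w)" "2 * w \<ge> 2 * \<tau>"
      unfolding is_axis_def using L tau by auto
    then show ?thesis by blast
  next
    case False
    have pf: "pushes f A j (2 * \<tau>)" unfolding f_def
      by (rule push[OF gc(1) _ False]) (use l g1_def in auto)
    have "pushes h A j (2 * \<tau>) \<or> flips h A"
      using push[OF gc(2), of "2 * Q"] flip[OF gc(2)] l g2_def unfolding h_def by auto
    then show ?thesis unfolding Jeq using squares_skewer[OF L fc _ pf] tau by simp
  qed
qed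

text \<open>The powers of the elliptic \<open>t\<close> share a fixed point \<open>p\<close>, so the
  displacement term of \<open>E\<close> vanishes. This is what allows \<open>P\<close> to be chosen
  from \<open>m\<close> alone, before \<open>b\<close> and \<open>t\<close> are known.\<close>

lemma jword_axis_left:
  assumes m: "rigid_axes m" and b: "b \<in> carrier Gr" and t: "t \<in> carrier Gr"
    and A: "is_axis b A \<tau>" and te: "elliptic t"
    and P: "P \<ge> 2 * m + 4"
  shows "\<exists>B \<sigma>. is_axis (jword Gr P Q b t) B \<sigma>"
proof -
  have L: "line A" and tau: "\<tau> > 0" using is_axisD[OF A] by auto
  have v: "A j \<in> verts" for j using line_verts[OF L] .
  obtain p where p: "p \<in> verts" "act t p = p" using te unfolding elliptic_def by blast
  have pn: "act (t [^] n) p = p" for n :: nat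
    by (induction n) (use act_pow_Suc[OF t p(1)] p in auto)
  define E where "E = (int m + 1) * \<tau>"
  define j where "j = foot A p + E + 1"
  define g1 where "g1 = t [^] Q"
  define g2 where "g2 = t [^] (2 * Q)"
  have gc: "g1 \<in> carrier Gr" "g2 \<in> carrier Gr" "g2 = g1 \<otimes> g1"
    unfolding g1_def g2_def using t pow_double by auto
  define f where "f = b [^] P \<otimes> g1"
  define h where "h = b [^] (2 * P) \<otimes> g2"
  have fc: "f \<in> carrier Gr" "h \<in> carrier Gr" unfolding f_def h_def using gc b by auto
  have Jeq: "jword Gr P Q b t = f \<otimes> f \<otimes> (h \<otimes> h)"
    unfolding jword_def f_def h_def g1_def g2_def ..
  have Pt: "int N * \<tau> \<ge> 2 * E + 2" if "N \<ge> P" for N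
  proof -
    have "int N \<ge> 2 * int m + 4" using P that by linarith
    then have "int N * \<tau> \<ge> (2 * int m + 4) * \<tau>" using tau by (intro mult_right_mono) auto
    then show ?thesis unfolding E_def using tau by (simp add: algebra_simps)
  qed
  have push: "pushes (b [^] N \<otimes> g) A j 1"
    if g: "g \<in> carrier Gr" "act g p = p" "\<not> flips g A" "N \<ge> P" for g N
    unfolding pushes_def
  proof (intro ballI impI)
    fix x assume x: "x \<in> verts" "j \<le> foot A x"
    have E': "E = 2 * int (d p (act g p)) + (int m + 1) * \<tau>" unfolding E_def using g p by simp
    have "foot A (act g x) \<ge> foot A p - E"
      using flips_or_pushes[OF m b A g(1) p(1) E' g(3) x(1)] x(2) unfolding j_def by simp
    then have "foot A (act (b [^] N) (act g x)) \<ge> foot A p - E + int N * \<tau>"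
      using foot_act_axis_pow[OF b A, of "act g x" N] g x by simp
    then show "j + 1 \<le> foot A (act (b [^] N \<otimes> g) x)"
      using act_mult[OF _ g(1), of "b [^] N" x] b x Pt[OF g(4)] unfolding j_def by simp
  qed
  have flip: "flips (b [^] N \<otimes> g) A" if g: "g \<in> carrier Gr" "flips g A" for g and N :: nat
  proof -
    obtain \<sigma> where "\<And>i. act g (A i) = A (\<sigma> - i)" using g unfolding flips_def by blast
    then have "act (b [^] N \<otimes> g) (A i) = A (\<sigma> + int N * \<tau> - i)" for i
      using act_mult[OF _ g(1) v, of "b [^] N"] b axis_pow[OF b A] by (simp add: algebra_simps)
    then show ?thesis unfolding flips_def by blast
  qed
  show ?thesis
  proof (cases "flips g1 A")
    case True
    have g2fix: "act g2 (A i) = A i" for i using flips_square[OF L gc(1) True] gc(3) by simp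
    define w where "w = int (2 * P) * \<tau>"
    have hA: "act h (A i) = A (i + w)" for i
      unfolding h_def w_def using act_mult[OF _ gc(2) v, of "b [^] (2 * P)"] b axis_pow[OF b A] g2fix by simp
    have fA: "act (f \<otimes> f) (A i) = A i" for i
      using flips_square[OF L fc(1)] flip[OF gc(1) True] unfolding f_def by blast
    have "act (jword Gr P Q b t) (A i) = A (i + 2 * w)" for i
      unfolding Jeq using act_mult[of "f \<otimes> f" "h \<otimes> h" "A i"] act_mult[of h h "A i"] fc v hA fA
      by (simp add: algebra_simps)
    moreover have "w > 0" unfolding w_def using P tau by simp
    ultimately have "is_axis (jword Gr P Q b t) A (2 * w)"
      unfolding is_axis_def using L tau by auto
    then show ?thesis by blast
  next
    case False
    have pf: "pushes f A j 1" unfolding f_def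
      by (rule push[OF gc(1) _ False]) (use pn g1_def in auto)
    have "pushes h A j 1 \<or> flips h A"
      using push[OF gc(2), of "2 * P"] flip[OF gc(2)] pn g2_def unfolding h_def by auto
    then show ?thesis unfolding Jeq using squares_skewer[OF L fc _ pf] by fastforce
  qed
qed

section \<open>Powers, conjugates and products\<close>

lemma axis_int_pow:
  assumes g: "g \<in> carrier Gr" and A: "is_axis g A \<tau>"
  shows "act (g [^] (j::int)) (A i) = A (i + j * \<tau>)"
proof (cases "j < 0")
  case False
  then obtain n where "j = int n" by (metis nonneg_int_cases not_less)
  then show ?thesis using axis_pow[OF g A, of n i] by (simp add: int_pow_int)
next
  case True
  then obtain n where j: "j = - int n" by (metis int_cases2 of_nat_less_0_iff)
  have v: "A i \<in> verts" for i using line_verts is_axisD(1)[OF A] by blast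
  have "act (g [^] n) (A (i + j * \<tau>)) = A i" using axis_pow[OF g A, of n "i + j * \<tau>"] j by simp
  then have "act (inv (g [^] n)) (A i) = A (i + j * \<tau>)" using act_inv(1)[of "g [^] n" "A (i + j * \<tau>)"] g v by simp
  then show ?thesis unfolding j using int_pow_neg_int[OF g, of n] by simp
qed

lemma axis_conj:
  assumes p: "p \<in> carrier Gr" and t: "t \<in> carrier Gr" and A: "is_axis t A \<tau>"
  shows "is_axis (inv p \<otimes> t \<otimes> p) (\<lambda>i. act (inv p) (A i)) \<tau>"
proof -
  have v: "A i \<in> verts" for i using line_verts is_axisD(1)[OF A] by blast
  have l: "adj (A i) (A (i + 1))" "A i \<noteq> A (i + 2)" for i using is_axisD(1)[OF A] unfolding line_def by auto
  have "act (inv p \<otimes> t \<otimes> p) (act (inv p) (A i)) = act (inv p) (A (i + \<tau>))" for i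
    using p t v is_axisD(3)[OF A, of i] by (simp add: act_mult)
  moreover have "line (\<lambda>i. act (inv p) (A i))"
    unfolding line_def using l act_adj act_inj v p by auto
  ultimately show ?thesis using is_axisD(2)[OF A] unfolding is_axis_def by blast
qed

lemma elliptic_conj:
  assumes p: "p \<in> carrier Gr" and t: "t \<in> carrier Gr" and e: "elliptic t"
  shows "elliptic (inv p \<otimes> t \<otimes> p)"
proof -
  obtain x where x: "x \<in> verts" "act t x = x" using e unfolding elliptic_def by blast
  have "act (inv p \<otimes> t \<otimes> p) (act (inv p) x) = act (inv p) x" using p t x by (simp add: act_mult)
  then show ?thesis unfolding elliptic_def using x p by (intro bexI[of _ "act (inv p) x"]) auto
qed

text \<open>Take the point \<open>q\<close> fixed by \<open>b\<close> that is nearest to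
  \<open>s\<close>. The path from \<open>q\<close> through \<open>s\<close> to
  \<open>act a q\<close>, the image of \<open>q\<close> under the product, does not backtrack at
  \<open>s\<close>, since \<open>a\<close> fixes nothing else, nor where its translate follows,
  since \<open>b\<close> fixes nothing nearer to \<open>s\<close>. So it would be a period of an
  axis.\<close>

lemma fix_of_product:
  assumes a: "a \<in> carrier Gr" and b: "b \<in> carrier Gr" and s: "s \<in> verts" and as: "act a s = s"
    and uniq: "\<And>x. x \<in> verts \<Longrightarrow> act a x = x \<Longrightarrow> x = s"
    and eb: "elliptic b" and eab: "elliptic (a \<otimes> b)"
  shows "act b s = s"
proof (rule ccontr)
  assume ne: "act b s \<noteq> s"
  obtain q0 where "q0 \<in> verts \<and> act b q0 = q0" using eb unfolding elliptic_def by blast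
  then obtain q where q: "q \<in> verts" "act b q = q" and min: "\<And>y. y \<in> verts \<Longrightarrow> act b y = y \<Longrightarrow> d s q \<le> d s y"
    using ex_has_least_nat[of "\<lambda>q. q \<in> verts \<and> act b q = q" q0 "d s"] by blast
  define r where "r = d s q"
  have r: "r > 0" using d_zero[OF s q(1)] ne q(2) unfolding r_def by (metis gr0I)
  obtain h where h: "h 0 = s" "h r = q" "\<And>i. i < r \<Longrightarrow> adj (h i) (h (Suc i))"
    "\<And>i. i \<le> r \<Longrightarrow> d s (h i) = i" "\<And>i. i \<le> r \<Longrightarrow> h i \<in> verts"
    using geodesic_path[OF s q(1)] unfolding r_def[symmetric] by blast
  define f where "f i = (if i \<le> r then h (r - i) else act a (h (i - r)))" for i
  have f2: "f i = act a (h (i - r))" if "i \<ge> r" for i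
    using that as h(1) unfolding f_def by (cases "i = r") auto
  have inj: "h i = h j \<longleftrightarrow> i = j" if "i \<le> r" "j \<le> r" for i j
  proof
    assume "h i = h j"
    then have "d s (h i) = d s (h j)" by (rule arg_cong)
    then show "i = j" unfolding h(4)[OF that(1)] h(4)[OF that(2)] .
  qed simp
  have "\<exists>A. is_axis (a \<otimes> b) A (int (2 * r)) \<and> A 0 = f 0 \<and> A 1 = f 1"
  proof (rule axis_from_path)
    show "a \<otimes> b \<in> carrier Gr" using a b by simp
    show "1 \<le> 2 * r" using r by simp
    show "adj (f i) (f (Suc i))" if "i < 2 * r" for i
    proof (cases "i < r")
      case True
      then have e: "Suc (r - Suc i) = r - i" by simp
      have "adj (h (r - Suc i)) (h (r - i))" using h(3)[of "r - Suc i"] True r unfolding e by simp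
      then show ?thesis using adj_sym True unfolding f_def by auto
    next
      case False
      then have e: "Suc i - r = Suc (i - r)" by simp
      have "adj (h (i - r)) (h (Suc i - r))" using h(3)[of "i - r"] False that unfolding e by simp
      then show ?thesis using act_adj[OF a] f2[of i] f2[of "Suc i"] False by simp
    qed
    show "f i \<noteq> f (Suc (Suc i))" if i: "Suc (Suc i) \<le> 2 * r" for i
    proof -
      consider "Suc (Suc i) \<le> r" | "i \<ge> r" | "Suc i = r" by linarith
      then show ?thesis
      proof cases
        case 1
        then show ?thesis unfolding f_def using inj[of "r - i" "r - Suc (Suc i)"] by auto
      next
        case 2
        have "h (i - r) \<noteq> h (Suc (Suc i) - r)" using inj[of "i - r" "Suc (Suc i) - r"] 2 i by simp
        then show ?thesis using f2[of i] f2[of "Suc (Suc i)"] 2 i act_inj[OF a] h(5) by simp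
      next
        case 3
        have "act a (h 1) \<noteq> h 1" using uniq[of "h 1"] h(5)[of 1] inj[of 1 0] h(1) r by force
        moreover have "f i = h 1" "f (Suc (Suc i)) = act a (h 1)"
          using 3 f2[of "Suc (Suc i)"] unfolding f_def by (auto simp: diff_Suc split: nat.split)
        ultimately show ?thesis by metis
      qed
    qed
    show "f (2 * r) = act (a \<otimes> b) (f 0)"
      using f2[of "2 * r"] r h(2) q a b act_mult[OF a b q(1)] unfolding f_def by simp
    show "act (a \<otimes> b) (f 1) \<noteq> f (2 * r - 1)"
    proof
      assume e: "act (a \<otimes> b) (f 1) = f (2 * r - 1)"
      have f1: "f 1 = h (r - 1)" unfolding f_def using r by simp
      have "f (2 * r - 1) = act a (h (r - 1))" using f2[of "2 * r - 1"] r by simp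
      then have "act a (act b (h (r - 1))) = act a (h (r - 1))"
        using e f1 act_mult[OF a b h(5)[of "r - 1"]] by simp
      then have "act b (h (r - 1)) = h (r - 1)" using act_inj[OF a] act_closed[OF b] h(5)[of "r - 1"] by simp
      then have "r \<le> d s (h (r - 1))" using min[of "h (r - 1)"] h(5)[of "r - 1"] unfolding r_def by simp
      then show False using h(4)[of "r - 1"] r by simp
    qed
  qed
  then show False using axis_not_elliptic eab a b by blast
qed

end

section \<open>Trees from level functions\<close>

definition walk_dist :: "('p \<Rightarrow> 'p \<Rightarrow> bool) \<Rightarrow> 'p \<Rightarrow> 'p \<Rightarrow> nat" where
  "walk_dist adj x y = (LEAST n. (adj ^^ n) x y)"

text \<open>Levels are given only for base points of one colour, the cosets from which letter counts
  measure distances. For the other base points the walk distance is used, and uniqueness of the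
  nearer neighbour is transported from an adjacent base point.\<close>

lemma tree_of_levels:
  fixes verts :: "'p set"
  assumes adj_verts: "\<And>x y. adj x y \<Longrightarrow> x \<in> verts \<and> y \<in> verts"
    and adj_sym: "\<And>x y. adj x y \<Longrightarrow> adj y x"
    and adj_col: "\<And>x y. adj x y \<Longrightarrow> col x \<noteq> col y"
    and nbr: "\<And>x. \<lbrakk>x \<in> verts; \<not> col x\<rbrakk> \<Longrightarrow> \<exists>y. adj x y"
    and L0: "\<And>p x. \<lbrakk>p \<in> verts; col p; x \<in> verts\<rbrakk> \<Longrightarrow> L p x = 0 \<longleftrightarrow> x = p"
    and Ladj: "\<And>p x y. \<lbrakk>p \<in> verts; col p; adj x y\<rbrakk> \<Longrightarrow> L p x = Suc (L p y) \<or> L p y = Suc (L p x)"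
    and Lclose: "\<And>p x. \<lbrakk>p \<in> verts; col p; x \<in> verts; x \<noteq> p\<rbrakk> \<Longrightarrow> \<exists>y. adj x y \<and> L p x = Suc (L p y)"
    and Luniq: "\<And>p x y z. \<lbrakk>p \<in> verts; col p; adj x y; adj x z; L p x = Suc (L p y); L p x = Suc (L p z)\<rbrakk> \<Longrightarrow> y = z"
  shows "tree verts adj (walk_dist adj) col"
    and "\<And>p x. \<lbrakk>p \<in> verts; col p; x \<in> verts\<rbrakk> \<Longrightarrow> walk_dist adj p x = L p x"
proof -
  let ?d = "walk_dist adj"
  have sym: "(adj ^^ n) x y \<Longrightarrow> (adj ^^ n) y x" for n x y
  proof (induction n arbitrary: y)
    case (Suc n)
    then obtain z where "(adj ^^ n) x z" "adj z y" by (meson relpowp_Suc_E)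
    then show ?case using Suc.IH adj_sym relpowp_Suc_I2 by metis
  qed auto
  have trans: "(adj ^^ (m + n)) x z" if "(adj ^^ m) x y" "(adj ^^ n) y z" for m n x y z
    using that relpowp_add[of m n adj] by auto
  have Lle: "L p x \<le> n" if "(adj ^^ n) p x" "p \<in> verts" "col p" for n p x
    using that(1)
  proof (induction n arbitrary: x)
    case 0
    then show ?case using L0[OF that(2,3,2)] by simp
  next
    case (Suc n)
    then obtain z where z: "(adj ^^ n) p z" "adj z x" by (meson relpowp_Suc_E)
    then show ?case using Suc.IH[OF z(1)] Ladj[OF that(2,3) z(2)] by linarith
  qed
  have Lwalk: "(adj ^^ (L p x)) p x" if "p \<in> verts" "col p" "x \<in> verts" for p x
    using that
  proof (induction "L p x" arbitrary: x)
    case 0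
    then show ?case using L0 by (metis relpowp_0_I)
  next
    case (Suc n)
    then have "x \<noteq> p" using L0 by (metis Zero_not_Suc)
    then obtain y where y: "adj x y" "L p x = Suc (L p y)" using Lclose Suc.prems by blast
    then have "(adj ^^ L p y) p y" using Suc adj_verts by (metis Suc_inject)
    then show ?case using y adj_sym relpowp_Suc_I by metis
  qed
  have walk: "\<exists>n. (adj ^^ n) p x" if pv: "p \<in> verts" and xv: "x \<in> verts" for p x
  proof (cases "col p")
    case True
    then show ?thesis using Lwalk pv xv by blast
  next
    case False
    then obtain q where q: "adj p q" using nbr pv by blast
    then have "q \<in> verts" "col q" using adj_verts adj_col False by blast+
    then show ?thesis using Lwalk[of q x] q xv relpowp_Suc_I2 by metis
  qed
  have dw: "(adj ^^ (?d p x)) p x" if "p \<in> verts" "x \<in> verts" for p x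
    using walk[OF that] LeastI_ex unfolding walk_dist_def by fast
  have dle: "?d p x \<le> n" if "(adj ^^ n) p x" for p x n
    using that unfolding walk_dist_def by (rule Least_le)
  show dL: "?d p x = L p x" if "p \<in> verts" "col p" "x \<in> verts" for p x
    using Lle[OF dw] dle[OF Lwalk] that by (meson le_antisym)
  have par: "even n \<longleftrightarrow> col p = col x" if "(adj ^^ n) p x" for n p x
    using that
  proof (induction n arbitrary: x)
    case (Suc n)
    then obtain z where z: "(adj ^^ n) p z" "adj z x" by (meson relpowp_Suc_E)
    then show ?case using Suc.IH[OF z(1)] adj_col[OF z(2)] by auto
  qed auto
  have d_sym: "?d x y = ?d y x" for x y
  proof -
    have "(\<lambda>n. (adj ^^ n) x y) = (\<lambda>n. (adj ^^ n) y x)" using sym by blast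
    then show ?thesis unfolding walk_dist_def by simp
  qed
  have d_step: "?d p y \<le> Suc (?d p x)" if "p \<in> verts" "adj x y" for p x y
    using dle[of "Suc (?d p x)" p y] dw[OF that(1), of x] adj_verts[OF that(2)] that(2) relpowp_Suc_I by metis
  have d_adj: "?d p x = Suc (?d p y) \<or> ?d p y = Suc (?d p x)" if "p \<in> verts" "adj x y" for p x y
  proof -
    have "even (?d p x) \<noteq> even (?d p y)"
      using par[OF dw[OF that(1), of x]] par[OF dw[OF that(1), of y]] adj_verts[OF that(2)] adj_col[OF that(2)] by blast
    then have "?d p x \<noteq> ?d p y" by auto
    then show ?thesis using d_step[OF that] d_step[OF that(1) adj_sym[OF that(2)]] by linarith
  qed
  have d_zero: "?d x y = 0 \<longleftrightarrow> x = y" if "x \<in> verts" "y \<in> verts" for x y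
  proof
    assume "?d x y = 0"
    then show "x = y" using dw[OF that] by simp
  next
    assume "x = y"
    then show "?d x y = 0" using dle[of 0 x y] by simp
  qed
  have closer: "\<exists>y. adj x y \<and> ?d p x = Suc (?d p y)" if pv: "p \<in> verts" and xv: "x \<in> verts" and px: "p \<noteq> x" for p x
  proof -
    obtain n where n: "?d p x = Suc n" using d_zero[OF pv xv] px not0_implies_Suc by metis
    then obtain y where y: "(adj ^^ n) p y" "adj y x" using dw[OF pv xv] by (metis relpowp_Suc_E)
    have "?d p y \<le> n" using dle y by blast
    then have "?d p x = Suc (?d p y)" using d_adj[OF pv y(2)] n by linarith
    then show ?thesis using adj_sym y by blast
  qed
  have uniq: "y = z" if p: "p \<in> verts" and xy: "adj x y" and xz: "adj x z"
    and dy: "?d p x = Suc (?d p y)" and dz: "?d p x = Suc (?d p z)" for p x y z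
  proof (cases "col p")
    case True
    then show ?thesis using Luniq[OF p True xy xz] dL[OF p True] dy dz adj_verts[OF xy] adj_verts[OF xz] by metis
  next
    case False
    show ?thesis
    proof (rule ccontr)
      assume ne: "y \<noteq> z"
      have v: "x \<in> verts" "y \<in> verts" "z \<in> verts" using adj_verts xy xz by blast+
      have py: "y \<noteq> p" and pz: "z \<noteq> p"
        using dy dz ne d_zero[OF p v(2)] d_zero[OF p v(3)] by (metis Suc_inject)+
      \<comment> \<open>Choosing \<open>q\<close> on the side of \<open>y\<close> makes
        \<open>y\<close> the neighbour of \<open>x\<close> nearer to \<open>q\<close>, so
        \<open>z\<close> is farther from \<open>q\<close>. The step from \<open>z\<close> towards
        \<open>p\<close> must then lead to \<open>x\<close>, against the distances from
        \<open>p\<close>.\<close>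
      obtain q where q: "adj p q" "?d y p = Suc (?d y q)" using closer[OF v(2) p] py by blast
      have qv: "q \<in> verts" and qc: "col q" using q adj_verts adj_col False by blast+
      have e1: "?d p y = Suc (?d q y)" using q(2) d_sym by metis
      have xq: "?d q x = Suc (?d q y)"
      proof -
        have "?d q x \<le> Suc (?d q y)" using d_step[OF qv adj_sym[OF xy]] .
        moreover have "?d x p \<le> Suc (?d x q)" using d_step[OF v(1) adj_sym[OF q(1)]] .
        then have "?d p x \<le> Suc (?d q x)" using d_sym by metis
        ultimately show ?thesis using e1 dy by linarith
      qed
      have uq: "y' = z'" if "adj w y'" "adj w z'" "?d q w = Suc (?d q y')" "?d q w = Suc (?d q z')" for w y' z'
        using Luniq[OF qv qc that(1,2)] that dL[OF qv qc] adj_verts[OF that(1)] adj_verts[OF that(2)] by metis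
      have zq: "?d q z = Suc (?d q x)"
        using uq[OF xy xz xq] ne d_adj[OF qv xz] by blast
      obtain y' where y': "adj z y'" "?d p z = Suc (?d p y')" using closer[OF p v(3)] pz by blast
      have y'v: "y' \<in> verts" using y' adj_verts by blast
      have "?d y' q \<le> Suc (?d y' p)" using d_step[OF y'v q(1)] .
      then have "?d q y' \<le> Suc (?d p y')" using d_sym by metis
      moreover have "?d p z = ?d q x" using dz dy e1 xq by linarith
      ultimately have "?d q z = Suc (?d q y')" using d_adj[OF qv y'(1)] zq y'(2) by linarith
      then have "y' = x" using uq[OF y'(1) adj_sym[OF xz] _ zq] by blast
      then show False using y'(2) dz by simp
    qed
  qed
  show "tree verts adj ?d col"
    by unfold_locales (fact adj_verts adj_sym adj_col d_zero d_sym d_adj closer uniq | blast intro: adj_verts adj_sym adj_col d_sym d_zero d_adj closer uniq)+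
qed

section \<open>Reduced words in graph products\<close>

locale graph_prod =
  fixes V :: "'v set" and E :: "'v set set" and G :: "'v \<Rightarrow> 'g monoid"
  assumes graph: "simplicial_graph V E"
    and groups: "\<And>v. v \<in> V \<Longrightarrow> group (G v)"
begin

abbreviation "W \<equiv> gp_words V G"
abbreviation "GP \<equiv> graph_product V E G"
abbreviation gmult (infixl "\<star>" 70) where "a \<star> b \<equiv> a \<otimes>\<^bsub>GP\<^esub> b"
abbreviation iv where "iv a \<equiv> inv\<^bsub>GP\<^esub> a"

lemma edge_irrefl [simp]: "{v} \<notin> E"
  using graph unfolding simplicial_graph_def by (auto simp: singleton_insert_inj_eq')

lemma edge_V: "{u, v} \<in> E \<Longrightarrow> u \<in> V \<and> v \<in> V"
  using graph unfolding simplicial_graph_def by (auto simp: doubleton_eq_iff)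

lemma edge_neq: "{u, v} \<in> E \<Longrightarrow> u \<noteq> v"
  by auto

lemma edge_sym: "{u, v} \<in> E \<Longrightarrow> {v, u} \<in> E"
  by (simp add: insert_commute)

lemma words_Nil [simp]: "[] \<in> W"
  and words_Cons [simp]: "(v, g) # xs \<in> W \<longleftrightarrow> v \<in> V \<and> g \<in> carrier (G v) \<and> xs \<in> W"
  and words_append [simp]: "xs @ ys \<in> W \<longleftrightarrow> xs \<in> W \<and> ys \<in> W"
  by (auto simp: gp_words_def)

lemma step_words: "gp_step V E G xs ys \<Longrightarrow> xs \<in> W \<and> ys \<in> W"
  by (induction rule: gp_step.induct)
    (auto simp: group.is_monoid groups monoid.one_closed monoid.m_closed)

lemma step_context:
  assumes "gp_step V E G xs ys" "as \<in> W" "bs \<in> W"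
  shows "gp_step V E G (as @ xs @ bs) (as @ ys @ bs)"
  using assms(1)
proof cases
  case (del xs ys v)
  then show ?thesis using gp_step.del[of "as @ xs" V G "ys @ bs" v E] assms by simp
next
  case (merge xs ys v g h)
  then show ?thesis using gp_step.merge[of "as @ xs" V G "ys @ bs" v g h E] assms by simp
next
  case (swap xs ys v w g h)
  then show ?thesis using gp_step.swap[of "as @ xs" V G "ys @ bs" v w E g h] assms by simp
qed

section \<open>Equivalence of words and the group law\<close>

definition eqv :: "('v \<times> 'g) list \<Rightarrow> ('v \<times> 'g) list \<Rightarrow> bool" where
  "eqv xs ys \<longleftrightarrow> (xs, ys) \<in> gp_rel V E G"

lemma eqv_words: "eqv xs ys \<Longrightarrow> xs \<in> W \<and> ys \<in> W"
  by (simp add: eqv_def gp_rel_def)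

lemma eqv_refl: "xs \<in> W \<Longrightarrow> eqv xs xs"
  by (simp add: eqv_def gp_rel_def)

lemma eqv_sym: "eqv xs ys \<Longrightarrow> eqv ys xs"
  by (auto simp: eqv_def gp_rel_def intro: sympD[OF symp_rtranclp_symclp])

lemma eqv_trans [trans]: "eqv xs ys \<Longrightarrow> eqv ys zs \<Longrightarrow> eqv xs zs"
  by (auto simp: eqv_def gp_rel_def)

lemma eqv_step: "gp_step V E G xs ys \<Longrightarrow> eqv xs ys"
  using step_words[of xs ys] by (auto simp: eqv_def gp_rel_def symclp_def intro: r_into_rtranclp)

lemma eqv_induct:
  assumes "eqv xs ys"
    and r: "\<And>xs. xs \<in> W \<Longrightarrow> Q xs xs"
    and s: "\<And>xs ys. Q xs ys \<Longrightarrow> Q ys xs"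
    and t: "\<And>xs ys zs. Q xs ys \<Longrightarrow> Q ys zs \<Longrightarrow> Q xs zs"
    and st: "\<And>xs ys. gp_step V E G xs ys \<Longrightarrow> Q xs ys"
  shows "Q xs ys"
proof -
  have "(symclp (gp_step V E G))\<^sup>*\<^sup>* xs ys" "xs \<in> W" using assms(1) by (auto simp: eqv_def gp_rel_def)
  then show ?thesis
  proof (induction rule: rtranclp_induct)
    case base
    then show ?case by (rule r)
  next
    case (step y z)
    then have "Q y z" using s st by (auto simp: symclp_def)
    then show ?case using step t by blast
  qed
qed

lemma eqv_context:
  assumes "eqv xs ys" "as \<in> W" "bs \<in> W"
  shows "eqv (as @ xs @ bs) (as @ ys @ bs)"
  using assms(1)
  by (rule eqv_induct) (use assms in \<open>auto intro: eqv_refl eqv_sym eqv_trans eqv_step step_context\<close>)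

lemma eqv_append:
  assumes "eqv xs xs'" "eqv ys ys'"
  shows "eqv (xs @ ys) (xs' @ ys')"
proof -
  have "eqv (xs @ ys) (xs' @ ys)"
    using eqv_context[OF assms(1), of "[]" ys] eqv_words[OF assms(2)] by simp
  moreover have "eqv (xs' @ ys) (xs' @ ys')"
    using eqv_context[OF assms(2), of xs' "[]"] eqv_words[OF assms(1)] by simp
  ultimately show ?thesis by (rule eqv_trans)
qed

lemma eqv_Cons: "eqv xs ys \<Longrightarrow> v \<in> V \<Longrightarrow> g \<in> carrier (G v) \<Longrightarrow> eqv ((v, g) # xs) ((v, g) # ys)"
  using eqv_context[of xs ys "[(v, g)]" "[]"] by simp

lemma eqv_del: "v \<in> V \<Longrightarrow> xs \<in> W \<Longrightarrow> eqv ((v, \<one>\<^bsub>G v\<^esub>) # xs) xs"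
  using eqv_step[OF gp_step.del[of "[]" V G xs v E]] by simp

lemma eqv_merge: "\<lbrakk>v \<in> V; g \<in> carrier (G v); h \<in> carrier (G v); xs \<in> W\<rbrakk> \<Longrightarrow>
    eqv ((v, g) # (v, h) # xs) ((v, g \<otimes>\<^bsub>G v\<^esub> h) # xs)"
  using eqv_step[OF gp_step.merge[of "[]" V G xs v g h E]] by simp

lemma eqv_swap: "\<lbrakk>{v, w} \<in> E; g \<in> carrier (G v); h \<in> carrier (G w); xs \<in> W\<rbrakk> \<Longrightarrow>
    eqv ((v, g) # (w, h) # xs) ((w, h) # (v, g) # xs)"
  using eqv_step[OF gp_step.swap[of "[]" V G xs v w E g h]] edge_V by simp

lemma eqv_move_front:
  assumes "ys @ (v, x) # zs \<in> W" "\<forall>l\<in>set ys. {fst l, v} \<in> E"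
  shows "eqv (ys @ (v, x) # zs) ((v, x) # ys @ zs)"
  using assms
proof (induction ys)
  case Nil
  then show ?case by (simp add: eqv_refl)
next
  case (Cons l ys)
  obtain u g where l: "l = (u, g)" by (cases l)
  have "eqv ((u, g) # ys @ (v, x) # zs) ((u, g) # (v, x) # ys @ zs)"
    using Cons l by (intro eqv_Cons) auto
  also have "eqv ((u, g) # (v, x) # ys @ zs) ((v, x) # (u, g) # ys @ zs)"
    using Cons l by (intro eqv_swap) auto
  finally show ?case using l by simp
qed

definition cls :: "('v \<times> 'g) list \<Rightarrow> ('v \<times> 'g) list set" where
  "cls xs = gp_rel V E G `` {xs}"

lemma equiv_rel: "equiv W (gp_rel V E G)"
proof (rule equivI)
  show "gp_rel V E G \<subseteq> W \<times> W" by (auto simp: gp_rel_def)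
  show "refl_on W (gp_rel V E G)" using eqv_refl by (auto simp: refl_on_def eqv_def)
  show "sym (gp_rel V E G)" using eqv_sym unfolding eqv_def by (auto intro: symI)
  show "trans (gp_rel V E G)" using eqv_trans unfolding eqv_def by (auto intro: transI)
qed

lemma cls_eq: "xs \<in> W \<Longrightarrow> ys \<in> W \<Longrightarrow> cls xs = cls ys \<longleftrightarrow> eqv xs ys"
  unfolding cls_def eqv_def using eq_equiv_class_iff[OF equiv_rel] by blast

lemma cls_self: "xs \<in> W \<Longrightarrow> xs \<in> cls xs"
  unfolding cls_def using eqv_refl eqv_def by auto

lemma mem_cls: "ys \<in> cls xs \<longleftrightarrow> eqv xs ys"
  unfolding cls_def eqv_def by auto

lemma carrier_GP: "carrier GP = cls ` W"
  unfolding graph_product_def quotient_def cls_def by auto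

lemma cls_carrier [simp]: "xs \<in> W \<Longrightarrow> cls xs \<in> carrier GP"
  using carrier_GP by blast

lemma carrier_cases: "a \<in> carrier GP \<Longrightarrow> (\<And>xs. xs \<in> W \<Longrightarrow> a = cls xs \<Longrightarrow> thesis) \<Longrightarrow> thesis"
  using carrier_GP by auto

lemma mult_cls: assumes "xs \<in> W" "ys \<in> W" shows "cls xs \<star> cls ys = cls (xs @ ys)"
proof -
  have "cls xs \<star> cls ys = \<Union>{cls (xs' @ ys') | xs' ys'. xs' \<in> cls xs \<and> ys' \<in> cls ys}"
    unfolding graph_product_def cls_def by simp
  also have "{cls (xs' @ ys') | xs' ys'. xs' \<in> cls xs \<and> ys' \<in> cls ys} = {cls (xs @ ys)}"
  proof -
    have eq: "cls (xs' @ ys') = cls (xs @ ys)" if "xs' \<in> cls xs" "ys' \<in> cls ys" for xs' ys'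
      using that eqv_append[of xs xs' ys ys'] cls_eq[of "xs @ ys" "xs' @ ys'"] eqv_words
      unfolding mem_cls by auto
    have "xs \<in> cls xs" "ys \<in> cls ys" using cls_self assms by blast+
    then have mem: "cls (xs @ ys) \<in> {cls (xs' @ ys') | xs' ys'. xs' \<in> cls xs \<and> ys' \<in> cls ys}" by blast
    have all: "c = cls (xs @ ys)" if "c \<in> {cls (xs' @ ys') | xs' ys'. xs' \<in> cls xs \<and> ys' \<in> cls ys}" for c
      using that eq by fast
    have sing: "S = {c}" if "c \<in> S" "\<And>c'. c' \<in> S \<Longrightarrow> c' = c" for S and c :: "('v \<times> 'g) list set"
      using that by blast
    show ?thesis by (rule sing[OF mem all])
  qed
  finally show ?thesis by simp
qed

lemma one_cls: "\<one>\<^bsub>GP\<^esub> = cls []"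
  unfolding graph_product_def cls_def by simp

definition winv :: "('v \<times> 'g) list \<Rightarrow> ('v \<times> 'g) list" where
  "winv xs = rev (map (\<lambda>(v, g). (v, inv\<^bsub>G v\<^esub> g)) xs)"

lemma winv_words [simp]: "xs \<in> W \<Longrightarrow> winv xs \<in> W"
  unfolding winv_def gp_words_def by (auto simp: group.inv_closed groups)

lemma winv_simps [simp]: "winv [] = []" "winv ((v, g) # xs) = winv xs @ [(v, inv\<^bsub>G v\<^esub> g)]"
  "winv (xs @ ys) = winv ys @ winv xs"
  unfolding winv_def by auto

lemma winv_left: "xs \<in> W \<Longrightarrow> eqv (winv xs @ xs) []"
proof (induction xs)
  case Nil
  then show ?case by (simp add: eqv_refl)
next
  case (Cons l xs)
  obtain v g where l: "l = (v, g)" by (cases l)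
  have v: "v \<in> V" "g \<in> carrier (G v)" "xs \<in> W" using Cons.prems l by auto
  interpret group "G v" using groups v by simp
  have ig: "inv\<^bsub>G v\<^esub> g \<in> carrier (G v)" using v by simp
  have "eqv ((v, inv\<^bsub>G v\<^esub> g) # (v, g) # xs) ((v, inv\<^bsub>G v\<^esub> g \<otimes>\<^bsub>G v\<^esub> g) # xs)"
    using v ig by (intro eqv_merge) auto
  also have "eqv ((v, inv\<^bsub>G v\<^esub> g \<otimes>\<^bsub>G v\<^esub> g) # xs) xs" using v eqv_del by simp
  finally have "eqv (winv xs @ ((v, inv\<^bsub>G v\<^esub> g) # (v, g) # xs)) (winv xs @ xs)"
    using eqv_append eqv_refl v by simp
  then show ?case using Cons.IH v l eqv_trans by simp
qed

lemma group_GP: "group GP"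
proof (rule groupI)
  show "\<one>\<^bsub>GP\<^esub> \<in> carrier GP" by (simp add: one_cls)
next
  fix a b assume "a \<in> carrier GP" "b \<in> carrier GP"
  then show "a \<star> b \<in> carrier GP" by (elim carrier_cases) (simp add: mult_cls)
next
  fix a b c assume "a \<in> carrier GP" "b \<in> carrier GP" "c \<in> carrier GP"
  then show "a \<star> b \<star> c = a \<star> (b \<star> c)"
    by (elim carrier_cases) (simp add: mult_cls)
next
  fix a assume "a \<in> carrier GP"
  then show "\<one>\<^bsub>GP\<^esub> \<star> a = a" by (elim carrier_cases) (simp add: mult_cls one_cls)
next
  fix a assume "a \<in> carrier GP"
  then obtain xs where xs: "xs \<in> W" "a = cls xs" by (rule carrier_cases)
  then have "cls (winv xs) \<star> a = \<one>\<^bsub>GP\<^esub>"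
    using winv_left cls_eq[of "winv xs @ xs" "[]"] by (simp add: mult_cls one_cls)
  then show "\<exists>b\<in>carrier GP. b \<star> a = \<one>\<^bsub>GP\<^esub>" using xs by (intro bexI[of _ "cls (winv xs)"]) auto
qed

sublocale GP: group GP by (rule group_GP)

lemma inv_cls: "xs \<in> W \<Longrightarrow> iv (cls xs) = cls (winv xs)"
proof -
  assume xs: "xs \<in> W"
  have "cls (winv xs) \<star> cls xs = \<one>\<^bsub>GP\<^esub>"
    using winv_left[OF xs] cls_eq[of "winv xs @ xs" "[]"] xs by (simp add: mult_cls one_cls)
  then show ?thesis using GP.inv_equality xs by simp
qed

text \<open>Pilings: column \<open>u\<close> lists the \<open>u\<close>-letters of a word, with \<open>None\<close> for every letter that does not
  commute with \<open>G u\<close>. The group acts on pilings from the left, which gives the uniqueness of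
  normal forms.\<close>

definition push :: "'v \<Rightarrow> 'g \<Rightarrow> ('v \<Rightarrow> 'g option list) \<Rightarrow> 'v \<Rightarrow> 'g option list" where
  "push v x p = (\<lambda>u. if u = v then Some x # p u else if {v, u} \<in> E then p u else None # p u)"

text \<open>Undoes \<open>push\<close> when a \<open>v\<close>-letter is on top: \<open>tl\<close>
  takes away that letter and the marks it left on the columns that do not commute with it.\<close>

definition pop :: "'v \<Rightarrow> ('v \<Rightarrow> 'g option list) \<Rightarrow> 'v \<Rightarrow> 'g option list" where
  "pop v p = (\<lambda>u. if {v, u} \<in> E then p u else tl (p u))"

definition istop :: "'v \<Rightarrow> ('v \<Rightarrow> 'g option list) \<Rightarrow> bool" where
  "istop v p \<longleftrightarrow> (\<exists>x r. p v = Some x # r)"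

text \<open>A missing letter counts as a trivial one, so that
  \<open>put v (top v p) (rest v p)\<close> rebuilds \<open>p\<close> in either case.\<close>

definition top :: "'v \<Rightarrow> ('v \<Rightarrow> 'g option list) \<Rightarrow> 'g" where
  "top v p = (if istop v p then the (hd (p v)) else \<one>\<^bsub>G v\<^esub>)"

definition rest :: "'v \<Rightarrow> ('v \<Rightarrow> 'g option list) \<Rightarrow> 'v \<Rightarrow> 'g option list" where
  "rest v p = (if istop v p then pop v p else p)"

definition put :: "'v \<Rightarrow> 'g \<Rightarrow> ('v \<Rightarrow> 'g option list) \<Rightarrow> 'v \<Rightarrow> 'g option list" where
  "put v y p = (if y = \<one>\<^bsub>G v\<^esub> then p else push v y p)"

definition lact :: "'v \<times> 'g \<Rightarrow> ('v \<Rightarrow> 'g option list) \<Rightarrow> 'v \<Rightarrow> 'g option list" where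
  "lact l p = put (fst l) (snd l \<otimes>\<^bsub>G (fst l)\<^esub> top (fst l) p) (rest (fst l) p)"

text \<open>The side conditions admit a letter only if it is nontrivial and cannot be merged with a
  later one, so the words related to some piling are exactly the reduced ones.\<close>

inductive pil :: "('v \<times> 'g) list \<Rightarrow> ('v \<Rightarrow> 'g option list) \<Rightarrow> bool" where
  pil_Nil: "pil [] (\<lambda>_. [])"
| pil_Cons: "\<lbrakk>pil xs p; v \<in> V; x \<in> carrier (G v); x \<noteq> \<one>\<^bsub>G v\<^esub>; \<not> istop v p\<rbrakk> \<Longrightarrow> pil ((v, x) # xs) (push v x p)"

lemma pop_push [simp]: "pop v (push v x p) = p"
  by (rule ext) (auto simp: pop_def push_def)

lemma pil_words: "pil xs p \<Longrightarrow> xs \<in> W"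
  by (induction rule: pil.induct) auto

lemma istop_push: "istop u (push v x p) \<longleftrightarrow> u = v \<or> ({v, u} \<in> E \<and> istop u p)"
  by (auto simp: istop_def push_def)

text \<open>A letter on top of its column has no mark above it, so every letter to its left in the
  word commutes with it.\<close>

lemma pil_top:
  assumes "pil xs p" "p v = Some x # r"
  shows "\<exists>ys zs. xs = ys @ (v, x) # zs \<and> (\<forall>l\<in>set ys. {fst l, v} \<in> E) \<and> pil (ys @ zs) (pop v p) \<and>
      push v x (pop v p) = p \<and> \<not> istop v (pop v p)"
  using assms
proof (induction arbitrary: r rule: pil.induct)
  case pil_Nil
  then show ?case by simp
next
  case (pil_Cons xs p u y)
  show ?case
  proof (cases "u = v")
    case True
    then have "x = y" using pil_Cons.prems by (simp add: push_def)
    then show ?thesis using True pil_Cons by (intro exI[of _ "[]"] exI[of _ xs]) simp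
  next
    case False
    then have uv: "{u, v} \<in> E" and pv: "p v = Some x # r"
      using pil_Cons.prems by (auto simp: push_def split: if_splits)
    obtain ys zs where yz: "xs = ys @ (v, x) # zs" "\<forall>l\<in>set ys. {fst l, v} \<in> E" "pil (ys @ zs) (pop v p)"
      "push v x (pop v p) = p" "\<not> istop v (pop v p)"
      using pil_Cons.IH[OF pv] by blast
    have vu: "{v, u} \<in> E" using uv edge_sym by blast
    \<comment> \<open>These columns begin with the mark left by \<open>x\<close>, so removing it
      before or after \<open>u\<close> adds its own mark gives the same column.\<close>
    have nn: "\<exists>r. p w = None # r" if "w \<noteq> v" "{v, w} \<notin> E" for w
      using fun_cong[OF yz(4), of w] that by (simp add: push_def pop_def) metis
    have comm: "pop v (push u y p) = push u y (pop v p)"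
    proof (rule ext)
      fix w show "pop v (push u y p) w = push u y (pop v p) w"
        using uv vu False nn[of w] by (cases "w = v") (auto simp: push_def pop_def)
    qed
    have "push v x (push u y (pop v p)) = push u y (push v x (pop v p))"
      using uv vu False by (intro ext) (auto simp: push_def)
    then have e: "push v x (pop v (push u y p)) = push u y p" using comm yz(4) by simp
    have "\<not> istop u (pop v p)" using pil_Cons.hyps(5) vu by (simp add: istop_def pop_def)
    then have "pil ((u, y) # ys @ zs) (push u y (pop v p))"
      using pil.pil_Cons[OF yz(3)] pil_Cons.hyps by simp
    moreover have "\<not> istop v (push u y (pop v p))" using yz(5) False istop_push by auto
    ultimately show ?thesis using yz comm e uv
      by (intro exI[of _ "(u, y) # ys"] exI[of _ zs]) simp
  qed
qed

definition isp :: "('v \<Rightarrow> 'g option list) \<Rightarrow> bool" where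
  "isp p \<longleftrightarrow> (\<exists>xs. pil xs p)"

lemma isp_empty: "isp (\<lambda>_. [])"
  unfolding isp_def using pil_Nil by blast

lemma pil_letters: "pil xs p \<Longrightarrow> (v, x) \<in> set xs \<Longrightarrow> v \<in> V \<and> x \<in> carrier (G v) \<and> x \<noteq> \<one>\<^bsub>G v\<^esub>"
  by (induction rule: pil.induct) auto

lemma isp_top:
  assumes "isp p" "istop v p"
  shows "v \<in> V" "top v p \<in> carrier (G v)" "top v p \<noteq> \<one>\<^bsub>G v\<^esub>" "isp (pop v p)"
    "push v (top v p) (pop v p) = p" "\<not> istop v (pop v p)"
proof -
  obtain xs where xs: "pil xs p" using assms isp_def by blast
  obtain x r where x: "p v = Some x # r" using assms istop_def by blast
  obtain ys zs where yz: "xs = ys @ (v, x) # zs" "pil (ys @ zs) (pop v p)"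
      "push v x (pop v p) = p" "\<not> istop v (pop v p)"
    using pil_top[OF xs x] by blast
  have t: "top v p = x" using assms(2) x by (simp add: top_def)
  have "v \<in> V \<and> x \<in> carrier (G v) \<and> x \<noteq> \<one>\<^bsub>G v\<^esub>" using pil_letters[OF xs, of v x] yz(1) by simp
  then show "v \<in> V" "top v p \<in> carrier (G v)" "top v p \<noteq> \<one>\<^bsub>G v\<^esub>" "isp (pop v p)"
    "push v (top v p) (pop v p) = p" "\<not> istop v (pop v p)"
    using t yz isp_def by auto
qed

text \<open>Together with \<open>isp_put\<close>: pilings correspond to pairs of a possibly trivial
  \<open>v\<close>-letter and a piling without \<open>v\<close>-letter on top. In these coordinates
  \<open>lact\<close> is left multiplication in \<open>G v\<close>.\<close>

lemma isp_decomp: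
  assumes p: "isp p" and v: "v \<in> V"
  shows "top v p \<in> carrier (G v)" "isp (rest v p)" "\<not> istop v (rest v p)" "put v (top v p) (rest v p) = p"
    "istop v p \<longleftrightarrow> top v p \<noteq> \<one>\<^bsub>G v\<^esub>"
  using isp_top[OF p, of v] p groups[OF v] group.is_monoid monoid.one_closed
  by (auto simp: rest_def put_def top_def split: if_splits)

lemma isp_put:
  assumes q: "isp q" and v: "v \<in> V" and n: "\<not> istop v q" and y: "y \<in> carrier (G v)"
  shows "isp (put v y q)" "top v (put v y q) = y" "rest v (put v y q) = q"
proof -
  show "isp (put v y q)" using q v n y unfolding isp_def put_def by (auto intro: pil_Cons)
  show "top v (put v y q) = y" "rest v (put v y q) = q"
    using n by (auto simp: top_def rest_def put_def istop_push) (simp add: push_def)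
qed

lemma isp_lact:
  assumes "isp p" "v \<in> V" "g \<in> carrier (G v)"
  shows "isp (lact (v, g) p)" "top v (lact (v, g) p) = g \<otimes>\<^bsub>G v\<^esub> top v p" "rest v (lact (v, g) p) = rest v p"
  using isp_put[OF isp_decomp(2)[OF assms(1,2)] assms(2) isp_decomp(3)[OF assms(1,2)], of "g \<otimes>\<^bsub>G v\<^esub> top v p"]
    isp_decomp(1)[OF assms(1,2)] assms groups group.is_monoid monoid.m_closed
  unfolding lact_def by (metis fst_conv snd_conv)+

lemma lact_one: "isp p \<Longrightarrow> v \<in> V \<Longrightarrow> lact (v, \<one>\<^bsub>G v\<^esub>) p = p"
  using isp_decomp[of p v] groups[of v] group.is_monoid monoid.l_one unfolding lact_def
  by (metis fst_conv snd_conv)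

lemma lact_mult:
  assumes "isp p" "v \<in> V" "g \<in> carrier (G v)" "h \<in> carrier (G v)"
  shows "lact (v, g) (lact (v, h) p) = lact (v, g \<otimes>\<^bsub>G v\<^esub> h) p"
proof -
  interpret group "G v" using groups assms by simp
  show ?thesis using isp_lact[OF assms(1,2,4)] isp_decomp(1)[OF assms(1,2)] assms
    by (simp add: lact_def m_assoc)
qed

lemma adj_put:
  assumes e: "{u, v} \<in> E" and q: "isp q"
  shows "top u (put v y q) = top u q" "istop u (put v y q) = istop u q"
    "rest u (put v y q) = put v y (rest u q)"
    "put u x (put v y q) = put v y (put u x q)"
proof -
  have e': "{v, u} \<in> E" and ne: "u \<noteq> v" using e edge_sym by auto
  have at: "put v y q u = q u" using e' ne by (simp add: put_def push_def)
  show i: "istop u (put v y q) = istop u q" using at by (simp add: istop_def)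
  show "top u (put v y q) = top u q" using at i by (simp add: top_def)
  show "put u x (put v y q) = put v y (put u x q)"
    using e e' ne by (auto simp: put_def push_def intro!: ext)
  show "rest u (put v y q) = put v y (rest u q)"
  proof (cases "istop u q")
    case True
    have nn: "\<exists>r. q w = None # r" if "w \<noteq> u" "{u, w} \<notin> E" for w
      using fun_cong[OF isp_top(5)[OF q True], of w] that by (simp add: push_def pop_def) metis
    have "pop u (push v y q) = push v y (pop u q)"
    proof (rule ext)
      fix w show "pop u (push v y q) w = push v y (pop u q) w"
        using e e' ne nn[of w] by (cases "w = u") (auto simp: push_def pop_def)
    qed
    then show ?thesis using True i by (simp add: rest_def put_def)
  next
    case False
    then show ?thesis using i by (simp add: rest_def)
  qed
qed

text \<open>Along an edge the two top letters are independent: changing one leaves the other in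
  place. Both orders act on the same remainder, since \<open>rest v b\<close> and
  \<open>rest u a\<close> agree.\<close>

lemma lact_comm:
  assumes p: "isp p" and e: "{u, v} \<in> E" and g: "g \<in> carrier (G u)" and h: "h \<in> carrier (G v)"
  shows "lact (u, g) (lact (v, h) p) = lact (v, h) (lact (u, g) p)"
proof -
  have uv: "u \<in> V" "v \<in> V" and e': "{v, u} \<in> E" using edge_V e edge_sym by auto
  define a where "a = rest v p"
  define b where "b = rest u p"
  have a: "isp a" "put v (top v p) a = p" "\<not> istop v a" and b: "isp b" "put u (top u p) b = p" "\<not> istop u b"
    unfolding a_def b_def using isp_decomp[OF p] uv by auto
  have ta: "top u a = top u p" using adj_put(1)[OF e a(1), of "top v p"] a(2) by simp
  have tb: "top v b = top v p" using adj_put(1)[OF e' b(1), of "top u p"] b(2) by simp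
  have "b = put v (top v p) (rest u a)" using adj_put(3)[OF e a(1), of "top v p"] a(2) b_def by simp
  moreover have na: "\<not> istop v (rest u a)"
    using a(3) e by (auto simp: rest_def pop_def istop_def)
  ultimately have r: "rest v b = rest u a"
    using isp_put(3)[OF isp_decomp(2)[OF a(1) uv(1)] uv(2) na isp_decomp(1)[OF p uv(2)]] by simp
  have la: "lact (v, h) p = put v (h \<otimes>\<^bsub>G v\<^esub> top v p) a"
    and lb: "lact (u, g) p = put u (g \<otimes>\<^bsub>G u\<^esub> top u p) b"
    unfolding lact_def a_def b_def by simp_all
  have "lact (u, g) (lact (v, h) p) = put u (g \<otimes>\<^bsub>G u\<^esub> top u p) (put v (h \<otimes>\<^bsub>G v\<^esub> top v p) (rest u a))"
    unfolding la using adj_put(1,3)[OF e a(1)] ta unfolding lact_def by simp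
  also have "\<dots> = put v (h \<otimes>\<^bsub>G v\<^esub> top v p) (put u (g \<otimes>\<^bsub>G u\<^esub> top u p) (rest u a))"
    using adj_put(4)[OF e] isp_decomp(2)[OF a(1) uv(1)] by blast
  also have "\<dots> = lact (v, h) (lact (u, g) p)"
    unfolding lb using adj_put(1,3)[OF e' b(1)] tb r unfolding lact_def by simp
  finally show ?thesis .
qed

definition piles :: "('v \<times> 'g) list \<Rightarrow> 'v \<Rightarrow> 'g option list" where
  "piles xs = foldr lact xs (\<lambda>_. [])"

lemma piles_simps [simp]: "piles [] = (\<lambda>_. [])" "piles (l # xs) = lact l (piles xs)"
  by (simp_all add: piles_def)

lemma isp_foldr: "xs \<in> W \<Longrightarrow> isp p \<Longrightarrow> isp (foldr lact xs p)"
  by (induction xs) (auto simp: isp_lact(1))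

lemma isp_piles: "xs \<in> W \<Longrightarrow> isp (piles xs)"
  by (simp add: piles_def isp_foldr isp_empty)

lemma piles_append: "piles (xs @ ys) = foldr lact xs (piles ys)"
  by (simp add: piles_def)

lemma piles_step: "gp_step V E G xs ys \<Longrightarrow> piles xs = piles ys"
proof (induction rule: gp_step.induct)
  case (swap xs ys v w g h)
  then show ?case using lact_comm[OF isp_piles, of ys v w g h] by (simp add: piles_append)
qed (auto simp: piles_append lact_one lact_mult isp_piles)

lemma piles_eqv: "eqv xs ys \<Longrightarrow> piles xs = piles ys"
  by (erule eqv_induct) (auto simp: piles_step)

lemma pil_piles: "pil xs p \<Longrightarrow> piles xs = p"
proof (induction rule: pil.induct)
  case (pil_Cons xs p v x)
  interpret group "G v" using groups pil_Cons by simp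
  show ?case using pil_Cons by (simp add: lact_def top_def rest_def put_def)
qed simp

text \<open>Multiplication by a letter changes a reduced word and its piling in the same way, once a
  \<open>v\<close>-letter on top has been shuffled to the front of the word.\<close>

lemma normal_form: "xs \<in> W \<Longrightarrow> \<exists>rs. pil rs (piles xs) \<and> eqv xs rs"
proof (induction xs)
  case Nil
  then show ?case using pil_Nil eqv_refl by fastforce
next
  case (Cons l xs)
  obtain v g where l: "l = (v, g)" by (cases l)
  have v: "v \<in> V" "g \<in> carrier (G v)" "xs \<in> W" using Cons.prems l by auto
  interpret group "G v" using groups v by simp
  obtain rs where rs: "pil rs (piles xs)" "eqv xs rs" using Cons.IH v by blast
  define p where "p = piles xs"
  have p: "isp p" using isp_piles v p_def by simp
  show ?case
  proof (cases "istop v p")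
    case True
    then obtain x r where xr: "p v = Some x # r" using istop_def by blast
    then have tx: "top v p = x" using True by (simp add: top_def)
    have xc: "x \<in> carrier (G v)" using isp_top(2)[OF p True] tx by simp
    obtain ys zs where yz: "rs = ys @ (v, x) # zs" "\<forall>l\<in>set ys. {fst l, v} \<in> E" "pil (ys @ zs) (pop v p)"
      "push v x (pop v p) = p" "\<not> istop v (pop v p)"
      using pil_top[OF rs(1)[folded p_def] xr] by blast
    have rW: "rs \<in> W" using pil_words rs by blast
    then have yzW: "ys @ zs \<in> W" using yz by simp
    have "eqv ((v, g) # xs) ((v, g) # rs)" using eqv_Cons rs v by simp
    also have "eqv ((v, g) # rs) ((v, g) # (v, x) # ys @ zs)"
      using eqv_Cons[OF eqv_move_front] yz rW v by simp
    also have "eqv ((v, g) # (v, x) # ys @ zs) ((v, g \<otimes>\<^bsub>G v\<^esub> x) # ys @ zs)"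
      using eqv_merge v xc yzW by simp
    finally have e: "eqv ((v, g) # xs) ((v, g \<otimes>\<^bsub>G v\<^esub> x) # ys @ zs)" .
    have act: "piles (l # xs) = put v (g \<otimes>\<^bsub>G v\<^esub> x) (pop v p)"
      using True tx l by (simp add: lact_def p_def[symmetric] rest_def)
    show ?thesis
    proof (cases "g \<otimes>\<^bsub>G v\<^esub> x = \<one>\<^bsub>G v\<^esub>")
      case True
      then have "eqv ((v, g) # xs) (ys @ zs)" using e eqv_del[OF v(1) yzW] eqv_trans by metis
      then show ?thesis using act True yz(3) l by (auto simp: put_def)
    next
      case False
      then have "pil ((v, g \<otimes>\<^bsub>G v\<^esub> x) # ys @ zs) (push v (g \<otimes>\<^bsub>G v\<^esub> x) (pop v p))"
        using pil_Cons[OF yz(3)] yz(5) v xc by simp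
      then show ?thesis using act False e l by (auto simp: put_def)
    qed
  next
    case False
    then have act: "piles (l # xs) = put v g p"
      using l v by (simp add: lact_def p_def[symmetric] rest_def top_def)
    show ?thesis
    proof (cases "g = \<one>\<^bsub>G v\<^esub>")
      case True
      then have "eqv ((v, g) # xs) rs" using eqv_del[OF v(1,3)] rs(2) eqv_trans by metis
      then show ?thesis using act True rs(1) l p_def by (auto simp: put_def)
    next
      case False
      then have "pil ((v, g) # rs) (push v g p)"
        using pil_Cons[OF rs(1)[folded p_def]] \<open>\<not> istop v p\<close> v by simp
      then show ?thesis using act False eqv_Cons[OF rs(2) v(1,2)] l by (auto simp: put_def)
    qed
  qed
qed

text \<open>By \<open>pil_top\<close> the first letter of one word can be taken out of the other;
  what remains has the same piling again.\<close>

lemma pil_length: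
  assumes "pil rs p" "pil rs' p"
  shows "length rs = length rs'"
  using assms
proof (induction arbitrary: rs' rule: pil.induct)
  case pil_Nil
  from pil_Nil.prems have "rs' = []"
    by (cases rule: pil.cases) (auto simp: push_def fun_eq_iff split: if_splits)
  then show ?case by simp
next
  case (pil_Cons xs p v x)
  have "push v x p v = Some x # p v" by (simp add: push_def)
  then obtain ys zs where yz: "rs' = ys @ (v, x) # zs" "pil (ys @ zs) p"
    using pil_top[OF pil_Cons.prems] by (metis pop_push)
  then show ?case using pil_Cons.IH[OF yz(2)] by simp
qed

section \<open>Reduced words\<close>

definition initl :: "'v \<Rightarrow> ('v \<times> 'g) list \<Rightarrow> bool" where
  "initl v xs \<longleftrightarrow> (\<exists>ys x zs. xs = ys @ (v, x) # zs \<and> (\<forall>l\<in>set ys. {fst l, v} \<in> E))"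

definition termin :: "'v \<Rightarrow> ('v \<times> 'g) list \<Rightarrow> bool" where
  "termin v xs \<longleftrightarrow> (\<exists>ys x zs. xs = ys @ (v, x) # zs \<and> (\<forall>l\<in>set zs. {fst l, v} \<in> E))"

definition red :: "('v \<times> 'g) list \<Rightarrow> bool" where
  "red xs \<longleftrightarrow> (\<forall>(v, x)\<in>set xs. v \<in> V \<and> x \<in> carrier (G v) \<and> x \<noteq> \<one>\<^bsub>G v\<^esub>) \<and>
     \<not> (\<exists>as v x bs y cs. xs = as @ (v, x) # bs @ (v, y) # cs \<and> (\<forall>l\<in>set bs. {fst l, v} \<in> E))"

lemma initl_Nil [simp]: "\<not> initl v []"
  by (simp add: initl_def)

lemma initl_Cons: "initl v ((u, x) # xs) \<longleftrightarrow> u = v \<or> ({u, v} \<in> E \<and> initl v xs)"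
proof
  assume "initl v ((u, x) # xs)"
  then obtain ys y zs where "(u, x) # xs = ys @ (v, y) # zs" "\<forall>l\<in>set ys. {fst l, v} \<in> E"
    unfolding initl_def by blast
  then show "u = v \<or> ({u, v} \<in> E \<and> initl v xs)"
    by (cases ys) (auto simp: initl_def)
next
  assume r: "u = v \<or> ({u, v} \<in> E \<and> initl v xs)"
  show "initl v ((u, x) # xs)"
  proof (cases "u = v")
    case True
    then show ?thesis unfolding initl_def by (intro exI[of _ "[]"]) auto
  next
    case False
    then obtain ys y zs where "xs = ys @ (v, y) # zs" "\<forall>l\<in>set ys. {fst l, v} \<in> E" "{u, v} \<in> E"
      using r unfolding initl_def by blast
    then show ?thesis unfolding initl_def by (intro exI[of _ "(u, x) # ys"] exI[of _ y] exI[of _ zs]) auto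
  qed
qed

lemma red_Nil [simp]: "red []"
  by (simp add: red_def)

lemma red_Cons: "red ((v, x) # xs) \<longleftrightarrow>
    v \<in> V \<and> x \<in> carrier (G v) \<and> x \<noteq> \<one>\<^bsub>G v\<^esub> \<and> red xs \<and> \<not> initl v xs"
proof -
  have "(\<exists>as u y bs z cs. (v, x) # xs = as @ (u, y) # bs @ (u, z) # cs \<and> (\<forall>l\<in>set bs. {fst l, u} \<in> E)) \<longleftrightarrow>
    initl v xs \<or> (\<exists>as u y bs z cs. xs = as @ (u, y) # bs @ (u, z) # cs \<and> (\<forall>l\<in>set bs. {fst l, u} \<in> E))"
    (is "?L \<longleftrightarrow> ?R1 \<or> ?R2")
  proof
    assume ?L
    then obtain as u y bs z cs where *: "(v, x) # xs = as @ (u, y) # bs @ (u, z) # cs" "\<forall>l\<in>set bs. {fst l, u} \<in> E"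
      by blast
    show "?R1 \<or> ?R2"
    proof (cases as)
      case Nil
      then show ?thesis using * unfolding initl_def by auto
    next
      case (Cons a as')
      then have "xs = as' @ (u, y) # bs @ (u, z) # cs" using * by simp
      then show ?thesis using *(2) by blast
    qed
  next
    assume "?R1 \<or> ?R2"
    then show ?L
    proof
      assume ?R1
      then obtain ys y zs where "xs = ys @ (v, y) # zs" "\<forall>l\<in>set ys. {fst l, v} \<in> E"
        unfolding initl_def by blast
      then show ?L by (intro exI[of _ "[]"] exI[of _ v] exI[of _ x] exI[of _ ys] exI[of _ y] exI[of _ zs]) simp
    next
      assume ?R2
      then obtain as u y bs z cs where "xs = as @ (u, y) # bs @ (u, z) # cs" "\<forall>l\<in>set bs. {fst l, u} \<in> E"
        by blast
      then show ?L by (intro exI[of _ "(v, x) # as"] exI[of _ u] exI[of _ y] exI[of _ bs] exI[of _ z] exI[of _ cs]) simp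
    qed
  qed
  then show ?thesis unfolding red_def by auto
qed

lemma pil_initl: "pil xs p \<Longrightarrow> initl v xs \<longleftrightarrow> istop v p"
proof (induction rule: pil.induct)
  case pil_Nil
  then show ?case by (simp add: istop_def)
next
  case (pil_Cons xs p u x)
  then show ?case by (auto simp: initl_Cons istop_push)
qed

lemma pil_red: "pil xs p \<Longrightarrow> red xs"
  by (induction rule: pil.induct) (auto simp: red_Cons pil_initl)

lemma red_pil: "red xs \<Longrightarrow> pil xs (piles xs)"
proof (induction xs)
  case (Cons l xs)
  obtain v x where l: "l = (v, x)" by (cases l)
  have r: "v \<in> V" "x \<in> carrier (G v)" "x \<noteq> \<one>\<^bsub>G v\<^esub>" "red xs" "\<not> initl v xs"
    using Cons.prems l red_Cons by auto
  then have "pil (l # xs) (push v x (piles xs))"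
    using pil_Cons[OF Cons.IH[OF r(4)]] pil_initl[OF Cons.IH[OF r(4)]] l by simp
  then show ?case using pil_piles by metis
qed (simp add: pil_Nil)

lemma red_words: "red xs \<Longrightarrow> xs \<in> W"
  using red_pil pil_words by blast

lemma red_letters: "red xs \<Longrightarrow> (v, x) \<in> set xs \<Longrightarrow> v \<in> V \<and> x \<in> carrier (G v) \<and> x \<noteq> \<one>\<^bsub>G v\<^esub>"
  unfolding red_def by blast

lemma red_rev: "red (rev xs) \<longleftrightarrow> red xs"
proof -
  have *: "red (rev xs)" if "red xs" for xs
    unfolding red_def
  proof (intro conjI notI)
    show "\<forall>(v, x)\<in>set (rev xs). v \<in> V \<and> x \<in> carrier (G v) \<and> x \<noteq> \<one>\<^bsub>G v\<^esub>" using that red_def by auto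
    assume "\<exists>as v x bs y cs. rev xs = as @ (v, x) # bs @ (v, y) # cs \<and> (\<forall>l\<in>set bs. {fst l, v} \<in> E)"
    then obtain as v x bs y cs where r: "rev xs = as @ (v, x) # bs @ (v, y) # cs" "\<forall>l\<in>set bs. {fst l, v} \<in> E"
      by blast
    have "xs = rev (as @ (v, x) # bs @ (v, y) # cs)" using r(1) by (metis rev_rev_ident)
    then have "xs = rev cs @ (v, y) # rev bs @ (v, x) # rev as" by simp
    moreover have "\<forall>l\<in>set (rev bs). {fst l, v} \<in> E" using r(2) by simp
    ultimately show False using that unfolding red_def by blast
  qed
  show ?thesis using *[of xs] *[of "rev xs"] by auto
qed

lemma termin_rev: "termin v (rev xs) \<longleftrightarrow> initl v xs"
proof
  assume "termin v (rev xs)"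
  then obtain ys x zs where r: "rev xs = ys @ (v, x) # zs" "\<forall>l\<in>set zs. {fst l, v} \<in> E"
    unfolding termin_def by blast
  have "xs = rev (ys @ (v, x) # zs)" using r(1) by (metis rev_rev_ident)
  then show "initl v xs" unfolding initl_def using r(2)
    by (intro exI[of _ "rev zs"] exI[of _ x] exI[of _ "rev ys"]) simp
next
  assume "initl v xs"
  then obtain ys x zs where "xs = ys @ (v, x) # zs" "\<forall>l\<in>set ys. {fst l, v} \<in> E"
    unfolding initl_def by blast
  then show "termin v (rev xs)" unfolding termin_def
    by (intro exI[of _ "rev zs"] exI[of _ x] exI[of _ "rev ys"]) simp
qed

lemma initl_rev: "initl v (rev xs) \<longleftrightarrow> termin v xs"
  using termin_rev[of v "rev xs"] by simp

text \<open>Two letters that could be merged across the junction are a terminal letter of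
  \<open>xs\<close> and an initial letter of \<open>ys\<close> at the same vertex.\<close>

lemma red_append:
  assumes xs: "red xs" and ys: "red ys" and no: "\<And>v. termin v xs \<Longrightarrow> \<not> initl v ys"
  shows "red (xs @ ys)"
  unfolding red_def
proof (intro conjI notI)
  show "\<forall>(v, x)\<in>set (xs @ ys). v \<in> V \<and> x \<in> carrier (G v) \<and> x \<noteq> \<one>\<^bsub>G v\<^esub>"
    using xs ys unfolding red_def by auto
  assume "\<exists>as v x bs y cs. xs @ ys = as @ (v, x) # bs @ (v, y) # cs \<and> (\<forall>l\<in>set bs. {fst l, v} \<in> E)"
  then obtain as v x bs y cs where r: "xs @ ys = as @ (v, x) # bs @ (v, y) # cs" "\<forall>l\<in>set bs. {fst l, v} \<in> E"
    by blast
  from r(1) consider us where "xs = as @ us" "us @ ys = (v, x) # bs @ (v, y) # cs"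
    | us where "as = xs @ us" "ys = us @ (v, x) # bs @ (v, y) # cs"
    by (auto simp: append_eq_append_conv2)
  then show False
  proof cases
    case 2
    then show False using ys r(2) unfolding red_def by blast
  next
    case 1
    show False
    proof (cases us)
      case Nil
      then have "ys = [] @ (v, x) # bs @ (v, y) # cs" using 1 by simp
      then show False using ys r(2) unfolding red_def by blast
    next
      case (Cons u us')
      then have u: "u = (v, x)" "us' @ ys = bs @ (v, y) # cs" using 1 by auto
      from u(2) consider ws where "us' = bs @ ws" "ws @ ys = (v, y) # cs"
        | ws where "bs = us' @ ws" "ys = ws @ (v, y) # cs"
        by (auto simp: append_eq_append_conv2)
      then show False
      proof cases
        case 1
        show False
        proof (cases ws)
          case Nil
          then have "us' = bs" "ys = [] @ (v, y) # cs" using 1 by auto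
          then have "termin v xs" "initl v ys"
            using \<open>xs = as @ us\<close> Cons u r(2) unfolding termin_def initl_def by fastforce+
          then show False using no by blast
        next
          case (Cons w ws')
          then have "xs = as @ (v, x) # bs @ (v, y) # ws'" using 1 \<open>xs = as @ us\<close> \<open>us = u # us'\<close> u by simp
          then show False using xs r(2) unfolding red_def by blast
        qed
      next
        case 2
        have "termin v xs" unfolding termin_def using \<open>xs = as @ us\<close> \<open>us = u # us'\<close> u r(2) 2 by auto
        moreover have "initl v ys" unfolding initl_def using 2 r(2) by auto
        ultimately show False using no by blast
      qed
    qed
  qed
qed

lemma red_appendD: "red (xs @ ys) \<Longrightarrow> red xs \<and> red ys"
proof -
  have r: "red ys" if "red (xs @ ys)" for xs ys
    using that by (induction xs) (auto simp: red_Cons)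
  assume "red (xs @ ys)"
  then have "red ys" "red (rev ys @ rev xs)" using r red_rev[of "xs @ ys"] by auto
  then show ?thesis using r[of "rev ys" "rev xs"] red_rev by blast
qed

lemma red_front:
  assumes "red (ys @ (v, x) # zs)" "\<forall>l\<in>set ys. {fst l, v} \<in> E"
  shows "red ((v, x) # ys @ zs)"
proof -
  let ?xs = "ys @ (v, x) # zs"
  have p: "pil ?xs (piles ?xs)" using red_pil assms by blast
  have "initl v ?xs" using assms(2) unfolding initl_def by blast
  then have "istop v (piles ?xs)" using pil_initl p by blast
  then obtain y r where y: "piles ?xs v = Some y # r" unfolding istop_def by blast
  obtain ys' zs' where yz: "?xs = ys' @ (v, y) # zs'" "\<forall>l\<in>set ys'. {fst l, v} \<in> E"
     "pil (ys' @ zs') (pop v (piles ?xs))" "\<not> istop v (pop v (piles ?xs))"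
    using pil_top[OF p y] by blast
  have n: "(v, a) \<notin> set ys" "(v, a) \<notin> set ys'" for a using assms(2) yz(2) by force+
  \<comment> \<open>Neither prefix contains a \<open>v\<close>-letter, as \<open>v\<close> is not
    adjacent to itself, so both decompositions split at the first \<open>v\<close>-letter.\<close>
  have "ys = ys'"
  proof -
    have "takeWhile (\<lambda>l. fst l \<noteq> v) (as @ (v, a) # bs) = as" if "\<forall>l\<in>set as. {fst l, v} \<in> E" for as a bs
    proof -
      have "\<forall>l\<in>set as. fst l \<noteq> v" using that by force
      then show ?thesis by (simp add: takeWhile_append)
    qed
    then show ?thesis using yz(1,2) assms(2) by metis
  qed
  then have e: "ys' @ zs' = ys @ zs" "y = x" using yz(1) by auto
  have "\<not> initl v (ys @ zs)" using pil_initl[OF yz(3)] yz(4) e by simp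
  then show ?thesis using pil_red[OF yz(3)] e red_letters[OF assms(1), of v x] red_Cons by simp
qed

definition cnt :: "'v \<Rightarrow> ('v \<times> 'g) list \<Rightarrow> nat" where
  "cnt v xs = length (filter (\<lambda>l. fst l = v) xs)"

lemma cnt_simps [simp]: "cnt v [] = 0" "cnt v (l # xs) = (if fst l = v then Suc (cnt v xs) else cnt v xs)"
  "cnt v (xs @ ys) = cnt v xs + cnt v ys" "cnt v (rev xs) = cnt v xs"
  unfolding cnt_def by (auto simp: rev_filter[symmetric])

lemma cnt_pos: "cnt v xs > 0 \<longleftrightarrow> v \<in> fst ` set xs"
  by (induction xs) auto

definition pnu :: "'v \<Rightarrow> ('v \<Rightarrow> 'g option list) \<Rightarrow> nat" where
  "pnu v p = length (filter (\<lambda>z. z \<noteq> None) (p v))"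

lemma pnu_put: "pnu v (put w y q) = pnu v q + (if v = w \<and> y \<noteq> \<one>\<^bsub>G w\<^esub> then 1 else 0)"
  by (auto simp: pnu_def put_def push_def)

lemma pnu_decomp: "isp p \<Longrightarrow> w \<in> V \<Longrightarrow> pnu v p = pnu v (rest w p) + (if v = w \<and> top w p \<noteq> \<one>\<^bsub>G w\<^esub> then 1 else 0)"
  using pnu_put[of v w "top w p" "rest w p"] isp_decomp(4) by simp

lemma pnu_lact: "isp p \<Longrightarrow> w \<in> V \<Longrightarrow>
  pnu v (lact (w, g) p) = pnu v (rest w p) + (if v = w \<and> g \<otimes>\<^bsub>G w\<^esub> top w p \<noteq> \<one>\<^bsub>G w\<^esub> then 1 else 0)"
  unfolding lact_def by (simp add: pnu_put)

lemma pil_cnt: "pil xs p \<Longrightarrow> pnu v p = cnt v xs"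
  by (induction rule: pil.induct) (auto simp: pnu_def push_def)

section \<open>Letter counts and lengths of group elements\<close>

definition rw :: "('v \<times> 'g) list set \<Rightarrow> ('v \<times> 'g) list" where
  "rw a = (SOME xs. red xs \<and> a = cls xs)"

lemma rw: assumes "a \<in> carrier GP" shows "red (rw a)" "cls (rw a) = a"
proof -
  obtain xs where xs: "xs \<in> W" "a = cls xs" using assms by (rule carrier_cases)
  obtain rs where "pil rs (piles xs)" "eqv xs rs" using normal_form xs by blast
  then have "red rs" "a = cls rs" using pil_red xs cls_eq eqv_words by blast+
  then have "\<exists>xs. red xs \<and> a = cls xs" by blast
  from someI_ex[OF this] show "red (rw a)" "cls (rw a) = a" unfolding rw_def by auto
qed

lemma red_cases: "a \<in> carrier GP \<Longrightarrow> (\<And>xs. red xs \<Longrightarrow> xs \<in> W \<Longrightarrow> a = cls xs \<Longrightarrow> thesis) \<Longrightarrow> thesis"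
  using rw red_words by metis

text \<open>In terms of reduced words: \<open>nu v a\<close> is the number of \<open>v\<close>-letters, \<open>glen a\<close> the length, and
  \<open>eta v a\<close> the \<open>v\<close>-letter that can be moved to the front, or the identity if there is none.\<close>

definition nu :: "'v \<Rightarrow> ('v \<times> 'g) list set \<Rightarrow> nat" where
  "nu v a = pnu v (piles (rw a))"

definition eta :: "'v \<Rightarrow> ('v \<times> 'g) list set \<Rightarrow> 'g" where
  "eta v a = top v (piles (rw a))"

definition glen :: "('v \<times> 'g) list set \<Rightarrow> nat" where
  "glen a = length (rw a)"

lemma piles_rw: assumes "xs \<in> W" shows "piles (rw (cls xs)) = piles xs"
  using rw[of "cls xs"] assms cls_eq[of xs "rw (cls xs)"] red_words piles_eqv by (metis cls_carrier)

lemma nu_cls: "xs \<in> W \<Longrightarrow> nu v (cls xs) = pnu v (piles xs)"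
  by (simp add: nu_def piles_rw)

lemma eta_cls: "xs \<in> W \<Longrightarrow> eta v (cls xs) = top v (piles xs)"
  by (simp add: eta_def piles_rw)

lemma red_nu: "red xs \<Longrightarrow> nu v (cls xs) = cnt v xs"
  using nu_cls red_words pil_cnt red_pil by metis

lemma red_length:
  assumes "red xs" "red ys" "cls xs = cls ys"
  shows "length xs = length ys"
proof -
  have "piles xs = piles ys" using assms cls_eq red_words piles_eqv by blast
  then have "pil ys (piles xs)" using red_pil[OF assms(2)] by simp
  from pil_length[OF red_pil[OF assms(1)] this] show ?thesis .
qed

lemma red_glen: "red xs \<Longrightarrow> glen (cls xs) = length xs"
  unfolding glen_def using red_length[of "rw (cls xs)" xs] rw[of "cls xs"] red_words by simp

lemma red_eta: "red xs \<Longrightarrow> v \<in> V \<Longrightarrow> eta v (cls xs) \<noteq> \<one>\<^bsub>G v\<^esub> \<longleftrightarrow> initl v xs"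
  using eta_cls[OF red_words] isp_decomp(5)[OF isp_piles[OF red_words]] pil_initl[OF red_pil] by metis

lemma not_red_shorten:
  assumes xs: "xs \<in> W" and n: "\<not> red xs"
  shows "\<exists>ys v. eqv xs ys \<and> length ys < length xs \<and> cnt v ys < cnt v xs \<and> (\<forall>w. cnt w ys \<le> cnt w xs)"
proof -
  have "(\<exists>v as bs. xs = as @ (v, \<one>\<^bsub>G v\<^esub>) # bs) \<or>
    (\<exists>as v x bs y cs. xs = as @ (v, x) # bs @ (v, y) # cs \<and> (\<forall>l\<in>set bs. {fst l, v} \<in> E))"
  proof (cases "\<exists>v. (v, \<one>\<^bsub>G v\<^esub>) \<in> set xs")
    case True
    then show ?thesis by (meson split_list)
  next
    case False
    then have "\<forall>(v, x)\<in>set xs. v \<in> V \<and> x \<in> carrier (G v) \<and> x \<noteq> \<one>\<^bsub>G v\<^esub>"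
      using xs unfolding gp_words_def by auto
    then show ?thesis using n unfolding red_def by blast
  qed
  then show ?thesis
  proof
    assume "\<exists>v as bs. xs = as @ (v, \<one>\<^bsub>G v\<^esub>) # bs"
    then obtain v as bs where e: "xs = as @ (v, \<one>\<^bsub>G v\<^esub>) # bs" by blast
    have "eqv (as @ (v, \<one>\<^bsub>G v\<^esub>) # bs) (as @ bs)"
      using eqv_append[OF eqv_refl eqv_del[of v bs], of as] xs e by simp
    then show ?thesis using e by (intro exI[of _ "as @ bs"] exI[of _ v]) auto
  next
    assume "\<exists>as v x bs y cs. xs = as @ (v, x) # bs @ (v, y) # cs \<and> (\<forall>l\<in>set bs. {fst l, v} \<in> E)"
    then obtain as v x bs y cs where e: "xs = as @ (v, x) # bs @ (v, y) # cs" "\<forall>l\<in>set bs. {fst l, v} \<in> E"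
      by blast
    have w: "v \<in> V" "x \<in> carrier (G v)" "y \<in> carrier (G v)" "as \<in> W" "bs \<in> W" "cs \<in> W" using xs e by auto
    have "eqv ((v, x) # bs @ (v, y) # cs) ((v, x) # (v, y) # bs @ cs)"
      using eqv_Cons[OF eqv_move_front[of bs v y cs]] w e(2) by simp
    also have "eqv ((v, x) # (v, y) # bs @ cs) ((v, x \<otimes>\<^bsub>G v\<^esub> y) # bs @ cs)"
      using eqv_merge w by simp
    finally have "eqv xs (as @ (v, x \<otimes>\<^bsub>G v\<^esub> y) # bs @ cs)"
      using eqv_append[OF eqv_refl[OF w(4)]] e by simp
    then show ?thesis using e by (intro exI[of _ "as @ (v, x \<otimes>\<^bsub>G v\<^esub> y) # bs @ cs"] exI[of _ v]) auto
  qed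
qed

lemma cnt_bound:
  assumes "xs \<in> W"
  shows "nu w (cls xs) \<le> cnt w xs" "glen (cls xs) \<le> length xs"
proof -
  have "(\<forall>w. nu w (cls xs) \<le> cnt w xs) \<and> glen (cls xs) \<le> length xs"
    using assms
  proof (induction xs rule: length_induct)
    case (1 xs)
    show ?case
    proof (cases "red xs")
      case True
      then show ?thesis using red_nu red_glen by simp
    next
      case False
      then obtain ys v where ys: "eqv xs ys" "length ys < length xs" "\<forall>w. cnt w ys \<le> cnt w xs"
        using not_red_shorten 1 by blast
      then have "cls xs = cls ys" "ys \<in> W" using cls_eq eqv_words by blast+
      then show ?thesis using 1 ys le_trans less_imp_le by metis
    qed
  qed
  then show "nu w (cls xs) \<le> cnt w xs" "glen (cls xs) \<le> length xs" by auto
qed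

text \<open>A reduction step lowers some count strictly, but \<open>nu\<close> is a lower bound for
  the counts of all words of the class. This criterion later shows that powers are reduced as
  written.\<close>

lemma red_of_nu:
  assumes "xs \<in> W" "\<And>w. nu w (cls xs) = cnt w xs"
  shows "red xs"
proof (rule ccontr)
  assume "\<not> red xs"
  then obtain ys v where ys: "eqv xs ys" "cnt v ys < cnt v xs" using not_red_shorten assms by blast
  then have "nu v (cls xs) \<le> cnt v ys" using cnt_bound cls_eq eqv_words by metis
  then show False using assms(2)[of v] ys by simp
qed

lemma nu_V: "a \<in> carrier GP \<Longrightarrow> nu v a > 0 \<Longrightarrow> v \<in> V"
  by (erule red_cases) (auto simp: red_nu cnt_pos dest: red_letters)

text \<open>Letters at other vertices add or remove marks in column \<open>w\<close>, never its
  letters.\<close>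

lemma nu_mult_left:
  assumes a: "a \<in> carrier GP" and b: "b \<in> carrier GP" and z: "nu w a = 0"
  shows "nu w (a \<star> b) = nu w b"
proof -
  obtain xs where xs: "red xs" "xs \<in> W" "a = cls xs" using a by (rule red_cases)
  obtain ys where ys: "ys \<in> W" "b = cls ys" using b by (rule carrier_cases)
  have "cnt w xs = 0" using red_nu xs z by metis
  then have "pnu w (foldr lact xs (piles ys)) = pnu w (piles ys)"
    using xs(2)
  proof (induction xs)
    case (Cons l xs)
    then have l: "fst l \<noteq> w" "fst l \<in> V" "xs \<in> W" by (cases l; simp split: if_splits)+
    have p: "isp (foldr lact xs (piles ys))" using isp_foldr isp_piles l ys by blast
    show ?case using pnu_lact[OF p l(2), of w "snd l"] pnu_decomp[OF p l(2), of w] l Cons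
      by (simp split: if_splits)
  qed simp
  then show ?thesis using xs ys by (simp add: mult_cls nu_cls piles_append)
qed

lemma winv_red: assumes "red xs" shows "red (winv xs)"
proof -
  have "red (map (\<lambda>(v, g). (v, inv\<^bsub>G v\<^esub> g)) xs) \<and> (\<forall>v. initl v (map (\<lambda>(v, g). (v, inv\<^bsub>G v\<^esub> g)) xs) = initl v xs)"
    using assms
  proof (induction xs)
    case (Cons l xs)
    obtain v x where l: "l = (v, x)" by (cases l)
    have r: "v \<in> V" "x \<in> carrier (G v)" "x \<noteq> \<one>\<^bsub>G v\<^esub>" "red xs" "\<not> initl v xs" using Cons.prems l red_Cons by auto
    interpret group "G v" using groups r by simp
    have "inv\<^bsub>G v\<^esub> x \<noteq> \<one>\<^bsub>G v\<^esub>" using r by simp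
    then show ?case using Cons.IH r l by (auto simp: red_Cons initl_Cons)
  qed simp
  then show ?thesis unfolding winv_def using red_rev by blast
qed

lemma cnt_winv: "cnt v (winv xs) = cnt v xs"
  by (induction xs) (auto simp: winv_def)

lemma nu_inv: "a \<in> carrier GP \<Longrightarrow> nu w (iv a) = nu w a"
  by (erule red_cases) (simp add: inv_cls red_nu winv_red cnt_winv)

lemma nu_mult_right:
  assumes a: "a \<in> carrier GP" and b: "b \<in> carrier GP" and z: "nu w b = 0"
  shows "nu w (a \<star> b) = nu w a"
  using nu_mult_left[of "iv b" "iv a" w] nu_inv a b z GP.inv_mult_group
  by (metis GP.inv_closed GP.m_closed)

text \<open>This is \<open>G\<^sub>Y\<close>, as the set of elements whose reduced words only use letters from \<open>Y\<close>.\<close>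

definition Gs :: "'v set \<Rightarrow> ('v \<times> 'g) list set set" where
  "Gs Y = {a \<in> carrier GP. \<forall>w. nu w a > 0 \<longrightarrow> w \<in> Y}"

lemma Gs_carrier: "a \<in> Gs Y \<Longrightarrow> a \<in> carrier GP"
  by (simp add: Gs_def)

lemma Gs_nu: "a \<in> Gs Y \<Longrightarrow> w \<notin> Y \<Longrightarrow> nu w a = 0"
  by (auto simp: Gs_def)

lemma Gs_cls: "xs \<in> W \<Longrightarrow> fst ` set xs \<subseteq> Y \<Longrightarrow> cls xs \<in> Gs Y"
proof -
  assume xs: "xs \<in> W" "fst ` set xs \<subseteq> Y"
  have "w \<in> Y" if "nu w (cls xs) > 0" for w
    using cnt_bound(1)[OF xs(1), of w] that cnt_pos[of w xs] xs(2) by auto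
  then show ?thesis using xs Gs_def by simp
qed

lemma Gs_red: "red xs \<Longrightarrow> cls xs \<in> Gs Y \<longleftrightarrow> fst ` set xs \<subseteq> Y"
proof -
  assume r: "red xs"
  have "cls xs \<in> Gs Y \<longleftrightarrow> (\<forall>w. w \<in> fst ` set xs \<longrightarrow> w \<in> Y)"
    unfolding Gs_def using red_nu[OF r] red_words[OF r] cnt_pos[of _ xs] by simp
  then show ?thesis by blast
qed

lemma Gs_mult: "a \<in> Gs Y \<Longrightarrow> b \<in> Gs Y \<Longrightarrow> a \<star> b \<in> Gs Y"
proof -
  assume a: "a \<in> Gs Y" and b: "b \<in> Gs Y"
  have c: "a \<in> carrier GP" "b \<in> carrier GP" using a b Gs_carrier by auto
  have "w \<in> Y" if "nu w (a \<star> b) > 0" for w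
  proof (rule ccontr)
    assume "w \<notin> Y"
    then have "nu w a = 0" "nu w b = 0" using Gs_nu a b by auto
    then show False using nu_mult_left[OF c, of w] that by simp
  qed
  then show ?thesis using c unfolding Gs_def by simp
qed

lemma Gs_inv: "a \<in> Gs Y \<Longrightarrow> iv a \<in> Gs Y"
  unfolding Gs_def using nu_inv by auto

lemma Gs_one: "\<one>\<^bsub>GP\<^esub> \<in> Gs Y"
  unfolding one_cls using Gs_cls[of "[]"] by simp

lemma Gs_mono: "Y \<subseteq> Z \<Longrightarrow> Gs Y \<subseteq> Gs Z"
  by (auto simp: Gs_def)

lemma Gs_Int: "a \<in> Gs Y \<Longrightarrow> a \<in> Gs Z \<Longrightarrow> a \<in> Gs (Y \<inter> Z)"
  by (auto simp: Gs_def)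

lemma Gs_pow: "a \<in> Gs Y \<Longrightarrow> a [^]\<^bsub>GP\<^esub> (n::nat) \<in> Gs Y"
  by (induction n) (auto simp: Gs_one Gs_mult)

lemma Gs_commute:
  assumes "a \<in> Gs Y" "b \<in> Gs Z" "\<And>y z. y \<in> Y \<Longrightarrow> z \<in> Z \<Longrightarrow> {y, z} \<in> E"
  shows "a \<star> b = b \<star> a"
proof -
  obtain xs where xs: "red xs" "xs \<in> W" "a = cls xs" using assms Gs_carrier red_cases by metis
  obtain ys where ys: "red ys" "ys \<in> W" "b = cls ys" using assms Gs_carrier red_cases by metis
  have X: "fst ` set xs \<subseteq> Y" "fst ` set ys \<subseteq> Z" using Gs_red assms xs ys by blast+
  have "eqv (xs @ ys) (ys @ xs)"
    using X(2) ys(2)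
  proof (induction ys)
    case Nil
    then show ?case using xs by (simp add: eqv_refl)
  next
    case (Cons l ys)
    obtain v x where l: "l = (v, x)" by (cases l)
    have w: "v \<in> V" "x \<in> carrier (G v)" "ys \<in> W" using Cons.prems l by auto
    have "\<forall>l\<in>set xs. {fst l, v} \<in> E" using X(1) Cons.prems l assms(3) by fastforce
    then have "eqv (xs @ (v, x) # ys) ((v, x) # xs @ ys)" using eqv_move_front xs w by simp
    also have "eqv ((v, x) # xs @ ys) ((v, x) # ys @ xs)" using Cons w by (intro eqv_Cons) auto
    finally show ?case using l by simp
  qed
  then show ?thesis using xs ys by (simp add: mult_cls cls_eq)
qed

definition lk :: "'v \<Rightarrow> 'v set" where "lk v = {u. {v, u} \<in> E}"

lemma lk_link: "v \<in> V \<Longrightarrow> lk v = link V E {v}"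
  unfolding lk_def link_def using edge_V by auto

lemma eta_lk:
  assumes h: "h \<in> Gs (lk v)" and a: "a \<in> carrier GP"
  shows "eta v (h \<star> a) = eta v a"
proof -
  obtain xs where xs: "red xs" "xs \<in> W" "h = cls xs" using h Gs_carrier red_cases by metis
  obtain ys where ys: "ys \<in> W" "a = cls ys" using a by (rule carrier_cases)
  have "fst ` set xs \<subseteq> lk v" using Gs_red h xs by blast
  then have "top v (foldr lact xs (piles ys)) = top v (piles ys)"
    using xs(2)
  proof (induction xs)
    case (Cons l xs)
    obtain u x where l: "l = (u, x)" by (cases l)
    have w: "{v, u} \<in> E" "u \<in> V" "xs \<in> W" using Cons.prems l lk_def by auto
    define p where "p = foldr lact xs (piles ys)"
    have p: "isp p" unfolding p_def using isp_foldr isp_piles w ys by blast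
    have r: "isp (rest u p)" using isp_decomp(2)[OF p w(2)] .
    have "top v (lact (u, x) p) = top v (rest u p)" unfolding lact_def using adj_put(1)[OF w(1) r] by simp
    also have "\<dots> = top v p" using adj_put(1)[OF w(1) r, of "top u p"] isp_decomp(4)[OF p w(2)] by simp
    finally show ?case using Cons l w unfolding p_def by simp
  qed simp
  then show ?thesis using xs ys by (simp add: mult_cls eta_cls piles_append)
qed

definition emb :: "'v \<Rightarrow> 'g \<Rightarrow> ('v \<times> 'g) list set" where "emb v k = cls [(v, k)]"

lemma emb_carrier [simp]: "v \<in> V \<Longrightarrow> k \<in> carrier (G v) \<Longrightarrow> emb v k \<in> carrier GP"
  by (simp add: emb_def)

lemma emb_mult: assumes "v \<in> V" "k \<in> carrier (G v)" "l \<in> carrier (G v)"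
  shows "emb v k \<star> emb v l = emb v (k \<otimes>\<^bsub>G v\<^esub> l)"
proof -
  interpret group "G v" using groups assms by simp
  show ?thesis using assms cls_eq eqv_merge[of v k l "[]"] by (simp add: emb_def mult_cls)
qed

lemma emb_one: "v \<in> V \<Longrightarrow> emb v \<one>\<^bsub>G v\<^esub> = \<one>\<^bsub>GP\<^esub>"
proof -
  assume v: "v \<in> V"
  interpret group "G v" using groups v by simp
  show ?thesis using v cls_eq eqv_del[of v "[]"] by (simp add: emb_def one_cls)
qed

lemma emb_inv: assumes "v \<in> V" "k \<in> carrier (G v)"
  shows "iv (emb v k) = emb v (inv\<^bsub>G v\<^esub> k)"
  using assms by (simp add: emb_def inv_cls)

lemma emb_Gs: "v \<in> V \<Longrightarrow> k \<in> carrier (G v) \<Longrightarrow> v \<in> Y \<Longrightarrow> emb v k \<in> Gs Y"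
  unfolding emb_def by (rule Gs_cls) auto

lemma eta_carrier: "a \<in> carrier GP \<Longrightarrow> v \<in> V \<Longrightarrow> eta v a \<in> carrier (G v)"
  unfolding eta_def using isp_decomp(1) isp_piles rw red_words by blast

text \<open>Only the presence of the leading \<open>v\<close>-letter changes. The count is stated as
  an equation of sums because subtraction on \<open>nat\<close> truncates.\<close>

lemma nu_emb:
  assumes "a \<in> carrier GP" "v \<in> V" "k \<in> carrier (G v)"
  shows "nu v (emb v k \<star> a) + (if eta v a = \<one>\<^bsub>G v\<^esub> then 0 else 1) =
    nu v a + (if k \<otimes>\<^bsub>G v\<^esub> eta v a = \<one>\<^bsub>G v\<^esub> then 0 else 1)"
    "eta v (emb v k \<star> a) = k \<otimes>\<^bsub>G v\<^esub> eta v a"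
proof -
  obtain xs where xs: "xs \<in> W" "a = cls xs" using assms by (auto elim: carrier_cases)
  have p: "isp (piles xs)" using isp_piles xs by blast
  show "nu v (emb v k \<star> a) + (if eta v a = \<one>\<^bsub>G v\<^esub> then 0 else 1) =
    nu v a + (if k \<otimes>\<^bsub>G v\<^esub> eta v a = \<one>\<^bsub>G v\<^esub> then 0 else 1)"
    "eta v (emb v k \<star> a) = k \<otimes>\<^bsub>G v\<^esub> eta v a"
    using xs assms p pnu_lact[OF p assms(2), of v k] pnu_decomp[OF p assms(2), of v] isp_lact(2)[OF p assms(2,3)]
    by (simp_all add: emb_def mult_cls nu_cls eta_cls)
qed

section \<open>Leading letters and the edge groups\<close>

lemma termin_split:
  assumes "red xs" "termin q xs"
  shows "\<exists>ys x. red (ys @ [(q, x)]) \<and> cls (ys @ [(q, x)]) = cls xs \<and> length xs = Suc (length ys) \<and> fst ` set ys \<subseteq> fst ` set xs"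
proof -
  have "initl q (rev xs)" using assms initl_rev by blast
  then obtain as x bs where ab: "rev xs = as @ (q, x) # bs" "\<forall>l\<in>set as. {fst l, q} \<in> E"
    unfolding initl_def by blast
  have "red ((q, x) # as @ bs)" using red_front ab assms red_rev by metis
  then have r: "red (rev (as @ bs) @ [(q, x)])" using red_rev[of "(q, x) # as @ bs"] by simp
  have xs: "xs = rev bs @ (q, x) # rev as"
  proof -
    have "xs = rev (as @ (q, x) # bs)" using ab(1) by (metis rev_rev_ident)
    then show ?thesis by simp
  qed
  have w: "xs \<in> W" using red_words assms by blast
  have q: "q \<in> V" "x \<in> carrier (G q)" "rev as \<in> W" "rev bs \<in> W" using w xs by auto
  have "fst ` set (rev as) \<subseteq> lk q" unfolding lk_def using ab(2) edge_sym by force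
  then have "cls [(q, x)] \<in> Gs {q}" "cls (rev as) \<in> Gs (lk q)"
    using q Gs_cls by simp_all
  then have "cls [(q, x)] \<star> cls (rev as) = cls (rev as) \<star> cls [(q, x)]"
    by (rule Gs_commute) (auto simp: lk_def)
  then have "cls ((q, x) # rev as) = cls (rev as @ [(q, x)])" using q by (simp add: mult_cls)
  then have "cls (rev bs) \<star> cls ((q, x) # rev as) = cls (rev bs) \<star> cls (rev as @ [(q, x)])" by simp
  then have "cls xs = cls (rev (as @ bs) @ [(q, x)])" using q xs by (simp add: mult_cls)
  then show ?thesis using r xs by (intro exI[of _ "rev (as @ bs)"] exI[of _ x]) auto
qed

lemma initl_split:
  assumes "red xs" "initl q xs"
  shows "\<exists>ys x. red ((q, x) # ys) \<and> cls ((q, x) # ys) = cls xs \<and> length xs = Suc (length ys) \<and> fst ` set ys \<subseteq> fst ` set xs"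
proof -
  obtain as x bs where ab: "xs = as @ (q, x) # bs" "\<forall>l\<in>set as. {fst l, q} \<in> E"
    using assms unfolding initl_def by blast
  have "red ((q, x) # as @ bs)" using red_front ab assms by metis
  moreover have "cls xs = cls ((q, x) # as @ bs)"
    using eqv_move_front[of as q x bs] ab red_words[OF assms(1)] cls_eq by simp
  ultimately show ?thesis using ab by (intro exI[of _ "as @ bs"] exI[of _ x]) auto
qed

text \<open>This becomes the uniqueness of the edge towards a given vertex. Terminal letters of
  \<open>h\<close> that commute with \<open>v\<close> are absorbed into \<open>a\<close> without
  changing its leading letter. When none is left, the concatenated word is reduced, and its
  \<open>v\<close>-letter can pass \<open>h\<close> only if \<open>h\<close> is empty.\<close>

lemma eta_separates:
  assumes h: "h \<in> Gs (V - {v})" and a: "a \<in> carrier GP" and v: "v \<in> V"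
    and ea: "eta v a \<noteq> \<one>\<^bsub>G v\<^esub>" and eh: "eta v (h \<star> a) \<noteq> \<one>\<^bsub>G v\<^esub>"
  shows "h \<in> Gs (lk v)"
proof -
  obtain hs where "red hs" "h = cls hs" using red_cases[OF Gs_carrier[OF h]] by blast
  then show ?thesis using h a ea eh
  proof (induction "length hs" arbitrary: hs h a rule: less_induct)
    case less
    have hsv: "fst ` set hs \<subseteq> V - {v}" using Gs_red[OF less.prems(1)] less.prems(2,3) by simp
    show ?case
    proof (cases "\<exists>q\<in>lk v. termin q hs")
      case True
      then obtain q where q: "q \<in> lk v" "termin q hs" by blast
      obtain ys x where ys: "red (ys @ [(q, x)])" "cls (ys @ [(q, x)]) = cls hs" "length hs = Suc (length ys)" "fst ` set ys \<subseteq> fst ` set hs"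
        using termin_split[OF less.prems(1) q(2)] by blast
      have yr: "red ys" and w: "ys \<in> W" "[(q, x)] \<in> W" using red_appendD ys(1) red_words by blast+
      define l where "l = cls [(q, x)]"
      have l: "l \<in> Gs (lk v)" unfolding l_def using w q by (intro Gs_cls) auto
      have hy: "h = cls ys \<star> l" unfolding l_def using less.prems(2) ys(2) w by (simp add: mult_cls)
      have yG: "cls ys \<in> Gs (V - {v})" using Gs_cls w ys(4) hsv by blast
      have lc: "l \<in> carrier GP" "cls ys \<in> carrier GP" using Gs_carrier l yG by auto
      have la: "l \<star> a \<in> carrier GP" "eta v (l \<star> a) \<noteq> \<one>\<^bsub>G v\<^esub>"
        using lc less.prems eta_lk[OF l less.prems(4)] by auto
      have "h \<star> a = cls ys \<star> (l \<star> a)" using hy lc less.prems by (simp add: GP.m_assoc)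
      then have "cls ys \<in> Gs (lk v)"
        using less.hyps[of ys "cls ys" "l \<star> a"] ys(3) yr yG la less.prems(6) by simp
      then show ?thesis using Gs_mult l hy by blast
    next
      case False
      obtain as where as: "red as" "as \<in> W" "a = cls as" using less.prems(4) by (rule red_cases)
      have "initl v as" using red_eta[OF as(1) v] less.prems(5) as by simp
      then obtain ys x where ys: "red ((v, x) # ys)" "cls ((v, x) # ys) = cls as"
        using initl_split[OF as(1)] by blast
      have r: "red (hs @ (v, x) # ys)"
      proof (rule red_append[OF less.prems(1) ys(1)])
        fix q assume q: "termin q hs"
        then have "q \<in> fst ` set hs" unfolding termin_def by force
        then have "q \<noteq> v" using hsv by auto
        then show "\<not> initl q ((v, x) # ys)" using False q by (auto simp: initl_Cons lk_def)
      qed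
      have w: "hs \<in> W" "(v, x) # ys \<in> W" using red_words less.prems(1) ys(1) by blast+
      have "h \<star> a = cls (hs @ (v, x) # ys)" using less.prems(2) as ys(2) w mult_cls by metis
      then have i: "initl v (hs @ (v, x) # ys)" using red_eta[OF r v] less.prems(6) by simp
      have "hs = []"
      proof (rule ccontr)
        assume "hs \<noteq> []"
        then obtain us l where l: "hs = us @ [l]" by (meson rev_exhaust)
        have "termin (fst l) hs" unfolding termin_def using l by (intro exI[of _ us] exI[of _ "snd l"] exI[of _ "[]"]) simp
        then have nl: "{v, fst l} \<notin> E" using False by (auto simp: lk_def)
        obtain as' z bs' where ab: "hs @ (v, x) # ys = as' @ (v, z) # bs'" "\<forall>l\<in>set as'. {fst l, v} \<in> E"
          using i unfolding initl_def by blast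
        have "v \<notin> fst ` set hs" using hsv by blast
        have "l \<in> set as'"
        proof -
          from ab(1) consider us' where "hs = as' @ us'" "us' @ (v, x) # ys = (v, z) # bs'"
            | us' where "as' = hs @ us'"
            by (auto simp: append_eq_append_conv2)
          then show ?thesis
          proof cases
            case 1
            then show ?thesis using \<open>v \<notin> fst ` set hs\<close> l by (cases us') (force simp: append_eq_append_conv2)+
          next
            case 2
            then show ?thesis using l by simp
          qed
        qed
        then show False using nl ab(2) edge_sym by blast
      qed
      then show ?thesis using less.prems(2) Gs_one one_cls by metis
    qed
  qed
qed

lemma split_first: "w \<in> fst ` set as \<Longrightarrow> \<exists>ys x zs. as = ys @ (w, x) # zs \<and> w \<notin> fst ` set ys"
proof (induction as)
  case (Cons l as)
  show ?case
  proof (cases "fst l = w")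
    case True
    then show ?thesis by (intro exI[of _ "[]"] exI[of _ "snd l"] exI[of _ as]) auto
  next
    case False
    then obtain ys x zs where "as = ys @ (w, x) # zs" "w \<notin> fst ` set ys" using Cons by auto
    then show ?thesis using False by (intro exI[of _ "l # ys"] exI[of _ x] exI[of _ zs]) auto
  qed
qed simp

text \<open>The element \<open>h\<close> cancels everything before the first \<open>v\<close>-letter
  of a reduced word.\<close>

lemma nu_pos_split:
  assumes a: "a \<in> carrier GP" and n: "nu v a > 0"
  shows "\<exists>h\<in>Gs (V - {v}). eta v (h \<star> a) \<noteq> \<one>\<^bsub>G v\<^esub>"
proof -
  obtain as where as: "red as" "as \<in> W" "a = cls as" using a by (rule red_cases)
  have "v \<in> fst ` set as" using n as red_nu cnt_pos by metis
  from split_first[OF this] obtain ys x zs where sp: "as = ys @ (v, x) # zs" "v \<notin> fst ` set ys" by blast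
  have r: "red ((v, x) # zs)" using red_appendD as sp by blast
  have v: "v \<in> V" using red_letters[OF r, of v x] by simp
  have w: "ys \<in> W" "(v, x) # zs \<in> W" using as sp by auto
  have ysV: "fst ` set ys \<subseteq> V - {v}"
    using w(1) sp(2) unfolding gp_words_def by force
  have "iv (cls ys) \<star> a = cls ((v, x) # zs)"
    using as(3) sp(1) w mult_cls[OF w] GP.inv_solve_left by (metis cls_carrier as(2))
  moreover have "eta v (cls ((v, x) # zs)) \<noteq> \<one>\<^bsub>G v\<^esub>" using red_eta[OF r v] by (simp add: initl_Cons)
  moreover have "iv (cls ys) \<in> Gs (V - {v})" using Gs_inv Gs_cls w ysV by blast
  ultimately show ?thesis by metis
qed

lemma GP_cancel [simp]:
  assumes "h \<in> carrier GP" "p \<in> carrier GP"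
  shows "h \<star> (iv h \<star> p) = p" "iv h \<star> (h \<star> p) = p"
  using assms by (simp_all add: GP.m_assoc[symmetric])

section \<open>The Bass--Serre tree of a vertex\<close>

lemma lk_V: "lk v \<subseteq> V - {v}"
  unfolding lk_def using edge_V edge_neq by auto

lemma star_decomp:
  assumes s: "s \<in> Gs (insert v (lk v))" and v: "v \<in> V"
  shows "\<exists>k\<in>carrier (G v). \<exists>l\<in>Gs (lk v). s = emb v k \<star> l"
proof -
  interpret Gv: group "G v" using groups v .
  obtain xs where xs: "red xs" "xs \<in> W" "s = cls xs" using red_cases[OF Gs_carrier[OF s]] by blast
  have "fst ` set xs \<subseteq> insert v (lk v)" using Gs_red[OF xs(1)] s xs(3) by simp
  then have "\<exists>k\<in>carrier (G v). \<exists>l\<in>Gs (lk v). cls xs = emb v k \<star> l" using xs(2)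
  proof (induction xs)
    case Nil
    have "cls [] = emb v \<one>\<^bsub>G v\<^esub> \<star> \<one>\<^bsub>GP\<^esub>" using emb_one[OF v] one_cls by simp
    then show ?case using Gs_one Gv.one_closed by blast
  next
    case (Cons a xs)
    obtain u x where a: "a = (u, x)" by (cases a)
    obtain k l where kl: "k \<in> carrier (G v)" "l \<in> Gs (lk v)" "cls xs = emb v k \<star> l" using Cons a by auto
    have w: "u \<in> V" "x \<in> carrier (G u)" "xs \<in> W" using Cons.prems a by auto
    have c: "emb v k \<in> carrier GP" "l \<in> carrier GP" "emb u x \<in> carrier GP" using kl v w Gs_carrier by auto
    have e: "cls (a # xs) = emb u x \<star> (emb v k \<star> l)"
      using kl(3) w a mult_cls[of "[a]" xs] by (simp add: emb_def)
    show ?case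
    proof (cases "u = v")
      case True
      then have "cls (a # xs) = emb v (x \<otimes>\<^bsub>G v\<^esub> k) \<star> l"
        using e c w kl v emb_mult GP.m_assoc by metis
      then show ?thesis using kl w True by blast
    next
      case False
      then have u: "u \<in> lk v" using Cons.prems a by auto
      then have ul: "emb u x \<in> Gs (lk v)" using emb_Gs w by blast
      have vl: "emb v k \<in> Gs {v}" using emb_Gs v kl by blast
      have "emb v k \<star> emb u x = emb u x \<star> emb v k"
        by (rule Gs_commute[OF vl ul]) (simp add: lk_def)
      then have "cls (a # xs) = emb v k \<star> (emb u x \<star> l)" using e c GP.m_assoc by metis
      then show ?thesis using kl Gs_mult ul by blast
    qed
  qed
  then show ?thesis using xs by simp
qed

text \<open>If \<open>b \<star> h\<close> had a leading \<open>v\<close>-letter and \<open>b\<close>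
  had none, multiplication by the inverse of that letter would lower the count of
  \<open>b \<star> h\<close> and raise that of \<open>b\<close>, although right multiplication by
  \<open>h\<close> preserves counts.\<close>

lemma eta_right:
  assumes b: "b \<in> carrier GP" and h: "h \<in> carrier GP" "nu v h = 0" and v: "v \<in> V"
  shows "eta v (b \<star> h) = \<one>\<^bsub>G v\<^esub> \<longleftrightarrow> eta v b = \<one>\<^bsub>G v\<^esub>"
proof -
  interpret Gv: group "G v" using groups v .
  have *: "eta v (b \<star> h) = \<one>\<^bsub>G v\<^esub>"
    if b: "b \<in> carrier GP" and h: "h \<in> carrier GP" "nu v h = 0" and e: "eta v b = \<one>\<^bsub>G v\<^esub>" for b h
  proof (rule ccontr)
    assume ne: "eta v (b \<star> h) \<noteq> \<one>\<^bsub>G v\<^esub>"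
    define k where "k = inv\<^bsub>G v\<^esub> (eta v (b \<star> h))"
    have ec: "eta v (b \<star> h) \<in> carrier (G v)" using eta_carrier b h v by simp
    have k: "k \<in> carrier (G v)" "k \<otimes>\<^bsub>G v\<^esub> eta v (b \<star> h) = \<one>\<^bsub>G v\<^esub>" "k \<noteq> \<one>\<^bsub>G v\<^esub>"
      unfolding k_def using ec ne by auto
    have "nu v (emb v k \<star> (b \<star> h)) + 1 = nu v (b \<star> h)"
      using nu_emb(1)[of "b \<star> h" v k] b h v k ne by simp
    moreover have "nu v (emb v k \<star> b) = nu v b + 1"
      using nu_emb(1)[of b v k] b v k e by simp
    moreover have "nu v (emb v k \<star> (b \<star> h)) = nu v (emb v k \<star> b)"
      using nu_mult_right[of "emb v k \<star> b" h v] b h v k by (simp add: GP.m_assoc)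
    moreover have "nu v (b \<star> h) = nu v b" using nu_mult_right b h by blast
    ultimately show False by simp
  qed
  have "b \<star> h \<star> iv h = b" using b h by (simp add: GP.m_assoc)
  then show ?thesis using *[of b h] *[of "b \<star> h" "iv h"] b h nu_inv[OF h(1), of v] by auto
qed

text \<open>The \<open>v\<close>-letters apart from a leading one; left multiplication by the star
  subgroup affects at most the leading one, which makes \<open>nu'\<close> a function on star
  cosets.\<close>

definition nu' :: "'v \<Rightarrow> ('v \<times> 'g) list set \<Rightarrow> nat" where
  "nu' v b = nu v b - (if eta v b = \<one>\<^bsub>G v\<^esub> then 0 else 1)"

lemma nu_pos: assumes "b \<in> carrier GP" "v \<in> V" "eta v b \<noteq> \<one>\<^bsub>G v\<^esub>" shows "nu v b > 0"
proof -
  interpret Gv: group "G v" using groups assms by simp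
  have "eta v b \<in> carrier (G v)" using eta_carrier assms by blast
  then show ?thesis using nu_emb(1)[of b v "inv\<^bsub>G v\<^esub> (eta v b)"] assms by simp
qed

lemma nu'_star:
  assumes s: "s \<in> Gs (insert v (lk v))" and b: "b \<in> carrier GP" and v: "v \<in> V"
  shows "nu' v (s \<star> b) = nu' v b"
proof -
  interpret Gv: group "G v" using groups v .
  obtain k l where k: "k \<in> carrier (G v)" and l: "l \<in> Gs (lk v)" and s: "s = emb v k \<star> l"
    using star_decomp[OF s v] by blast
  have lc: "l \<in> carrier GP" using Gs_carrier l .
  have "nu v l = 0" using Gs_nu[OF l] lk_V by blast
  then have 1: "nu v (l \<star> b) = nu v b" "eta v (l \<star> b) = eta v b"
    using nu_mult_left[OF lc b] eta_lk[OF l b] by auto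
  have lb: "l \<star> b \<in> carrier GP" using lc b by simp
  have "s \<star> b = emb v k \<star> (l \<star> b)" using s lc b k v by (simp add: GP.m_assoc)
  then show ?thesis
    using nu_emb[OF lb v k] 1 nu_pos[OF lb v] nu_pos[of "emb v k \<star> (l \<star> b)" v] lb v k
    unfolding nu'_def by (auto split: if_splits)
qed

lemma nu'_right:
  assumes "b \<in> carrier GP" "h \<in> carrier GP" "nu v h = 0" "v \<in> V"
  shows "nu' v (b \<star> h) = nu' v b"
  unfolding nu'_def using eta_right[OF assms] nu_mult_right[OF assms(1-3)] by simp

text \<open>The Bass--Serre tree of the splitting at \<open>v\<close>, the first component telling the two kinds of cosets
  apart.\<close>

definition vA :: "'v \<Rightarrow> ('v \<times> 'g) list set \<Rightarrow> bool \<times> ('v \<times> 'g) list set set" where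
  "vA v g = (True, (\<lambda>h. g \<star> h) ` Gs (V - {v}))"

definition vS :: "'v \<Rightarrow> ('v \<times> 'g) list set \<Rightarrow> bool \<times> ('v \<times> 'g) list set set" where
  "vS v g = (False, (\<lambda>h. g \<star> h) ` Gs (insert v (lk v)))"

definition bs_verts :: "'v \<Rightarrow> (bool \<times> ('v \<times> 'g) list set set) set" where
  "bs_verts v = vA v ` carrier GP \<union> vS v ` carrier GP"

definition bs_adj :: "'v \<Rightarrow> bool \<times> ('v \<times> 'g) list set set \<Rightarrow> bool \<times> ('v \<times> 'g) list set set \<Rightarrow> bool" where
  "bs_adj v x y \<longleftrightarrow> (\<exists>g\<in>carrier GP. (x = vA v g \<and> y = vS v g) \<or> (x = vS v g \<and> y = vA v g))"

definition bs_act :: "('v \<times> 'g) list set \<Rightarrow> bool \<times> ('v \<times> 'g) list set set \<Rightarrow> bool \<times> ('v \<times> 'g) list set set" where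
  "bs_act g x = (fst x, (\<lambda>h. g \<star> h) ` snd x)"

lemma Gs_coset_eq:
  assumes g: "g \<in> carrier GP" and h: "h \<in> carrier GP"
  shows "(\<lambda>a. g \<star> a) ` Gs Y = (\<lambda>a. h \<star> a) ` Gs Y \<longleftrightarrow> iv g \<star> h \<in> Gs Y"
proof
  assume e: "(\<lambda>a. g \<star> a) ` Gs Y = (\<lambda>a. h \<star> a) ` Gs Y"
  have "h \<star> \<one>\<^bsub>GP\<^esub> \<in> (\<lambda>a. g \<star> a) ` Gs Y" unfolding e using Gs_one by blast
  then obtain a where a: "a \<in> Gs Y" "h = g \<star> a" using h by auto
  then have "iv g \<star> h = a" using g Gs_carrier[OF a(1)] GP.inv_solve_left' by simp
  then show "iv g \<star> h \<in> Gs Y" using a by simp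
next
  have *: "(\<lambda>a. h \<star> a) ` Gs Y \<subseteq> (\<lambda>a. g \<star> a) ` Gs Y"
    if r: "iv g \<star> h \<in> Gs Y" "g \<in> carrier GP" "h \<in> carrier GP" for g h
  proof
    fix x assume "x \<in> (\<lambda>a. h \<star> a) ` Gs Y"
    then obtain a where a: "a \<in> Gs Y" "x = h \<star> a" by blast
    then have "x = g \<star> (iv g \<star> h \<star> a)" using Gs_carrier[OF a(1)] r by (simp add: GP.m_assoc[symmetric])
    then show "x \<in> (\<lambda>a. g \<star> a) ` Gs Y" using Gs_mult[OF r(1) a(1)] by blast
  qed
  assume r: "iv g \<star> h \<in> Gs Y"
  have "iv h \<star> g = iv (iv g \<star> h)" using g h by (simp add: GP.inv_mult_group)
  then have "iv h \<star> g \<in> Gs Y" using Gs_inv[OF r] by simp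
  then show "(\<lambda>a. g \<star> a) ` Gs Y = (\<lambda>a. h \<star> a) ` Gs Y" using *[OF r g h] *[of h g] g h by blast
qed

lemma vA_eq: "g \<in> carrier GP \<Longrightarrow> h \<in> carrier GP \<Longrightarrow> vA v g = vA v h \<longleftrightarrow> iv g \<star> h \<in> Gs (V - {v})"
  unfolding vA_def using Gs_coset_eq by simp

lemma vS_eq: "g \<in> carrier GP \<Longrightarrow> h \<in> carrier GP \<Longrightarrow> vS v g = vS v h \<longleftrightarrow> iv g \<star> h \<in> Gs (insert v (lk v))"
  unfolding vS_def using Gs_coset_eq by simp

lemma vA_neq_vS [simp]: "vA v g \<noteq> vS w h" "vS w h \<noteq> vA v g"
  by (simp_all add: vA_def vS_def)

lemma fst_v [simp]: "fst (vA v g)" "\<not> fst (vS v g)"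
  by (simp_all add: vA_def vS_def)

lemma bs_vertsI [simp]: "g \<in> carrier GP \<Longrightarrow> vA v g \<in> bs_verts v" "g \<in> carrier GP \<Longrightarrow> vS v g \<in> bs_verts v"
  by (simp_all add: bs_verts_def)

lemma bs_act_v:
  assumes "g \<in> carrier GP" "h \<in> carrier GP"
  shows "bs_act g (vA v h) = vA v (g \<star> h)" "bs_act g (vS v h) = vS v (g \<star> h)"
  unfolding vA_def vS_def bs_act_def using assms Gs_carrier
  by (auto simp: image_image GP.m_assoc intro!: image_cong)

text \<open>The distance from \<open>p\<close>, only meaningful if \<open>p\<close> is a coset of \<open>G\<^bsub>V - {v}\<^esub>\<close>; it does not depend on
  the representatives that \<open>SOME\<close> picks.\<close>

definition bs_lev :: "'v \<Rightarrow> bool \<times> ('v \<times> 'g) list set set \<Rightarrow> bool \<times> ('v \<times> 'g) list set set \<Rightarrow> nat" where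
  "bs_lev v p x = (let b = iv (SOME g. g \<in> snd x) \<star> (SOME g. g \<in> snd p) in
     if fst x then 2 * nu v b else 2 * nu' v b + 1)"

lemma coset_some:
  assumes "g \<in> carrier GP"
  shows "\<exists>a\<in>Gs Y. (SOME h. h \<in> (\<lambda>a. g \<star> a) ` Gs Y) = g \<star> a"
proof -
  have "(SOME h. h \<in> (\<lambda>a. g \<star> a) ` Gs Y) \<in> (\<lambda>a. g \<star> a) ` Gs Y"
    using Gs_one by (intro someI_ex[of "\<lambda>h. h \<in> (\<lambda>a. g \<star> a) ` Gs Y"]) blast
  then show ?thesis by blast
qed

lemma bs_lev_v:
  assumes v: "v \<in> V" and p: "p \<in> carrier GP" and g: "g \<in> carrier GP"
  shows "bs_lev v (vA v p) (vA v g) = 2 * nu v (iv g \<star> p)"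
    "bs_lev v (vA v p) (vS v g) = 2 * nu' v (iv g \<star> p) + 1"
proof -
  obtain a where a: "a \<in> Gs (V - {v})" "(SOME h. h \<in> snd (vA v p)) = p \<star> a"
    using coset_some[OF p] unfolding vA_def snd_conv by blast
  obtain b where b: "b \<in> Gs (V - {v})" "(SOME h. h \<in> snd (vA v g)) = g \<star> b"
    using coset_some[OF g] unfolding vA_def snd_conv by blast
  obtain c where c: "c \<in> Gs (insert v (lk v))" "(SOME h. h \<in> snd (vS v g)) = g \<star> c"
    using coset_some[OF g] unfolding vS_def snd_conv by blast
  have ac: "a \<in> carrier GP" "b \<in> carrier GP" "c \<in> carrier GP" using a b c Gs_carrier by blast+
  have z: "nu v a = 0" "nu v (iv b) = 0" using Gs_nu[OF a(1)] Gs_nu[OF Gs_inv[OF b(1)]] by auto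
  have gp: "iv g \<star> p \<in> carrier GP" using g p by simp
  have e: "iv (g \<star> h) \<star> (p \<star> a) = iv h \<star> (iv g \<star> p) \<star> a" if "h \<in> carrier GP" for h
    using that g p ac by (simp add: GP.inv_mult_group GP.m_assoc)
  have "nu v (iv b \<star> (iv g \<star> p) \<star> a) = nu v (iv g \<star> p)"
    using nu_mult_right[of "iv b \<star> (iv g \<star> p)" a v] nu_mult_left[of "iv b" "iv g \<star> p" v] gp ac z by simp
  then show "bs_lev v (vA v p) (vA v g) = 2 * nu v (iv g \<star> p)"
    unfolding bs_lev_def a(2) b(2) Let_def e[OF ac(2)] by simp
  have "nu' v (iv c \<star> (iv g \<star> p) \<star> a) = nu' v (iv g \<star> p)"
    using nu'_right[of "iv c \<star> (iv g \<star> p)" a v] nu'_star[OF Gs_inv[OF c(1)] gp v] gp ac z v by simp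
  then show "bs_lev v (vA v p) (vS v g) = 2 * nu' v (iv g \<star> p) + 1"
    unfolding bs_lev_def a(2) c(2) Let_def e[OF ac(3)] by simp
qed

lemma bs_verts_cases:
  assumes "x \<in> bs_verts v"
  obtains g where "g \<in> carrier GP" "x = vA v g" | g where "g \<in> carrier GP" "x = vS v g"
  using assms unfolding bs_verts_def by blast

lemma bs_verts_col: "p \<in> bs_verts v \<Longrightarrow> fst p \<Longrightarrow> \<exists>g\<in>carrier GP. p = vA v g"
  by (auto simp: bs_verts_def)

text \<open>The edge given by \<open>g\<close> leads nearer to the base vertex of \<open>p\<close>
  from its first coset exactly if \<open>iv g \<star> p\<close> has a leading
  \<open>v\<close>-letter; the prefix from \<open>nu_pos_split\<close> yields such a
  representative.\<close>

lemma bs_closer_A: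
  assumes v: "v \<in> V" and p: "p \<in> carrier GP" and g: "g \<in> carrier GP" and n: "nu v (iv g \<star> p) > 0"
  shows "\<exists>h\<in>carrier GP. vA v h = vA v g \<and> eta v (iv h \<star> p) \<noteq> \<one>\<^bsub>G v\<^esub>"
proof -
  obtain h where h: "h \<in> Gs (V - {v})" "eta v (h \<star> (iv g \<star> p)) \<noteq> \<one>\<^bsub>G v\<^esub>"
    using nu_pos_split[of "iv g \<star> p" v] n g p by auto
  have hc: "h \<in> carrier GP" using Gs_carrier h by blast
  have "iv (g \<star> iv h) \<star> p = h \<star> (iv g \<star> p)" using g p hc by (simp add: GP.inv_mult_group GP.m_assoc)
  moreover have "vA v (g \<star> iv h) = vA v g"
    using vA_eq[of g "g \<star> iv h" v] g hc Gs_inv[OF h(1)] by (simp add: GP.m_assoc[symmetric])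
  ultimately show ?thesis using h(2) g hc by (intro bexI[of _ "g \<star> iv h"]) auto
qed

text \<open>From a star coset the nearer edge is the one without leading letter, so that letter is
  moved into the representative.\<close>

lemma bs_closer_S:
  assumes v: "v \<in> V" and p: "p \<in> carrier GP" and g: "g \<in> carrier GP"
  shows "\<exists>h\<in>carrier GP. vS v h = vS v g \<and> eta v (iv h \<star> p) = \<one>\<^bsub>G v\<^esub>"
proof -
  interpret Gv: group "G v" using groups v .
  define e where "e = eta v (iv g \<star> p)"
  have e: "e \<in> carrier (G v)" unfolding e_def using eta_carrier g p v by simp
  have ec: "emb v e \<in> carrier GP" "emb v e \<in> Gs (insert v (lk v))" using e v emb_Gs by auto
  have "iv (g \<star> emb v e) \<star> p = emb v (inv\<^bsub>G v\<^esub> e) \<star> (iv g \<star> p)"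
    using g p ec v e by (simp add: GP.inv_mult_group GP.m_assoc emb_inv)
  then have "eta v (iv (g \<star> emb v e) \<star> p) = \<one>\<^bsub>G v\<^esub>"
    using nu_emb(2)[of "iv g \<star> p" v "inv\<^bsub>G v\<^esub> e"] g p v e e_def by simp
  moreover have "vS v (g \<star> emb v e) = vS v g"
    using vS_eq[of g "g \<star> emb v e" v] g ec by (simp add: GP.m_assoc[symmetric])
  ultimately show ?thesis using g ec by (intro bexI[of _ "g \<star> emb v e"]) auto
qed

lemma bs_lev_step:
  assumes v: "v \<in> V" and p: "p \<in> carrier GP" and g: "g \<in> carrier GP"
  shows "eta v (iv g \<star> p) = \<one>\<^bsub>G v\<^esub> \<Longrightarrow> bs_lev v (vA v p) (vS v g) = Suc (bs_lev v (vA v p) (vA v g))"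
    "eta v (iv g \<star> p) \<noteq> \<one>\<^bsub>G v\<^esub> \<Longrightarrow> bs_lev v (vA v p) (vA v g) = Suc (bs_lev v (vA v p) (vS v g))"
  using bs_lev_v[OF assms] nu_pos[of "iv g \<star> p" v] assms by (auto simp: nu'_def)

lemma bs_uniq_A:
  assumes v: "v \<in> V" and p: "p \<in> carrier GP" and g: "g \<in> carrier GP" and h: "h \<in> carrier GP"
    and e: "vA v g = vA v h" and eg: "eta v (iv g \<star> p) \<noteq> \<one>\<^bsub>G v\<^esub>" and eh: "eta v (iv h \<star> p) \<noteq> \<one>\<^bsub>G v\<^esub>"
  shows "vS v g = vS v h"
proof -
  have s: "iv g \<star> h \<in> Gs (V - {v})" using vA_eq e g h by blast
  have "iv g \<star> p = iv g \<star> h \<star> (iv h \<star> p)" using g h p by (simp add: GP.m_assoc)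
  then have "iv g \<star> h \<in> Gs (lk v)" using eta_separates[OF s, of "iv h \<star> p"] eg eh h p v by simp
  then have "iv g \<star> h \<in> Gs (insert v (lk v))" using Gs_mono[of "lk v" "insert v (lk v)"] by blast
  then show ?thesis using vS_eq g h by blast
qed

lemma bs_uniq_S:
  assumes v: "v \<in> V" and p: "p \<in> carrier GP" and g: "g \<in> carrier GP" and h: "h \<in> carrier GP"
    and e: "vS v g = vS v h" and eg: "eta v (iv g \<star> p) = \<one>\<^bsub>G v\<^esub>" and eh: "eta v (iv h \<star> p) = \<one>\<^bsub>G v\<^esub>"
  shows "vA v g = vA v h"
proof -
  interpret Gv: group "G v" using groups v .
  have s: "iv g \<star> h \<in> Gs (insert v (lk v))" using vS_eq e g h by blast
  obtain k l where k: "k \<in> carrier (G v)" and l: "l \<in> Gs (lk v)" and kl: "iv g \<star> h = emb v k \<star> l"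
    using star_decomp[OF s v] by blast
  have lc: "l \<in> carrier GP" using Gs_carrier l .
  have hp: "iv h \<star> p \<in> carrier GP" using h p by simp
  have "iv g \<star> p = iv g \<star> h \<star> (iv h \<star> p)" using g h p by (simp add: GP.m_assoc)
  then have "iv g \<star> p = emb v k \<star> (l \<star> (iv h \<star> p))" using kl hp lc k v by (simp add: GP.m_assoc)
  then have "eta v (iv g \<star> p) = k \<otimes>\<^bsub>G v\<^esub> eta v (iv h \<star> p)"
    using nu_emb(2)[of "l \<star> (iv h \<star> p)" v k] eta_lk[OF l hp] lc hp k v by simp
  then have "k = \<one>\<^bsub>G v\<^esub>" using eg eh k by simp
  then have "iv g \<star> h \<in> Gs (lk v)" using kl emb_one v lc l by simp
  then have "iv g \<star> h \<in> Gs (V - {v})" using Gs_mono[OF lk_V] by blast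
  then show ?thesis using vA_eq g h by blast
qed

lemma bs_tree:
  assumes v: "v \<in> V"
  shows "tree (bs_verts v) (bs_adj v) (walk_dist (bs_adj v)) fst"
    and "\<And>p x. \<lbrakk>p \<in> bs_verts v; fst p; x \<in> bs_verts v\<rbrakk> \<Longrightarrow> walk_dist (bs_adj v) p x = bs_lev v p x"
proof -
  have av: "x \<in> bs_verts v \<and> y \<in> bs_verts v" if "bs_adj v x y" for x y
    using that unfolding bs_adj_def by auto
  have as: "bs_adj v y x" if "bs_adj v x y" for x y
    using that unfolding bs_adj_def by blast
  have ac: "fst x \<noteq> fst y" if "bs_adj v x y" for x y
    using that unfolding bs_adj_def by auto
  have nb: "\<exists>y. bs_adj v x y" if "x \<in> bs_verts v" "\<not> fst x" for x
    using that unfolding bs_adj_def bs_verts_def by blast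
  have L0: "bs_lev v p x = 0 \<longleftrightarrow> x = p" if p: "p \<in> bs_verts v" "fst p" and x: "x \<in> bs_verts v" for p x
  proof -
    obtain q where q: "q \<in> carrier GP" "p = vA v q" using bs_verts_col p by blast
    show ?thesis using x
    proof (cases rule: bs_verts_cases)
      case (1 g)
      have "nu v (iv g \<star> q) = 0 \<longleftrightarrow> iv g \<star> q \<in> Gs (V - {v})"
        unfolding Gs_def using 1 q nu_V[of "iv g \<star> q"] by auto
      then show ?thesis using 1 q bs_lev_v[OF v q(1) 1(1)] vA_eq by simp
    next
      case (2 g)
      then show ?thesis using q bs_lev_v[OF v q(1) 2(1)] by simp
    qed
  qed
  have La: "bs_lev v p x = Suc (bs_lev v p y) \<or> bs_lev v p y = Suc (bs_lev v p x)"
    if p: "p \<in> bs_verts v" "fst p" and x: "bs_adj v x y" for p x y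
  proof -
    obtain q where q: "q \<in> carrier GP" "p = vA v q" using bs_verts_col p by blast
    show ?thesis using x bs_lev_step[OF v q(1)] q(2) unfolding bs_adj_def by blast
  qed
  have Lc: "\<exists>y. bs_adj v x y \<and> bs_lev v p x = Suc (bs_lev v p y)"
    if p: "p \<in> bs_verts v" "fst p" and x: "x \<in> bs_verts v" "x \<noteq> p" for p x
  proof -
    obtain q where q: "q \<in> carrier GP" "p = vA v q" using bs_verts_col p by blast
    show ?thesis using x(1)
    proof (cases rule: bs_verts_cases)
      case (1 g)
      have "bs_lev v p x \<noteq> 0" using L0[OF p x(1)] x(2) by blast
      then have "nu v (iv g \<star> q) > 0" using bs_lev_v[OF v q(1) 1(1)] q 1 by simp
      then obtain h where "h \<in> carrier GP" "vA v h = vA v g" "eta v (iv h \<star> q) \<noteq> \<one>\<^bsub>G v\<^esub>"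
        using bs_closer_A[OF v q(1) 1(1)] by blast
      then show ?thesis using bs_lev_step(2)[OF v q(1)] 1 q unfolding bs_adj_def by metis
    next
      case (2 g)
      then obtain h where "h \<in> carrier GP" "vS v h = vS v g" "eta v (iv h \<star> q) = \<one>\<^bsub>G v\<^esub>"
        using bs_closer_S[OF v q(1) 2(1)] by blast
      then show ?thesis using bs_lev_step(1)[OF v q(1)] 2 q unfolding bs_adj_def by metis
    qed
  qed
  have Lu: "y = z" if p: "p \<in> bs_verts v" "fst p" and xy: "bs_adj v x y" and xz: "bs_adj v x z"
    and dy: "bs_lev v p x = Suc (bs_lev v p y)" and dz: "bs_lev v p x = Suc (bs_lev v p z)" for p x y z
  proof -
    obtain q where q: "q \<in> carrier GP" "p = vA v q" using bs_verts_col p by blast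
    obtain g where g: "g \<in> carrier GP" "x = vA v g \<and> y = vS v g \<or> x = vS v g \<and> y = vA v g"
      using xy unfolding bs_adj_def by blast
    obtain h where h: "h \<in> carrier GP" "x = vA v h \<and> z = vS v h \<or> x = vS v h \<and> z = vA v h"
      using xz unfolding bs_adj_def by blast
    note sg = bs_lev_step[OF v q(1) g(1)] note sh = bs_lev_step[OF v q(1) h(1)]
    show ?thesis
    proof (cases "fst x")
      case True
      then have e: "x = vA v g" "y = vS v g" "x = vA v h" "z = vS v h" using g h by auto
      have "eta v (iv g \<star> q) \<noteq> \<one>\<^bsub>G v\<^esub>" using sg(1) dy e(1,2) q(2) by auto
      moreover have "eta v (iv h \<star> q) \<noteq> \<one>\<^bsub>G v\<^esub>" using sh(1) dz e(3,4) q(2) by auto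
      ultimately       show ?thesis using bs_uniq_A[OF v q(1) g(1) h(1)] e by simp
    next
      case False
      then have e: "x = vS v g" "y = vA v g" "x = vS v h" "z = vA v h" using g h by auto
      have "eta v (iv g \<star> q) = \<one>\<^bsub>G v\<^esub>" using sg(2) dy e(1,2) q(2) by auto
      moreover have "eta v (iv h \<star> q) = \<one>\<^bsub>G v\<^esub>" using sh(2) dz e(3,4) q(2) by auto
      ultimately       show ?thesis using bs_uniq_S[OF v q(1) g(1) h(1)] e by simp
    qed
  qed
  show "tree (bs_verts v) (bs_adj v) (walk_dist (bs_adj v)) fst"
    by (rule tree_of_levels(1)[where L = "bs_lev v"]) (fact av as ac nb L0 La Lc Lu)+
  show "walk_dist (bs_adj v) p x = bs_lev v p x" if "p \<in> bs_verts v" "fst p" "x \<in> bs_verts v" for p x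
    by (rule tree_of_levels(2)[where L = "bs_lev v" and col = fst and verts = "bs_verts v"])
      (fact av as ac nb L0 La Lc Lu that)+
qed

end

locale graph_prod_vertex = graph_prod +
  fixes v :: 'a
  assumes v: "v \<in> V"
begin

abbreviation "td \<equiv> walk_dist (bs_adj v)"

sublocale T: tree_act "bs_verts v" "bs_adj v" td fst GP bs_act
proof -
  interpret T: tree "bs_verts v" "bs_adj v" td fst using bs_tree v by blast
  show "tree_act (bs_verts v) (bs_adj v) td fst GP bs_act"
  proof (unfold_locales)
    show "bs_act g x \<in> bs_verts v" if "g \<in> carrier GP" "x \<in> bs_verts v" for g x
      using that(2) by (cases rule: bs_verts_cases) (use that in \<open>auto simp: bs_act_v\<close>)
    show "bs_act (g \<star> h) x = bs_act g (bs_act h x)" if "g \<in> carrier GP" "h \<in> carrier GP" "x \<in> bs_verts v" for g h x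
      using that(3) by (cases rule: bs_verts_cases) (use that in \<open>auto simp: bs_act_v GP.m_assoc\<close>)
    show "bs_act \<one>\<^bsub>GP\<^esub> x = x" if "x \<in> bs_verts v" for x
      using that by (cases rule: bs_verts_cases) (use that in \<open>auto simp: bs_act_v\<close>)
    show "bs_adj v (bs_act g x) (bs_act g y)" if "g \<in> carrier GP" "bs_adj v x y" for g x y
      using that unfolding bs_adj_def by (metis bs_act_v GP.m_closed)
    show "fst (bs_act g x) = fst x" for g x by (simp add: bs_act_def)
  qed
qed

lemma td_A: "p \<in> carrier GP \<Longrightarrow> g \<in> carrier GP \<Longrightarrow> td (vA v p) (vA v g) = 2 * nu v (iv g \<star> p)"
  using bs_tree(2)[OF v] bs_lev_v(1)[OF v] by simp

lemma td_S: "p \<in> carrier GP \<Longrightarrow> g \<in> carrier GP \<Longrightarrow> td (vA v p) (vS v g) = 2 * nu' v (iv g \<star> p) + 1"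
  using bs_tree(2)[OF v] bs_lev_v(2)[OF v] by simp

lemma fix_A:
  assumes "g \<in> carrier GP" "h \<in> carrier GP"
  shows "bs_act g (vA v h) = vA v h \<longleftrightarrow> iv h \<star> g \<star> h \<in> Gs (V - {v})"
proof -
  have "bs_act g (vA v h) = vA v h \<longleftrightarrow> vA v h = vA v (g \<star> h)" using assms bs_act_v by auto
  then show ?thesis using vA_eq[of h "g \<star> h" v] assms by (simp add: GP.m_assoc)
qed

lemma fix_S:
  assumes "g \<in> carrier GP" "h \<in> carrier GP"
  shows "bs_act g (vS v h) = vS v h \<longleftrightarrow> iv h \<star> g \<star> h \<in> Gs (insert v (lk v))"
proof -
  have "bs_act g (vS v h) = vS v h \<longleftrightarrow> vS v h = vS v (g \<star> h)" using assms bs_act_v by auto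
  then show ?thesis using vS_eq[of h "g \<star> h" v] assms by (simp add: GP.m_assoc)
qed

end

context graph_prod
begin

section \<open>Cyclically reduced elements and rigidity of axes\<close>

lemma red_of_glen:
  assumes "xs \<in> W" "length xs \<le> glen (cls xs)"
  shows "red xs"
proof (rule ccontr)
  assume "\<not> red xs"
  then obtain ys where ys: "eqv xs ys" "length ys < length xs" using not_red_shorten assms by blast
  then have "glen (cls xs) \<le> length ys" using cnt_bound(2) cls_eq eqv_words by metis
  then show False using assms(2) ys by simp
qed

text \<open>Minimal length in the conjugacy class is used as cyclic reducedness: by
  \<open>cmin_rotate\<close> all rotations of a reduced word stay reduced.\<close>

definition cmin :: "('v \<times> 'g) list set \<Rightarrow> bool" where
  "cmin c \<longleftrightarrow> c \<in> carrier GP \<and> (\<forall>g\<in>carrier GP. glen c \<le> glen (iv g \<star> c \<star> g))"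

lemma conj_conj:
  assumes "c \<in> carrier GP" "p \<in> carrier GP" "g \<in> carrier GP"
  shows "iv g \<star> (iv p \<star> c \<star> p) \<star> g = iv (p \<star> g) \<star> c \<star> (p \<star> g)"
  using assms by (simp add: GP.inv_mult_group GP.m_assoc)

lemma cmin_exists:
  assumes t: "t \<in> carrier GP"
  shows "\<exists>p\<in>carrier GP. cmin (iv p \<star> t \<star> p)"
proof -
  have "\<exists>p. p \<in> carrier GP \<and> (\<forall>g. g \<in> carrier GP \<longrightarrow> glen (iv p \<star> t \<star> p) \<le> glen (iv g \<star> t \<star> g))"
    using ex_has_least_nat[of "\<lambda>p. p \<in> carrier GP" "\<one>\<^bsub>GP\<^esub>" "\<lambda>p. glen (iv p \<star> t \<star> p)"] by simp
  then obtain p where p: "p \<in> carrier GP" "\<And>g. g \<in> carrier GP \<Longrightarrow> glen (iv p \<star> t \<star> p) \<le> glen (iv g \<star> t \<star> g)"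
    by blast
  then show ?thesis unfolding cmin_def using t conj_conj[OF t p(1)] by (intro bexI[of _ p]) auto
qed

lemma cmin_rotate:
  assumes r: "red (xs @ ys)" and c: "cmin (cls (xs @ ys))"
  shows "red (ys @ xs)" "cmin (cls (ys @ xs))"
proof -
  have w: "xs \<in> W" "ys \<in> W" using red_words[OF r] by auto
  have xc: "cls xs \<in> carrier GP" "cls ys \<in> carrier GP" "cls (xs @ ys) \<in> carrier GP" using w by auto
  have e: "cls (ys @ xs) = iv (cls xs) \<star> cls (xs @ ys) \<star> cls xs"
    using xc by (simp add: mult_cls[symmetric] w GP.m_assoc)
  have "glen (cls (xs @ ys)) \<le> glen (cls (ys @ xs))" unfolding e using c xc cmin_def by blast
  then show "red (ys @ xs)" using red_glen[OF r] w by (intro red_of_glen) auto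
  then have "glen (cls (ys @ xs)) = glen (cls (xs @ ys))" using red_glen r by simp
  then show "cmin (cls (ys @ xs))" using c xc unfolding cmin_def e by (simp add: conj_conj del: mult_cls)
qed

lemma initl_winv: "initl v (winv xs) \<longleftrightarrow> termin v xs"
proof -
  have *: "initl v (map (\<lambda>(v, g). (v, inv\<^bsub>G v\<^esub> g)) ys) \<longleftrightarrow> initl v ys" for ys
    by (induction ys) (auto simp: initl_Cons)
  show ?thesis unfolding winv_def by (simp add: rev_map * initl_rev)
qed

end

context graph_prod_vertex
begin

text \<open>A terminal \<open>v\<close>-letter is either the first letter itself, and then all
  others commute with \<open>v\<close>, or a second one, and then a further rotation makes the two
  mergeable in a reduced word.\<close>

lemma cmin_not_backtracking:
  assumes r: "red (as @ (v, x) # bs)" and c: "cmin (cls (as @ (v, x) # bs))"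
    and n: "\<not> fst ` set (as @ (v, x) # bs) \<subseteq> insert v (lk v)"
  shows "\<not> termin v ((v, x) # bs @ as)"
proof
  assume "termin v ((v, x) # bs @ as)"
  then obtain ys y zs where e: "(v, x) # bs @ as = ys @ (v, y) # zs" "\<forall>l\<in>set zs. {fst l, v} \<in> E"
    unfolding termin_def by blast
  have r': "red ((v, x) # bs @ as)" "cmin (cls ((v, x) # bs @ as))" using cmin_rotate[OF r c] by auto
  show False
  proof (cases ys)
    case Nil
    then have "zs = bs @ as" using e(1) by simp
    then have "fst ` set (as @ (v, x) # bs) \<subseteq> insert v (lk v)" using e(2) edge_sym unfolding lk_def by fastforce
    then show False using n by blast
  next
    case (Cons a us)
    then have ee: "(v, x) # bs @ as = ((v, x) # us) @ (v, y) # zs" using e(1) by simp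
    have "red (((v, y) # zs) @ (v, x) # us)" using cmin_rotate(1)[of "(v, x) # us" "(v, y) # zs"] r' ee by simp
    then have "red ((v, y) # zs @ (v, x) # us)" by simp
    then have "\<not> initl v (zs @ (v, x) # us)" using red_Cons by blast
    then show False using e(2) unfolding initl_def by blast
  qed
qed

lemma adj_A: "g \<in> carrier GP \<Longrightarrow> bs_adj v (vA v g) (vS v g)"
  unfolding bs_adj_def by blast

text \<open>The geodesic from the base vertex to its image leaves through the star coset of the
  prefix \<open>a\<close> before the first \<open>v\<close>-letter. Backtracking at the image would
  give the rotation that starts with this letter a terminal \<open>v\<close>-letter.\<close>

lemma cmin_axis:
  assumes c: "cmin c" and n: "nu v c > 0" and st: "c \<notin> Gs (insert v (lk v))"
  shows "\<exists>A. T.is_axis c A (int (2 * nu v c)) \<and> A 0 = vA v \<one>\<^bsub>GP\<^esub>"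
proof -
  interpret Gv: group "G v" using groups v .
  have cc: "c \<in> carrier GP" using c cmin_def by blast
  obtain ws where ws: "red ws" "ws \<in> W" "c = cls ws" using cc by (rule red_cases)
  have "v \<in> fst ` set ws" using n ws red_nu[OF ws(1)] cnt_pos[of v ws] by simp
  from split_first[OF this] obtain as x bs where ab: "ws = as @ (v, x) # bs" "v \<notin> fst ` set as" by blast
  have n': "\<not> fst ` set ws \<subseteq> insert v (lk v)" using Gs_red[OF ws(1)] st ws(3) by simp
  have nb: "\<not> termin v ((v, x) # bs @ as)"
    using cmin_not_backtracking[of as x bs] ws ab c n' by simp
  have rot: "red ((v, x) # bs @ as)" using cmin_rotate(1)[of as "(v, x) # bs"] ws ab c by simp
  define a where "a = cls as"
  have asw: "as \<in> W" "(v, x) # bs \<in> W" using ws ab by auto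
  have ac: "a \<in> carrier GP" unfolding a_def using asw by simp
  have "fst ` set as \<subseteq> V - {v}" using asw(1) ab(2) unfolding gp_words_def by force
  then have aG: "a \<in> Gs (V - {v})" unfolding a_def using Gs_cls asw by blast
  have nua: "nu v a = 0" using Gs_nu[OF aG] by simp
  have ca: "iv a \<star> c = cls ((v, x) # bs)"
    unfolding ws(3) ab(1) a_def using mult_cls[OF asw] asw by (metis GP_cancel(2) cls_carrier)
  have rb: "red ((v, x) # bs)" using red_appendD ws ab by blast
  have eta1: "eta v (iv a \<star> c) \<noteq> \<one>\<^bsub>G v\<^esub>" unfolding ca using red_eta[OF rb v] by (simp add: initl_Cons)
  let ?o = "vA v \<one>\<^bsub>GP\<^esub>" and ?m = "2 * nu v c"
  have ov: "?o \<in> bs_verts v" "vA v c \<in> bs_verts v" using cc by auto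
  have act: "bs_act c ?o = vA v c" using bs_act_v cc by simp
  have dm: "td ?o (vA v c) = ?m" using td_A[of "\<one>\<^bsub>GP\<^esub>" c] cc nu_inv by simp
  obtain f where f: "f 0 = ?o" "f ?m = vA v c" "\<And>i. i < ?m \<Longrightarrow> bs_adj v (f i) (f (Suc i))"
    "\<And>i. i \<le> ?m \<Longrightarrow> td ?o (f i) = i \<and> f i \<in> bs_verts v"
    using T.geodesic_path[OF ov] unfolding dm by blast
  have dc: "td (vA v c) (f 1) + 1 = ?m" "td (vA v c) ?o = ?m"
  proof -
    show 1: "td (vA v c) ?o = ?m" using dm T.d_sym ov by metis
    have a1: "bs_adj v ?o (f 1)" using f(1) f(3)[of 0] n by simp
    have v1: "f 1 \<in> bs_verts v" using f(4)[of 1] n by simp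
    have "td (vA v c) (f 1) \<le> ?m - 1"
    proof -
      have "td (f (?m - j)) (f ?m) \<le> j" if "j \<le> ?m" for j
        using that
      proof (induction j)
        case 0
        then show ?case using f(4)[of ?m] by simp
      next
        case (Suc j)
        have s: "Suc (?m - Suc j) = ?m - j" using Suc.prems by simp
        have ad: "bs_adj v (f (?m - Suc j)) (f (?m - j))" using f(3)[of "?m - Suc j"] Suc.prems unfolding s by simp
        have vv: "f (?m - Suc j) \<in> bs_verts v" "f (?m - j) \<in> bs_verts v" "f ?m \<in> bs_verts v" using f(4) by auto
        have "td (f (?m - Suc j)) (f ?m) \<le> td (f (?m - Suc j)) (f (?m - j)) + td (f (?m - j)) (f ?m)"
          using T.d_tri[OF vv] .
        then show ?case using T.d_adj_one[OF ad] Suc by simp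
      qed
      from this[of "?m - 1"] have "td (f 1) (vA v c) \<le> ?m - 1" using f(2) n by simp
      then show ?thesis using T.d_sym[OF v1 ov(2)] by simp
    qed
    then show "td (vA v c) (f 1) + 1 = ?m" using T.d_adj[OF ov(2) a1] 1 n by linarith
  qed
  have f1: "f 1 = vS v a"
  proof (rule T.closer_unique[OF ov(2), of ?o])
    show "bs_adj v ?o (f 1)" using f(1) f(3)[of 0] n by simp
    have oa: "vA v a = ?o" using vA_eq[of "\<one>\<^bsub>GP\<^esub>" a v] ac aG by simp
    then show "bs_adj v ?o (vS v a)" using adj_A[OF ac] by simp
    show "td (vA v c) ?o = Suc (td (vA v c) (f 1))" using dc by simp
    have "td (vA v c) (vA v a) = Suc (td (vA v c) (vS v a))"
      using td_A[OF cc ac] td_S[OF cc ac] nu_pos[OF _ v eta1] eta1 cc ac unfolding nu'_def by simp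
    then show "td (vA v c) ?o = Suc (td (vA v c) (vS v a))" unfolding oa .
  qed
  have nbm: "bs_act c (f 1) \<noteq> f (?m - 1)"
  proof
    assume e: "bs_act c (f 1) = f (?m - 1)"
    have ss: "Suc (?m - 1) = ?m" using n by simp
    have "bs_adj v (f (?m - 1)) (vA v c)" using f(3)[of "?m - 1"] f(2) n unfolding ss by simp
    have "f (?m - 1) = vS v (c \<star> a)" using e f1 bs_act_v cc ac by simp
    then have "td ?o (vS v (c \<star> a)) = ?m - 1" using f(4)[of "?m - 1"] by simp
    then have e1: "2 * nu' v (iv (c \<star> a)) + 1 = ?m - 1" using td_S[of "\<one>\<^bsub>GP\<^esub>" "c \<star> a"] cc ac by simp
    have "nu v (iv (c \<star> a)) = nu v c" using nu_inv nu_mult_right[OF cc ac nua] cc ac by simp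
    \<comment> \<open>By \<open>e1\<close> the value of \<open>nu'\<close> is one less than that of
      \<open>nu\<close>, so there is a leading letter.\<close>
    then have "eta v (iv (c \<star> a)) \<noteq> \<one>\<^bsub>G v\<^esub>" using e1 n unfolding nu'_def by (auto split: if_splits)
    then have "eta v (iv (c \<star> a) \<star> a) \<noteq> \<one>\<^bsub>G v\<^esub>" using eta_right[of "iv (c \<star> a)" a v] cc ac nua v by simp
    moreover have "iv (c \<star> a) \<star> a = iv (cls ((v, x) # bs @ as))"
    proof -
      have "cls ((v, x) # bs @ as) = iv a \<star> c \<star> a" unfolding ca using mult_cls[OF asw(2,1)] by (simp add: a_def)
      then show ?thesis using cc ac by (simp add: GP.inv_mult_group GP.m_assoc)
    qed
    moreover have "iv (cls ((v, x) # bs @ as)) = cls (winv ((v, x) # bs @ as))" using inv_cls red_words[OF rot] by blast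
    ultimately have "initl v (winv ((v, x) # bs @ as))" using red_eta[OF winv_red[OF rot] v] by simp
    then show False using nb initl_winv by blast
  qed
  have "\<exists>A. T.is_axis c A (int ?m) \<and> A 0 = f 0 \<and> A 1 = f 1"
  proof (rule T.axis_from_path[OF cc])
    show "?m \<ge> 1" using n by simp
    show "bs_adj v (f i) (f (Suc i))" if "i < ?m" for i using f(3) that .
    show "f i \<noteq> f (Suc (Suc i))" if "Suc (Suc i) \<le> ?m" for i
    proof
      assume "f i = f (Suc (Suc i))"
      then show False using f(4)[of i] f(4)[of "Suc (Suc i)"] that by simp
    qed
    show "f ?m = bs_act c (f 0)" using f act by simp
    show "bs_act c (f 1) \<noteq> f (?m - 1)" by (fact nbm)
  qed
  then show ?thesis using f(1) by metis
qed

text \<open>The geodesic between the two fixed cosets passes the edge given by the prefix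
  \<open>xs\<close>, because counts add up along a reduced word. So \<open>z\<close> fixes that
  edge, whose stabiliser is a conjugate of \<open>Gs (lk v)\<close>.\<close>

lemma between_pos_v:
  assumes r: "red (xs @ (v, x) # ys)" and p: "p \<in> carrier GP" and z: "z \<in> carrier GP"
    and zp: "iv p \<star> z \<star> p \<in> Gs (V - {v})"
    and q: "q = p \<star> cls (xs @ (v, x) # ys)" and zq: "iv q \<star> z \<star> q \<in> Gs (V - {v})"
  shows "iv (p \<star> cls xs) \<star> z \<star> (p \<star> cls xs) \<in> Gs (lk v)"
proof -
  interpret Gv: group "G v" using groups v .
  have w: "xs \<in> W" "(v, x) # ys \<in> W" using red_words[OF r] by auto
  have ry: "red xs" "red ((v, x) # ys)" using red_appendD[OF r] by auto
  define s where "s = p \<star> cls xs"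
  have sc: "s \<in> carrier GP" "q \<in> carrier GP" "cls xs \<in> carrier GP" "cls ((v, x) # ys) \<in> carrier GP"
    unfolding s_def q using p w by (auto simp del: words_Cons intro: cls_carrier)
  have qs: "q = s \<star> cls ((v, x) # ys)" unfolding s_def q using mult_cls[OF w] p sc by (simp add: GP.m_assoc)
  have V: "vA v p \<in> bs_verts v" "vA v q \<in> bs_verts v" "vA v s \<in> bs_verts v" "vS v s \<in> bs_verts v"
    using p sc by auto
  have ps: "iv p \<star> s = cls xs" "iv p \<star> q = cls (xs @ (v, x) # ys)" "iv s \<star> q = cls ((v, x) # ys)"
  proof -
    show "iv p \<star> s = cls xs" unfolding s_def using p sc(3) by (rule GP_cancel(2))
    show "iv p \<star> q = cls (xs @ (v, x) # ys)" unfolding q using p cls_carrier[OF red_words[OF r]] by (rule GP_cancel(2))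
    show "iv s \<star> q = cls ((v, x) # ys)" unfolding qs using sc(1,4) by (rule GP_cancel(2))
  qed
  have d1: "td (vA v p) (vA v q) = 2 * cnt v xs + 2 * cnt v ((v, x) # ys)"
  proof -
    have "td (vA v q) (vA v p) = 2 * nu v (iv p \<star> q)" using td_A p sc by blast
    then show ?thesis using T.d_sym[OF V(1,2)] ps(2) red_nu[OF r] by simp
  qed
  have d2: "td (vA v p) (vA v s) = 2 * cnt v xs"
  proof -
    have "td (vA v s) (vA v p) = 2 * nu v (iv p \<star> s)" using td_A p sc by blast
    then show ?thesis using T.d_sym[OF V(1,3)] ps(1) red_nu[OF ry(1)] by simp
  qed
  have d3: "td (vA v q) (vA v s) = 2 * cnt v ((v, x) # ys)"
    using td_A[OF sc(2) sc(1)] ps(3) red_nu[OF ry(2)] by simp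
  have e: "eta v (cls ((v, x) # ys)) \<noteq> \<one>\<^bsub>G v\<^esub>" using red_eta[OF ry(2) v] by (simp add: initl_Cons)
  have d4: "td (vA v q) (vS v s) + 1 = td (vA v q) (vA v s)"
    using td_S[OF sc(2) sc(1)] d3 ps(3) red_nu[OF ry(2)] e unfolding nu'_def by simp
  have d5: "td (vA v p) (vS v s) \<le> td (vA v p) (vA v s) + 1"
    using T.d_tri[OF V(1,3,4)] T.d_adj_one[OF adj_A[OF sc(1)]] by simp
  have d6: "td (vA v p) (vA v q) \<le> td (vA v p) (vS v s) + td (vS v s) (vA v q)"
    using T.d_tri[OF V(1,4,2)] .
  have s1: "td (vS v s) (vA v q) = td (vA v q) (vS v s)" "td (vA v s) (vA v q) = td (vA v q) (vA v s)"
    using T.d_sym V by auto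
  have b1: "T.btw (vA v p) (vA v s) (vA v q)" unfolding T.btw_def using V d1 d2 d3 s1 by simp
  have b2: "T.btw (vA v p) (vS v s) (vA v q)" unfolding T.btw_def using V d1 d2 d3 d4 d5 d6 s1 by linarith
  have f: "bs_act z (vA v p) = vA v p" "bs_act z (vA v q) = vA v q" using fix_A z p sc zp zq by auto
  have "bs_act z (vA v s) = vA v s" "bs_act z (vS v s) = vS v s"
    using T.fix_between[OF z b1 f] T.fix_between[OF z b2 f] .
  then have "iv s \<star> z \<star> s \<in> Gs (V - {v})" "iv s \<star> z \<star> s \<in> Gs (insert v (lk v))"
    using fix_A fix_S z sc by auto
  then have "iv s \<star> z \<star> s \<in> Gs ((V - {v}) \<inter> insert v (lk v))" by (rule Gs_Int)
  then show ?thesis unfolding s_def[symmetric] using Gs_mono[of "(V - {v}) \<inter> insert v (lk v)" "lk v"] by blast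
qed

text \<open>The base vertex lies on an axis, so the power moves it by \<open>k\<close> periods, and
  its displacement is twice the letter count.\<close>

lemma cmin_pow_nu_v:
  assumes c: "cmin c" and n: "nu v c > 0" and st: "c \<notin> Gs (insert v (lk v))"
  shows "nu v (c [^]\<^bsub>GP\<^esub> (k::nat)) = k * nu v c"
proof -
  have cc: "c \<in> carrier GP" using c cmin_def by blast
  obtain A where A: "T.is_axis c A (int (2 * nu v c))" "A 0 = vA v \<one>\<^bsub>GP\<^esub>" using cmin_axis[OF assms] by blast
  have "A (0 + int k * int (2 * nu v c)) = vA v (c [^]\<^bsub>GP\<^esub> k)"
    using T.axis_pow[OF cc A(1), of k 0] A(2) bs_act_v(1)[of "c [^]\<^bsub>GP\<^esub> k" "\<one>\<^bsub>GP\<^esub>"] cc by simp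
  moreover have "int (td (A 0) (A (0 + int k * int (2 * nu v c)))) = int k * int (2 * nu v c)"
    using T.line_d[OF T.is_axisD(1)[OF A(1)], of 0 "0 + int k * int (2 * nu v c)"] by simp
  moreover have "td (vA v \<one>\<^bsub>GP\<^esub>) (vA v (c [^]\<^bsub>GP\<^esub> k)) = 2 * nu v (c [^]\<^bsub>GP\<^esub> k)"
    using td_A[of "\<one>\<^bsub>GP\<^esub>" "c [^]\<^bsub>GP\<^esub> k"] cc nu_inv by simp
  ultimately have "int (2 * nu v (c [^]\<^bsub>GP\<^esub> k)) = int (k * (2 * nu v c))" using A(2) by simp
  then have "2 * nu v (c [^]\<^bsub>GP\<^esub> k) = k * (2 * nu v c)" using of_nat_eq_iff by blast
  then show ?thesis by simp
qed

end

context graph_prod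
begin

lemma cmin_pow_nu:
  assumes "cmin c" "nu w c > 0" "c \<notin> Gs (insert w (lk w))"
  shows "nu w (c [^]\<^bsub>GP\<^esub> (k::nat)) = k * nu w c"
proof -
  have "w \<in> V" using nu_V[of c w] assms cmin_def by blast
  then interpret w: graph_prod_vertex V E G w by unfold_locales
  show ?thesis using w.cmin_pow_nu_v assms by blast
qed

lemma between_pos:
  assumes "u \<in> V" "red (xs @ (u, x) # ys)" "p \<in> carrier GP" "z \<in> carrier GP"
    "iv p \<star> z \<star> p \<in> Gs (V - {u})"
    "q = p \<star> cls (xs @ (u, x) # ys)" "iv q \<star> z \<star> q \<in> Gs (V - {u})"
  shows "iv (p \<star> cls xs) \<star> z \<star> (p \<star> cls xs) \<in> Gs (lk u)"
proof -
  interpret u: graph_prod_vertex V E G u using assms(1) by unfold_locales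
  show ?thesis using u.between_pos_v[OF assms(2-7)] .
qed

lemma cls_filter_split:
  assumes "xs \<in> W" "\<And>l l'. \<lbrakk>l \<in> set xs; l' \<in> set xs; fst l \<in> S; fst l' \<notin> S\<rbrakk> \<Longrightarrow> {fst l, fst l'} \<in> E"
  shows "cls xs = cls (filter (\<lambda>l. fst l \<in> S) xs) \<star> cls (filter (\<lambda>l. fst l \<notin> S) xs)"
  using assms
proof (induction xs)
  case Nil
  then show ?case using one_cls by (metis GP.one_closed GP.r_one filter.simps(1))
next
  case (Cons l xs)
  let ?a = "filter (\<lambda>l. fst l \<in> S) xs" and ?b = "filter (\<lambda>l. fst l \<notin> S) xs"
  have w: "[l] \<in> W" "xs \<in> W" "?a \<in> W" "?b \<in> W" using Cons.prems(1) by (cases l; auto simp: gp_words_def)+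
  have c: "cls [l] \<in> carrier GP" "cls ?a \<in> carrier GP" "cls ?b \<in> carrier GP" using w by simp_all
  have IH: "cls xs = cls ?a \<star> cls ?b" using Cons.IH[OF w(2)] Cons.prems(2) by simp
  have e: "cls (l # xs) = cls [l] \<star> (cls ?a \<star> cls ?b)" using mult_cls[OF w(1,2)] IH by simp
  show ?case
  proof (cases "fst l \<in> S")
    case True
    then show ?thesis using e mult_cls[OF w(1,3)] c by (simp add: GP.m_assoc[symmetric])
  next
    case False
    have 1: "cls [l] \<in> Gs {fst l}" "cls ?a \<in> Gs (fst ` set ?a)" using Gs_cls w by auto
    have "cls [l] \<star> cls ?a = cls ?a \<star> cls [l]"
    proof (rule Gs_commute[OF 1])
      fix y w assume "y \<in> {fst l}" "w \<in> fst ` set ?a"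
      then obtain l' where l': "l' \<in> set xs" "fst l' \<in> S" "w = fst l'" "y = fst l" by auto
      then have "{fst l', fst l} \<in> E" using Cons.prems(2)[of l' l] False by simp
      then show "{y, w} \<in> E" using l' edge_sym by blast
    qed
    then have "cls (l # xs) = cls ?a \<star> (cls [l] \<star> cls ?b)" using e c by (simp add: GP.m_assoc[symmetric])
    then show ?thesis using mult_cls[OF w(1,4)] False by simp
  qed
qed

text \<open>The ball around \<open>v\<close> in the complement of the graph induced on \<open>B\<close>.\<close>

primrec lay :: "'v set \<Rightarrow> 'v \<Rightarrow> nat \<Rightarrow> 'v set" where
  "lay B v 0 = {v}"
| "lay B v (Suc i) = lay B v i \<union> {u \<in> B. \<exists>u'\<in>lay B v i. u \<noteq> u' \<and> {u, u'} \<notin> E}"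

lemma lay_mono: "i \<le> j \<Longrightarrow> lay B v i \<subseteq> lay B v j"
  by (induction j rule: dec_induct) auto

lemma lay_subset: "v \<in> B \<Longrightarrow> lay B v i \<subseteq> B"
  by (induction i) auto

lemma lay_const: "lay B v (Suc i) = lay B v i \<Longrightarrow> lay B v (i + n) = lay B v i"
proof (induction n)
  case (Suc n)
  then have "lay B v (Suc (i + n)) = lay B v (Suc i)" by simp
  then show ?case using Suc.prems by simp
qed simp

lemma lay_nonadj: "u \<in> lay B v i \<Longrightarrow> u \<noteq> v \<Longrightarrow> \<exists>u'\<in>lay B v i. u \<noteq> u' \<and> {u, u'} \<notin> E"
  by (induction i) auto

text \<open>Vertices at distance at least two in the complement graph are adjacent in the graph. If
  the ball still grew at radius \<open>2 * N\<close>, new vertices from every second layer would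
  form a clique of \<open>N + 1\<close> vertices. Only here does the dimension bound the geometry;
  supports may be arbitrarily large.\<close>

lemma lay_stable:
  assumes N: "\<And>S. clique V E S \<Longrightarrow> finite S \<and> card S \<le> N" and v: "v \<in> B" and B: "B \<subseteq> V"
  shows "lay B v (Suc (2 * N)) = lay B v (2 * N)"
proof (rule ccontr)
  assume ne: "lay B v (Suc (2 * N)) \<noteq> lay B v (2 * N)"
  have grow: "lay B v (Suc j) \<noteq> lay B v j" if j: "j \<le> 2 * N" for j
  proof
    assume e: "lay B v (Suc j) = lay B v j"
    have "lay B v (j + (2 * N - j)) = lay B v j" "lay B v (j + (Suc (2 * N) - j)) = lay B v j"
      using lay_const[OF e] by blast+
    then show False using ne j by simp
  qed
  have "\<exists>y. y \<in> lay B v (2 * j) \<and> (j > 0 \<longrightarrow> y \<notin> lay B v (2 * j - 1))" if "j \<le> N" for j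
  proof (cases j)
    case 0
    then show ?thesis by simp
  next
    case (Suc i)
    then have s: "2 * j = Suc (2 * j - 1)" by simp
    have "lay B v (2 * j - 1) \<subseteq> lay B v (2 * j)" by (rule lay_mono) simp
    moreover have "lay B v (2 * j) \<noteq> lay B v (2 * j - 1)" using grow[of "2 * j - 1"] that s by simp
    ultimately show ?thesis by blast
  qed
  then obtain y where y: "\<And>j. j \<le> N \<Longrightarrow> y j \<in> lay B v (2 * j)"
    "\<And>j. j \<le> N \<Longrightarrow> j > 0 \<Longrightarrow> y j \<notin> lay B v (2 * j - 1)" by metis
  have yB: "y j \<in> B" if "j \<le> N" for j using y(1)[OF that] lay_subset[OF v] by blast
  have lt: "y i \<noteq> y j \<and> {y j, y i} \<in> E" if "i < j" "j \<le> N" for i j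
  proof -
    have s: "2 * i \<le> 2 * j - 1" "Suc (2 * i) \<le> 2 * j - 1" "j > 0" using that by auto
    have yi: "y i \<in> lay B v (2 * i)" using y(1) that by simp
    then have "y i \<in> lay B v (2 * j - 1)" using lay_mono[OF s(1)] by blast
    then have ne: "y i \<noteq> y j" using y(2)[OF that(2) s(3)] by metis
    have "y j \<notin> lay B v (Suc (2 * i))" using y(2)[OF that(2) s(3)] lay_mono[OF s(2)] by blast
    then have "{y j, y i} \<in> E" using yi ne yB[OF that(2)] by auto
    then show ?thesis using ne by blast
  qed
  have "inj_on y {0..N}"
  proof (rule inj_onI)
    fix i j assume "i \<in> {0..N}" "j \<in> {0..N}" "y i = y j"
    then show "i = j" using lt[of i j] lt[of j i] by (cases i j rule: linorder_cases) auto
  qed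
  then have card: "card (y ` {0..N}) = Suc N" by (simp add: card_image)
  have "clique V E (y ` {0..N})"
    unfolding clique_def
  proof (intro conjI ballI impI)
    show "y ` {0..N} \<subseteq> V" using yB B by auto
    fix a b assume ab: "a \<in> y ` {0..N}" "b \<in> y ` {0..N}" "a \<noteq> b"
    then obtain i j where ij: "a = y i" "b = y j" "i \<le> N" "j \<le> N" by auto
    then have "i \<noteq> j" using ab by blast
    then show "{a, b} \<in> E" using lt[of i j] lt[of j i] ij edge_sym by (cases i j rule: linorder_cases) auto
  qed
  then show False using N card by fastforce
qed

lemma concat_replicate_cls:
  assumes "xs \<in> W"
  shows "concat (replicate j xs) \<in> W" "cls (concat (replicate j xs)) = cls xs [^]\<^bsub>GP\<^esub> j"
    "cnt u (concat (replicate j xs)) = j * cnt u xs"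
proof -
  have c: "cls xs \<in> carrier GP" using assms by simp
  have "concat (replicate j xs) \<in> W \<and> cls (concat (replicate j xs)) = cls xs [^]\<^bsub>GP\<^esub> j \<and>
    cnt u (concat (replicate j xs)) = j * cnt u xs"
  proof (induction j)
    case 0
    then show ?case by (simp add: one_cls)
  next
    case (Suc j)
    have "cls (xs @ concat (replicate j xs)) = cls xs \<star> cls xs [^]\<^bsub>GP\<^esub> j" using Suc assms mult_cls by metis
    then show ?case using Suc assms c GP.nat_pow_Suc2[OF c] by simp
  qed
  then show "concat (replicate j xs) \<in> W" "cls (concat (replicate j xs)) = cls xs [^]\<^bsub>GP\<^esub> j"
    "cnt u (concat (replicate j xs)) = j * cnt u xs" by auto
qed

lemma Gs_int_pow: "a \<in> Gs Y \<Longrightarrow> a [^]\<^bsub>GP\<^esub> (n::int) \<in> Gs Y"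
proof -
  assume a: "a \<in> Gs Y"
  have "a [^]\<^bsub>GP\<^esub> nat n \<in> Gs Y" "iv (a [^]\<^bsub>GP\<^esub> nat (- n)) \<in> Gs Y" using Gs_pow[OF a] Gs_inv by blast+
  then show ?thesis unfolding int_pow_def2 by (cases "n < 0") (simp_all only: if_True if_False)
qed

lemma cnt_filter: "cnt u (filter (\<lambda>l. fst l \<in> S) xs) = (if u \<in> S then cnt u xs else 0)"
  by (induction xs) auto

lemma conj_fixed:
  assumes "z \<in> carrier GP" "g \<in> carrier GP" "z \<star> g = g \<star> z"
  shows "iv g \<star> z \<star> g = z"
  using assms by (simp add: GP.m_assoc)

lemma conj_fixed':
  assumes "z \<in> carrier GP" "g \<in> carrier GP" "z \<star> g = g \<star> z"
  shows "g \<star> z \<star> iv g = z"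
  using assms(1,2) by (simp add: assms(3)[symmetric] GP.m_assoc)

text \<open>Write \<open>c = d e\<close>, where \<open>d\<close> consists of the letters in the component of \<open>v\<close> in the complement of the
  support of \<open>c\<close>. In the reduced word \<open>d\<^sup>k\<close> the conjugate of \<open>z\<close> by the prefix before a \<open>u\<close>-letter lies in
  \<open>G\<^bsub>lk u\<^esub>\<close>: first for \<open>u = v\<close>, and then for every further layer of the component at the cost of one copy of
  \<open>d\<close> at each end. In the middle copy this makes \<open>z\<close> commute with all letters of \<open>d\<close>.\<close>

lemma long_fixer_fixes_orbit:
  assumes N: "\<And>S. clique V E S \<Longrightarrow> finite S \<and> card S \<le> N"
    and c: "cmin c" and n: "nu v c > 0" and st: "c \<notin> Gs (insert v (lk v))"
    and z: "z \<in> Gs (V - {v})" and k: "k = 4 * N + 1"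
    and zk: "iv (c [^]\<^bsub>GP\<^esub> k) \<star> z \<star> c [^]\<^bsub>GP\<^esub> k \<in> Gs (V - {v})"
  shows "iv (c [^]\<^bsub>GP\<^esub> (j::int)) \<star> z \<star> c [^]\<^bsub>GP\<^esub> j \<in> Gs (V - {v})"
proof -
  have cc: "c \<in> carrier GP" using c cmin_def by blast
  have zc: "z \<in> carrier GP" using Gs_carrier z .
  have vV: "v \<in> V" using nu_V cc n by blast
  obtain ws where ws: "red ws" "ws \<in> W" "c = cls ws" using cc by (rule red_cases)
  define B where "B = fst ` set ws"
  define S where "S = lay B v (2 * N)"
  have nu_c: "nu u c = cnt u ws" for u unfolding ws(3) by (rule red_nu[OF ws(1)])
  have BV: "B \<subseteq> V" unfolding B_def using ws(2) unfolding gp_words_def by auto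
  have vB: "v \<in> B" unfolding B_def using n nu_c cnt_pos[of v ws] by simp
  have SB: "S \<subseteq> B" unfolding S_def by (rule lay_subset[OF vB])
  have layS: "lay B v i \<subseteq> S" if "i \<le> 2 * N" for i unfolding S_def by (rule lay_mono[OF that])
  have vS: "v \<in> S" using layS[of 0] by simp
  \<comment> \<open>The ball has stopped growing, so the remaining vertices of the support are
    adjacent to all of it.\<close>
  have closed: "{u, s} \<in> E" if "u \<in> B" "u \<notin> S" "s \<in> S" for u s
  proof (rule ccontr)
    assume "{u, s} \<notin> E"
    then have "u \<in> lay B v (Suc (2 * N))" using that unfolding S_def by auto
    then show False using lay_stable[OF N vB BV] that(2) unfolding S_def by blast
  qed
  define D where "D = filter (\<lambda>l. fst l \<in> S) ws"
  define d where "d = cls D"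
  define e where "e = cls (filter (\<lambda>l. fst l \<notin> S) ws)"
  have Dw: "D \<in> W" "filter (\<lambda>l. fst l \<notin> S) ws \<in> W" using ws(2) unfolding D_def gp_words_def by auto
  have cde: "c = d \<star> e" unfolding ws(3) d_def e_def D_def
  proof (rule cls_filter_split[OF ws(2)])
    fix l l' assume "l \<in> set ws" "l' \<in> set ws" "fst l \<in> S" "fst l' \<notin> S"
    then show "{fst l, fst l'} \<in> E" using closed[of "fst l'" "fst l"] edge_sym unfolding B_def by blast
  qed
  have dS: "d \<in> Gs S" unfolding d_def by (rule Gs_cls[OF Dw(1)]) (auto simp: D_def)
  have eBS: "e \<in> Gs (B - S)" unfolding e_def by (rule Gs_cls[OF Dw(2)]) (auto simp: B_def)
  have "B - S \<subseteq> lk v" using closed vS edge_sym unfolding lk_def by blast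
  then have elk: "e \<in> Gs (lk v)" using eBS Gs_mono by blast
  have dec: "d \<in> carrier GP" "e \<in> carrier GP" using dS elk Gs_carrier by auto
  have de: "d \<star> e = e \<star> d" by (rule Gs_commute[OF dS eBS]) (use closed edge_sym in blast)
  have cp: "c [^]\<^bsub>GP\<^esub> i = d [^]\<^bsub>GP\<^esub> i \<star> e [^]\<^bsub>GP\<^esub> i" for i :: nat
    unfolding cde using GP.pow_mult_distrib[OF de] dec by blast
  have cpi: "c [^]\<^bsub>GP\<^esub> i = d [^]\<^bsub>GP\<^esub> i \<star> e [^]\<^bsub>GP\<^esub> i" for i :: int
    unfolding cde using GP.int_pow_mult_distrib[OF de] dec by blast
  \<comment> \<open>Each \<open>u\<close> in \<open>S\<close> other than \<open>v\<close> has a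
    non-neighbour in \<open>S\<close>, so \<open>c\<close> is in no star subgroup of such a
    \<open>u\<close> and \<open>cmin_pow_nu\<close> applies; \<open>e\<close> contributes no letters
    from \<open>S\<close>.\<close>
  have nuS: "nu u (d [^]\<^bsub>GP\<^esub> i) = i * cnt u D" for u and i :: nat
  proof (cases "u \<in> S")
    case False
    then have "cnt u D = 0" unfolding D_def cnt_filter by simp
    then show ?thesis using Gs_nu[OF Gs_pow[OF dS] False] by simp
  next
    case True
    have uB: "u \<in> B" using True SB by blast
    have pos: "nu u c > 0" using nu_c[of u] cnt_pos[of u ws] uB unfolding B_def by simp
    have "c \<notin> Gs (insert u (lk u))"
    proof (cases "u = v")
      case True
      then show ?thesis using st by simp
    next
      case False
      then obtain u' where u': "u' \<in> S" "u \<noteq> u'" "{u, u'} \<notin> E" using lay_nonadj True unfolding S_def by blast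
      have "u' \<in> fst ` set ws" using u'(1) SB unfolding B_def by blast
      moreover have "u' \<notin> insert u (lk u)" using u' unfolding lk_def by blast
      ultimately have "\<not> fst ` set ws \<subseteq> insert u (lk u)" by blast
      then show ?thesis using Gs_red[OF ws(1)] ws(3) by simp
    qed
    then have "nu u (c [^]\<^bsub>GP\<^esub> i) = i * nu u c" using cmin_pow_nu c pos by blast
    moreover have "nu u (e [^]\<^bsub>GP\<^esub> i) = 0" using Gs_nu[OF Gs_pow[OF eBS]] True by blast
    then have "nu u (c [^]\<^bsub>GP\<^esub> i) = nu u (d [^]\<^bsub>GP\<^esub> i)"
      unfolding cp using nu_mult_right dec by simp
    ultimately show ?thesis using nu_c[of u] True unfolding D_def cnt_filter by simp
  qed
  \<comment> \<open>Since the counts add up exactly, nothing cancels between the copies.\<close>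
  have redD: "red (concat (replicate i D))" for i
  proof (rule red_of_nu)
    show "concat (replicate i D) \<in> W" using concat_replicate_cls Dw by blast
    show "nu w (cls (concat (replicate i D))) = cnt w (concat (replicate i D))" for w
      using concat_replicate_cls(2,3)[OF Dw(1)] nuS unfolding d_def by simp
  qed
  let ?C = "\<lambda>q. iv q \<star> z \<star> q"
  have dk: "?C (d [^]\<^bsub>GP\<^esub> k) \<in> Gs (V - {v})"
  proof -
    have ek: "e [^]\<^bsub>GP\<^esub> k \<in> Gs (V - {v})" using Gs_pow[OF elk] Gs_mono[OF lk_V] by blast
    have "e [^]\<^bsub>GP\<^esub> k \<star> ?C (c [^]\<^bsub>GP\<^esub> k) \<star> iv (e [^]\<^bsub>GP\<^esub> k) \<in> Gs (V - {v})"
      using Gs_mult[OF Gs_mult[OF ek zk] Gs_inv[OF ek]] .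
    moreover have "e [^]\<^bsub>GP\<^esub> k \<star> ?C (c [^]\<^bsub>GP\<^esub> k) \<star> iv (e [^]\<^bsub>GP\<^esub> k) = ?C (d [^]\<^bsub>GP\<^esub> k)"
      unfolding cp using dec zc by (simp add: GP.inv_mult_group GP.m_assoc)
    ultimately show ?thesis by simp
  qed
  have Dmem: "\<exists>as x bs. D = as @ (u, x) # bs" if "u \<in> S" for u
  proof -
    have "u \<in> fst ` set D" using that SB unfolding D_def B_def by force
    from split_first[OF this] show ?thesis by blast
  qed
  \<comment> \<open>Here \<open>a\<close> and \<open>b\<close> are the numbers of copies of
    \<open>D\<close> before and after the copy containing the \<open>u\<close>-letter.\<close>
  have pos: "?C (d [^]\<^bsub>GP\<^esub> a \<star> cls as) \<in> Gs (lk u)"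
    if "u \<in> lay B v i" "D = as @ (u, x) # bs" "a + 1 + b = k" "i \<le> a" "i \<le> b" for i u a b as x bs
    using that
  proof (induction i arbitrary: u a b as x bs)
    case 0
    have u: "u = v" using 0 by simp
    have w: "as \<in> W" "concat (replicate a D) \<in> W" using Dw(1) concat_replicate_cls(1)[OF Dw(1)] 0 by auto
    have "replicate k D = replicate a D @ D # replicate b D"
      using 0(3) by (metis replicate_Suc replicate_add add.assoc plus_1_eq_Suc)
    then have e: "concat (replicate k D) = (concat (replicate a D) @ as) @ (v, x) # bs @ concat (replicate b D)"
      using 0(2) u by simp
    have ee: "cls (concat (replicate a D) @ as) = d [^]\<^bsub>GP\<^esub> a \<star> cls as"
      using mult_cls[OF w(2,1)] concat_replicate_cls(2)[OF Dw(1)] unfolding d_def by simp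
    have "?C (\<one>\<^bsub>GP\<^esub> \<star> cls (concat (replicate a D) @ as)) \<in> Gs (lk v)"
    proof (rule between_pos[OF vV _ _ zc, where q = "d [^]\<^bsub>GP\<^esub> k"])
      show "red ((concat (replicate a D) @ as) @ (v, x) # bs @ concat (replicate b D))" using redD[of k] unfolding e .
      show "d [^]\<^bsub>GP\<^esub> k = \<one>\<^bsub>GP\<^esub> \<star> cls ((concat (replicate a D) @ as) @ (v, x) # bs @ concat (replicate b D))"
        unfolding e[symmetric] concat_replicate_cls(2)[OF Dw(1)] using dec by (simp add: d_def)
    qed (use z zc dk in auto)
    then show ?case using ee u dec w by simp
  next
    case (Suc i)
    show ?case
    proof (cases "u \<in> lay B v i")
      case True
      show ?thesis by (rule Suc.IH[OF True Suc.prems(2,3)]) (use Suc.prems in auto)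
    next
      case False
      then obtain u' where u': "u \<in> B" "u' \<in> lay B v i" "u \<noteq> u'" "{u, u'} \<notin> E" using Suc.prems(1) by auto
      have "i \<le> 2 * N" using Suc.prems(3-5) k by simp
      then have "u' \<in> S" using layS u' by blast
      then obtain as' y bs' where D': "D = as' @ (u', y) # bs'" using Dmem by blast
      obtain a' b' where ab: "a = Suc a'" "b = Suc b'" using Suc.prems(4,5) by (cases a; cases b) auto
      \<comment> \<open>The \<open>u'\<close>-letters of the preceding and the following copy
        enclose the \<open>u\<close>-letter. As \<open>u\<close> is not in \<open>lk u'\<close>,
        both conjugates avoid \<open>u\<close>, and \<open>between_pos\<close> applies to the piece
        in between.\<close>
      have i1: "?C (d [^]\<^bsub>GP\<^esub> a' \<star> cls as') \<in> Gs (lk u')"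
        by (rule Suc.IH[OF u'(2) D', of a' "Suc (Suc b')"]) (use Suc.prems ab in auto)
      have i2: "?C (d [^]\<^bsub>GP\<^esub> Suc (Suc a') \<star> cls as') \<in> Gs (lk u')"
        by (rule Suc.IH[OF u'(2) D', of "Suc (Suc a')" b']) (use Suc.prems ab in auto)
      have "lk u' \<subseteq> V - {u}" using lk_V[of u'] u'(4) unfolding lk_def by (auto simp: insert_commute)
      then have mono: "Gs (lk u') \<subseteq> Gs (V - {u})" by (rule Gs_mono)
      have w: "as \<in> W" "as' \<in> W" "(u', y) # bs' \<in> W" "(u, x) # bs \<in> W"
        using Dw(1) D' Suc.prems(2) by (metis words_append)+
      have wc: "cls as \<in> carrier GP" "cls as' \<in> carrier GP" "cls ((u', y) # bs') \<in> carrier GP" "cls ((u, x) # bs) \<in> carrier GP"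
        using w cls_carrier by blast+
      let ?xs = "((u', y) # bs') @ as" and ?ys = "bs @ as'" and ?p = "d [^]\<^bsub>GP\<^esub> a' \<star> cls as'"
      have dd: "d = cls as' \<star> cls ((u', y) # bs')" "d = cls as \<star> cls ((u, x) # bs)"
        unfolding d_def using mult_cls w D' Suc.prems(2) by metis+
      have e1: "?p \<star> cls ?xs = d [^]\<^bsub>GP\<^esub> a \<star> cls as"
      proof -
        have "?p \<star> cls ?xs = d [^]\<^bsub>GP\<^esub> a' \<star> (cls as' \<star> cls ((u', y) # bs')) \<star> cls as"
          unfolding mult_cls[OF w(3,1), symmetric] using wc dec by (simp add: GP.m_assoc)
        then show ?thesis unfolding dd(1)[symmetric] ab by simp
      qed
      have "?C (?p \<star> cls ?xs) \<in> Gs (lk u)"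
      proof (rule between_pos[where q = "d [^]\<^bsub>GP\<^esub> Suc (Suc a') \<star> cls as'"])
        show "u \<in> V" using u'(1) BV by blast
        have "red (as' @ (?xs @ (u, x) # ?ys) @ (u', y) # bs')"
        proof -
          have "concat (replicate 3 D) = D @ D @ D" by (simp add: numeral_3_eq_3)
          also have "\<dots> = (as' @ (u', y) # bs') @ (as @ (u, x) # bs) @ (as' @ (u', y) # bs')"
            using D' Suc.prems(2) by metis
          finally show ?thesis using redD[of 3] by simp
        qed
        then show "red (?xs @ (u, x) # ?ys)" using red_appendD by blast
        show "?p \<in> carrier GP" using dec wc by simp
        show "?C ?p \<in> Gs (V - {u})" "?C (d [^]\<^bsub>GP\<^esub> Suc (Suc a') \<star> cls as') \<in> Gs (V - {u})" using i1 i2 mono by auto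
        have "cls (?xs @ (u, x) # ?ys) = cls ((u', y) # bs') \<star> cls as \<star> (cls ((u, x) # bs) \<star> cls as')"
          using mult_cls[of ?xs "(u, x) # ?ys"] mult_cls[OF w(3,1)] mult_cls[OF w(4,2)] w by simp
        then have "?p \<star> cls (?xs @ (u, x) # ?ys) =
          d [^]\<^bsub>GP\<^esub> a' \<star> (cls as' \<star> cls ((u', y) # bs')) \<star> (cls as \<star> cls ((u, x) # bs)) \<star> cls as'"
          using wc dec by (simp add: GP.m_assoc)
        then show "d [^]\<^bsub>GP\<^esub> Suc (Suc a') \<star> cls as' = ?p \<star> cls (?xs @ (u, x) # ?ys)"
          unfolding dd[symmetric] by simp
      qed (use zc in auto)
      then show ?thesis unfolding e1 .
    qed
  qed
  \<comment> \<open>All layers reach the middle copy when \<open>2 * N\<close> copies stand on each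
    side, whence \<open>k = 4 * N + 1\<close>.\<close>
  let ?q = "d [^]\<^bsub>GP\<^esub> (2 * N)"
  have qc: "?q \<in> carrier GP" using dec by simp
  have mid: "?C (?q \<star> cls as) \<in> Gs (lk u)" if "D = as @ (u, x) # bs" for u as x bs
  proof (rule pos[of u "2 * N" as x bs "2 * N" "2 * N"])
    show "u \<in> lay B v (2 * N)"
    proof -
      have "(u, x) \<in> set D" using that by simp
      then show ?thesis unfolding D_def S_def by auto
    qed
  qed (use that k in auto)
  \<comment> \<open>Each letter of the middle copy commutes with the conjugate obtained so far, so
    conjugating by it changes nothing.\<close>
  have const: "?C (?q \<star> cls as) = ?C ?q" if "D = as @ bs" for as bs
    using that
  proof (induction as arbitrary: bs rule: rev_induct)
    case Nil
    then show ?case using qc by (simp add: one_cls[symmetric])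
  next
    case (snoc l as)
    obtain u x where l: "l = (u, x)" by (cases l)
    have D: "D = as @ (u, x) # bs" using snoc.prems l by simp
    have w: "as \<in> W" "[(u, x)] \<in> W" using Dw(1) unfolding D by auto
    have wc: "cls as \<in> carrier GP" "cls [(u, x)] \<in> carrier GP" using w by simp_all
    have g: "?C (?q \<star> cls as) \<in> Gs (lk u)" using mid[OF D] .
    have g2: "cls [(u, x)] \<in> Gs {u}" by (rule Gs_cls[OF w(2)]) simp
    have cm: "?C (?q \<star> cls as) \<star> cls [(u, x)] = cls [(u, x)] \<star> ?C (?q \<star> cls as)"
      by (rule Gs_commute[OF g g2]) (auto simp: lk_def insert_commute)
    have "?C (?q \<star> cls (as @ [l])) = iv (cls [(u, x)]) \<star> ?C (?q \<star> cls as) \<star> cls [(u, x)]"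
      using mult_cls[OF w] l conj_conj[OF zc, of "?q \<star> cls as" "cls [(u, x)]"] wc qc by (simp add: GP.m_assoc)
    also have "\<dots> = ?C (?q \<star> cls as)" by (rule conj_fixed[OF _ _ cm]) (use Gs_carrier[OF g] wc in auto)
    finally show ?case using snoc.IH[OF D] by simp
  qed
  have zP: "?C ?q \<in> Gs (lk u)" if uS: "u \<in> S" for u
  proof -
    obtain as x bs where D: "D = as @ (u, x) # bs" using Dmem[OF uS] by blast
    show ?thesis using mid[OF D] unfolding const[OF D] .
  qed
  define Y where "Y = {y. \<forall>u\<in>S. {u, y} \<in> E}"
  have CY: "?C ?q \<in> Gs Y"
    using zP Gs_carrier[OF zP[OF vS]] unfolding Y_def Gs_def lk_def by blast
  have comm: "a \<star> b = b \<star> a" if "a \<in> Gs Y" "b \<in> Gs S" for a b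
    by (rule Gs_commute[OF that]) (auto simp: Y_def insert_commute)
  \<comment> \<open>The conjugate commutes with all of \<open>d\<close>, so undoing the conjugation
    by a power of \<open>d\<close> leaves it as it is.\<close>
  have "z = ?q \<star> ?C ?q \<star> iv ?q" using zc qc by (simp add: GP.m_assoc)
  also have "\<dots> = ?C ?q" by (rule conj_fixed'[OF _ qc comm[OF CY Gs_pow[OF dS]]]) (use qc zc in simp)
  finally have zY: "z \<in> Gs Y" using CY by simp
  have "iv (c [^]\<^bsub>GP\<^esub> j) \<star> z \<star> c [^]\<^bsub>GP\<^esub> j = iv (e [^]\<^bsub>GP\<^esub> j) \<star> ?C (d [^]\<^bsub>GP\<^esub> j) \<star> e [^]\<^bsub>GP\<^esub> j"
    unfolding cpi using dec zc by (simp add: GP.inv_mult_group GP.m_assoc)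
  also have "?C (d [^]\<^bsub>GP\<^esub> j) = z"
    by (rule conj_fixed[OF zc _ comm[OF zY Gs_int_pow[OF dS]]]) (use dec in simp)
  finally have f: "iv (c [^]\<^bsub>GP\<^esub> j) \<star> z \<star> c [^]\<^bsub>GP\<^esub> j = iv (e [^]\<^bsub>GP\<^esub> j) \<star> z \<star> e [^]\<^bsub>GP\<^esub> j" .
  have ej: "e [^]\<^bsub>GP\<^esub> j \<in> Gs (V - {v})" using Gs_int_pow[OF elk] Gs_mono[OF lk_V] by blast
  show ?thesis unfolding f using Gs_mult[OF Gs_mult[OF Gs_inv[OF ej] z] ej] .
qed

section \<open>Elliptic elements\<close>

text \<open>A copy of \<open>elliptic\<close> outside the locale of a fixed vertex, so that it can
  be quantified over all vertices.\<close>

definition ell :: "'v \<Rightarrow> ('v \<times> 'g) list set \<Rightarrow> bool" where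
  "ell u g \<longleftrightarrow> (\<exists>x\<in>bs_verts u. bs_act g x = x)"

section \<open>Retractions to the vertex groups\<close>

lemma retr_word_simps [simp]:
  "gp_retr_word G u [] = \<one>\<^bsub>G u\<^esub>"
  "gp_retr_word G u (l # xs) = (if fst l = u then snd l \<otimes>\<^bsub>G u\<^esub> gp_retr_word G u xs else gp_retr_word G u xs)"
  by (simp_all add: gp_retr_word_def)

lemma retr_word_closed: "u \<in> V \<Longrightarrow> xs \<in> W \<Longrightarrow> gp_retr_word G u xs \<in> carrier (G u)"
proof (induction xs)
  case (Cons l xs)
  interpret group "G u" using groups Cons.prems(1) .
  show ?case using Cons by (cases l) auto
qed (simp add: groups group.is_monoid monoid.one_closed)

lemma retr_word_append:
  "u \<in> V \<Longrightarrow> xs \<in> W \<Longrightarrow> ys \<in> W \<Longrightarrow>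
    gp_retr_word G u (xs @ ys) = gp_retr_word G u xs \<otimes>\<^bsub>G u\<^esub> gp_retr_word G u ys"
proof (induction xs)
  case Nil
  interpret group "G u" using groups Nil.prems(1) .
  show ?case using retr_word_closed Nil by simp
next
  case (Cons l xs)
  interpret group "G u" using groups Cons.prems(1) .
  show ?case using Cons retr_word_closed[of u] by (cases l) (auto simp: m_assoc)
qed

lemma retr_word_step:
  assumes u: "u \<in> V" and "gp_step V E G xs ys"
  shows "gp_retr_word G u xs = gp_retr_word G u ys"
proof -
  interpret group "G u" using groups u .
  show ?thesis using assms(2)
  proof cases
    case (del xs' ys' w)
    then have "[(w, \<one>\<^bsub>G w\<^esub>)] \<in> W" using groups group.is_monoid monoid.one_closed by fastforce
    then show ?thesis using del u by (auto simp: retr_word_append retr_word_closed simp del: append_Cons)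
  next
    case (merge xs' ys' w g h)
    then have "g \<otimes>\<^bsub>G w\<^esub> h \<in> carrier (G w)" using groups group.is_monoid monoid.m_closed by fastforce
    then show ?thesis using merge u by (auto simp: retr_word_append retr_word_closed m_assoc)
  next
    case (swap xs' ys' w w' g h)
    then show ?thesis using u by (auto simp: retr_word_append retr_word_closed)
  qed
qed

lemma retr_word_eqv: "u \<in> V \<Longrightarrow> eqv xs ys \<Longrightarrow> gp_retr_word G u xs = gp_retr_word G u ys"
  by (erule eqv_induct) (auto simp: retr_word_step)

lemma retr_cls: assumes "u \<in> V" "xs \<in> W" shows "gp_retr G u (cls xs) = gp_retr_word G u xs"
proof -
  have "(SOME ys. ys \<in> cls xs) \<in> cls xs" using cls_self[OF assms(2)] by (rule someI)
  then have "eqv xs (SOME ys. ys \<in> cls xs)" using mem_cls by blast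
  then show ?thesis unfolding gp_retr_def using retr_word_eqv assms by metis
qed

lemma retr_hom: "u \<in> V \<Longrightarrow> gp_retr G u \<in> hom GP (G u)"
proof (rule homI)
  assume u: "u \<in> V"
  show "gp_retr G u a \<in> carrier (G u)" if "a \<in> carrier GP" for a
    using that by (rule carrier_cases) (simp add: retr_cls retr_word_closed u)
  show "gp_retr G u (a \<star> b) = gp_retr G u a \<otimes>\<^bsub>G u\<^esub> gp_retr G u b" if a: "a \<in> carrier GP" and b: "b \<in> carrier GP" for a b
  proof -
    obtain xs ys where "xs \<in> W" "a = cls xs" "ys \<in> W" "b = cls ys" using carrier_cases a b by metis
    then show ?thesis using u by (simp add: mult_cls retr_cls retr_word_append)
  qed
qed

lemma retr_Gs: assumes u: "u \<in> V" and a: "a \<in> Gs Y" "u \<notin> Y" shows "gp_retr G u a = \<one>\<^bsub>G u\<^esub>"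
proof -
  obtain xs where xs: "red xs" "xs \<in> W" "a = cls xs" using red_cases[OF Gs_carrier[OF a(1)]] by blast
  have "fst ` set xs \<subseteq> Y" using Gs_red[OF xs(1)] a(1) xs(3) by simp
  then have "u \<notin> fst ` set xs" using a(2) by blast
  then have "gp_retr_word G u xs = \<one>\<^bsub>G u\<^esub>" by (induction xs) auto
  then show ?thesis using retr_cls u xs by simp
qed

lemma retr_conj:
  assumes u: "u \<in> V" and a: "a \<in> carrier GP" and p: "p \<in> carrier GP" and e: "gp_retr G u (iv p \<star> a \<star> p) = \<one>\<^bsub>G u\<^esub>"
  shows "gp_retr G u a = \<one>\<^bsub>G u\<^esub>"
proof -
  interpret Gu: group "G u" using groups u .
  interpret h: group_hom GP "G u" "gp_retr G u" by unfold_locales (rule retr_hom[OF u])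
  have "a = p \<star> (iv p \<star> a \<star> p) \<star> iv p" using a p by (simp add: GP.m_assoc)
  then have "gp_retr G u a = gp_retr G u (p \<star> (iv p \<star> a \<star> p) \<star> iv p)" by simp
  also have "\<dots> = gp_retr G u p \<otimes>\<^bsub>G u\<^esub> gp_retr G u (iv p \<star> a \<star> p) \<otimes>\<^bsub>G u\<^esub> gp_retr G u (iv p)"
    using a p h.hom_mult[of "p \<star> (iv p \<star> a \<star> p)" "iv p"] h.hom_mult[of p "iv p \<star> a \<star> p"] by simp
  also have "\<dots> = \<one>\<^bsub>G u\<^esub>" unfolding e using p by simp
  finally show ?thesis .
qed

text \<open>The elements that act on the tree of \<open>u\<close> with a star vertex as their only fixed point.\<close>

definition pinned :: "'v \<Rightarrow> ('v \<times> 'g) list set \<Rightarrow> bool" where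
  "pinned u g \<longleftrightarrow> u \<in> V \<and> gp_retr G u g \<noteq> \<one>\<^bsub>G u\<^esub> \<and> (\<exists>p\<in>carrier GP. iv p \<star> g \<star> p \<in> Gs (insert u (lk u)))"

end

context graph_prod_vertex
begin

lemma elliptic_ell: "T.elliptic = ell v"
  unfolding T.elliptic_def ell_def by simp

lemma cmin_elliptic:
  assumes c: "cmin c" and n: "nu v c > 0" and e: "ell v c"
  shows "c \<in> Gs (insert v (lk v))"
proof (rule ccontr)
  assume "c \<notin> Gs (insert v (lk v))"
  then obtain A where "T.is_axis c A (int (2 * nu v c))" using cmin_axis[OF c n] by blast
  then show False using T.axis_not_elliptic e c unfolding elliptic_ell cmin_def by blast
qed

text \<open>After conjugation the translating element has minimal length, and by
  \<open>on_axis\<close> the given axis contains the base vertex, hence its translates by all powers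
  of \<open>c\<close>. \<open>long_fixer_fixes_orbit\<close> needs \<open>4 * N + 1\<close> periods
  starting at a translate; one more is spent on reaching the first translate in the segment.\<close>

lemma rigid_axes_bs:
  assumes N: "\<And>S. clique V E S \<Longrightarrow> finite S \<and> card S \<le> N"
  shows "T.rigid_axes (4 * N + 2)"
  unfolding T.rigid_axes_def
proof (intro allI impI)
  fix t A \<tau> z a i
  assume t: "t \<in> carrier GP" and z: "z \<in> carrier GP" and A: "T.is_axis t A \<tau>"
    and f: "\<forall>i. a \<le> i \<and> i \<le> a + int (4 * N + 2) * \<tau> \<longrightarrow> bs_act z (A i) = A i"
  define k where "k = 4 * N + 1"
  have tau: "\<tau> > 0" using T.is_axisD(2)[OF A] .
  obtain p where p: "p \<in> carrier GP" "cmin (iv p \<star> t \<star> p)" using cmin_exists[OF t] by blast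
  define c where "c = iv p \<star> t \<star> p"
  define B where "B i = bs_act (iv p) (A i)" for i
  have cc: "c \<in> carrier GP" unfolding c_def using p t by simp
  have Bx: "T.is_axis c B \<tau>" unfolding c_def B_def using T.axis_conj[OF p(1) t A] .
  have Av: "A i \<in> bs_verts v" for i using T.line_verts T.is_axisD(1)[OF A] by blast
  have ne: "\<not> T.elliptic c" using T.axis_not_elliptic[OF cc Bx] .
  have n: "nu v c > 0"
  proof (rule ccontr)
    assume "\<not> nu v c > 0"
    then have "c \<in> Gs (V - {v})" unfolding Gs_def using cc nu_V[OF cc] by auto
    then have "bs_act c (vA v \<one>\<^bsub>GP\<^esub>) = vA v \<one>\<^bsub>GP\<^esub>" using fix_A[OF cc, of "\<one>\<^bsub>GP\<^esub>"] cc by simp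
    then show False using ne unfolding T.elliptic_def by auto
  qed
  have st: "c \<notin> Gs (insert v (lk v))"
  proof
    assume "c \<in> Gs (insert v (lk v))"
    then have "bs_act c (vS v \<one>\<^bsub>GP\<^esub>) = vS v \<one>\<^bsub>GP\<^esub>" using fix_S[OF cc, of "\<one>\<^bsub>GP\<^esub>"] cc by simp
    then show False using ne unfolding T.elliptic_def by auto
  qed
  have cm: "cmin c" unfolding c_def by (rule p(2))
  let ?o = "vA v \<one>\<^bsub>GP\<^esub>"
  obtain A' where A': "T.is_axis c A' (int (2 * nu v c))" "A' 0 = ?o" using cmin_axis[OF cm n st] by blast
  have ov: "?o \<in> bs_verts v" by simp
  have o1: "bs_act c ?o = A' (int (2 * nu v c))" "bs_act c (bs_act c ?o) = A' (2 * int (2 * nu v c))"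
    using T.is_axisD(3)[OF A'(1)] A'(2) by (metis add_0, metis add_0 mult_2)
  have "int (td (A' 0) (A' (int (2 * nu v c)))) = int (2 * nu v c)" "int (td (A' 0) (A' (2 * int (2 * nu v c)))) = 2 * int (2 * nu v c)"
    using T.line_d[OF T.is_axisD(1)[OF A'(1)], of 0 "int (2 * nu v c)"]
      T.line_d[OF T.is_axisD(1)[OF A'(1)], of 0 "2 * int (2 * nu v c)"] by simp_all
  then have "int (td ?o (bs_act c (bs_act c ?o))) = int (2 * td ?o (bs_act c ?o))"
    unfolding o1(2) unfolding o1(1) A'(2) by simp
  then have "td ?o (bs_act c (bs_act c ?o)) = 2 * td ?o (bs_act c ?o)" using of_nat_eq_iff by blast
  then obtain i0 where i0: "?o = B i0" using T.on_axis[OF cc Bx ov] by blast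
  have Bc: "B (i0 + j * \<tau>) = vA v (c [^]\<^bsub>GP\<^esub> j)" for j :: int
    using T.axis_int_pow[OF cc Bx, of j i0] bs_act_v(1)[of "c [^]\<^bsub>GP\<^esub> j" "\<one>\<^bsub>GP\<^esub>" v] cc i0 by simp
  define z1 where "z1 = iv p \<star> z \<star> p"
  have z1c: "z1 \<in> carrier GP" unfolding z1_def using p z by simp
  have z1B: "bs_act z1 (B i) = B i \<longleftrightarrow> bs_act z (A i) = A i" for i
    unfolding z1_def B_def using p z Av T.act_inj[of "iv p"] by (simp add: T.act_mult)
  \<comment> \<open>The first translate of the base vertex at or after index \<open>a\<close> is
    number \<open>j\<close>.\<close>
  define j where "j = - ((i0 - a) div \<tau>)"
  have jr: "a \<le> i0 + j * \<tau>" "i0 + j * \<tau> \<le> a + \<tau>"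
  proof -
    have "i0 - a = (i0 - a) div \<tau> * \<tau> + (i0 - a) mod \<tau>" by simp
    moreover have "0 \<le> (i0 - a) mod \<tau>" "(i0 - a) mod \<tau> < \<tau>" using tau by auto
    moreover have "i0 + j * \<tau> = i0 - (i0 - a) div \<tau> * \<tau>" unfolding j_def by simp
    ultimately show "a \<le> i0 + j * \<tau>" "i0 + j * \<tau> \<le> a + \<tau>" by linarith+
  qed
  define z0 where "z0 = iv (c [^]\<^bsub>GP\<^esub> j) \<star> z1 \<star> c [^]\<^bsub>GP\<^esub> j"
  have z0c: "z0 \<in> carrier GP" unfolding z0_def using z1c cc by simp
  have key: "bs_act z1 (B (i0 + (j + l) * \<tau>)) = B (i0 + (j + l) * \<tau>) \<longleftrightarrow>
    iv (c [^]\<^bsub>GP\<^esub> l) \<star> z0 \<star> c [^]\<^bsub>GP\<^esub> l \<in> Gs (V - {v})" for l :: int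
  proof -
    have "c [^]\<^bsub>GP\<^esub> (j + l) = c [^]\<^bsub>GP\<^esub> j \<star> c [^]\<^bsub>GP\<^esub> l" using GP.int_pow_mult cc by simp
    then show ?thesis unfolding Bc z0_def using fix_A[OF z1c, of "c [^]\<^bsub>GP\<^esub> (j + l)"] conj_conj[OF z1c] cc by simp
  qed
  have fB: "bs_act z1 (B (i0 + (j + l) * \<tau>)) = B (i0 + (j + l) * \<tau>)" if "0 \<le> l" "l \<le> int k" for l
  proof -
    have "0 \<le> l * \<tau>" "l * \<tau> \<le> int k * \<tau>" using that tau by auto
    moreover have "int (4 * N + 2) * \<tau> = int k * \<tau> + \<tau>" unfolding k_def by (simp add: algebra_simps)
    moreover have "i0 + (j + l) * \<tau> = i0 + j * \<tau> + l * \<tau>" by (simp add: algebra_simps)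
    ultimately have "a \<le> i0 + (j + l) * \<tau>" "i0 + (j + l) * \<tau> \<le> a + int (4 * N + 2) * \<tau>" using jr by linarith+
    then show ?thesis using z1B f by blast
  qed
  have z0: "z0 \<in> Gs (V - {v})" using key[of 0] fB[of 0] z0c by simp
  have zk: "iv (c [^]\<^bsub>GP\<^esub> k) \<star> z0 \<star> c [^]\<^bsub>GP\<^esub> k \<in> Gs (V - {v})"
    using key[of "int k"] fB[of "int k"] by (simp add: int_pow_int)
  have all: "bs_act z1 (B (i0 + (j + l) * \<tau>)) = B (i0 + (j + l) * \<tau>)" for l
    unfolding key by (rule long_fixer_fixes_orbit[OF N cm n st z0 k_def zk])
  define l where "l = (i - i0) div \<tau> - j"
  have l1: "i0 + (j + l) * \<tau> \<le> i" "i \<le> i0 + (j + (l + 1)) * \<tau>"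
  proof -
    define x where "x = (i - i0) div \<tau> * \<tau>"
    have x: "i - i0 = x + (i - i0) mod \<tau>" "0 \<le> (i - i0) mod \<tau>" "(i - i0) mod \<tau> < \<tau>"
      unfolding x_def using tau by auto
    have e: "i0 + (j + l) * \<tau> = i0 + x" "i0 + (j + (l + 1)) * \<tau> = i0 + x + \<tau>"
      unfolding l_def x_def by (simp_all add: algebra_simps)
    show "i0 + (j + l) * \<tau> \<le> i" "i \<le> i0 + (j + (l + 1)) * \<tau>" unfolding e using x by linarith+
  qed
  have "bs_act z1 (B i) = B i"
    using T.fix_line_between[OF z1c T.is_axisD(1)[OF Bx] all[of l] all[of "l + 1"] l1] .
  then show "bs_act z (A i) = A i" using z1B by blast
qed

text \<open>A second fixed vertex would make the neighbour in its direction fixed as well. That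
  neighbour is a coset of the other kind, so a conjugate of \<open>a\<close> would lack the vertex
  \<open>v\<close> and retract trivially.\<close>

lemma pinned_unique:
  assumes a: "a \<in> carrier GP" and r: "gp_retr G v a \<noteq> \<one>\<^bsub>G v\<^esub>" and h: "h \<in> carrier GP"
    and f: "bs_act a (vS v h) = vS v h" and x: "x \<in> bs_verts v" "bs_act a x = x"
  shows "x = vS v h"
proof (rule ccontr)
  assume ne: "x \<noteq> vS v h"
  have sv: "vS v h \<in> bs_verts v" using h by simp
  obtain y where y: "bs_adj v (vS v h) y" "td x (vS v h) = Suc (td x y)" using T.closer[OF x(1) sv ne] by blast
  have yv: "y \<in> bs_verts v" using T.adj_verts[OF y(1)] by blast
  have "td y (vS v h) = 1" using T.d_adj_one[OF T.adj_sym[OF y(1)]] .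
  then have "T.btw x y (vS v h)" unfolding T.btw_def using x sv yv y(2) by simp
  then have fy: "bs_act a y = y" using T.fix_between[OF a _ x(2) f] by blast
  have "fst y" using T.adj_col[OF y(1)] by simp
  then obtain g where g: "g \<in> carrier GP" "y = vA v g" using bs_verts_col yv by blast
  then have "iv g \<star> a \<star> g \<in> Gs (V - {v})" using fix_A[OF a g(1)] fy by simp
  then have "gp_retr G v (iv g \<star> a \<star> g) = \<one>\<^bsub>G v\<^esub>" using retr_Gs[OF v] by simp
  then show False using retr_conj[OF v a g(1)] r by blast
qed

lemma pinned_vertex:
  assumes a: "a \<in> carrier GP" and p: "pinned v a"
  shows "\<exists>h\<in>carrier GP. bs_act a (vS v h) = vS v h \<and> (\<forall>x\<in>bs_verts v. bs_act a x = x \<longrightarrow> x = vS v h)"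
proof -
  obtain h where h: "h \<in> carrier GP" "iv h \<star> a \<star> h \<in> Gs (insert v (lk v))" and r: "gp_retr G v a \<noteq> \<one>\<^bsub>G v\<^esub>"
    using p unfolding pinned_def by blast
  have f: "bs_act a (vS v h) = vS v h" using fix_S[OF a h(1)] h(2) by blast
  then show ?thesis using pinned_unique[OF a r h(1) f] h(1) by blast
qed

lemma pinned_shared:
  assumes "a \<in> carrier GP" "b \<in> carrier GP" "h \<in> carrier GP" "bs_act a (vS v h) = vS v h"
    "\<forall>x\<in>bs_verts v. bs_act a x = x \<longrightarrow> x = vS v h" "ell v b" "ell v (a \<star> b)"
  shows "bs_act b (vS v h) = vS v h"
  using T.fix_of_product[of a b "vS v h"] assms unfolding elliptic_ell by simp

end

context graph_prod
begin

text \<open>Any letter \<open>u\<close> of a conjugate \<open>c\<close> of minimal length will do: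
  ellipticity on the tree of \<open>u\<close> forces \<open>c\<close> into the star subgroup, and
  its nontrivial part at \<open>u\<close> is its value under the retraction.\<close>

lemma elliptic_pinned:
  assumes g: "g \<in> carrier GP" and ne: "g \<noteq> \<one>\<^bsub>GP\<^esub>" and e: "\<And>u. u \<in> V \<Longrightarrow> ell u g"
  shows "\<exists>u. pinned u g"
proof -
  obtain p where p: "p \<in> carrier GP" "cmin (iv p \<star> g \<star> p)" using cmin_exists[OF g] by blast
  define c where "c = iv p \<star> g \<star> p"
  have cc: "c \<in> carrier GP" unfolding c_def using p g by simp
  have "c \<noteq> \<one>\<^bsub>GP\<^esub>"
  proof
    assume "c = \<one>\<^bsub>GP\<^esub>"
    then have "p \<star> c \<star> iv p = \<one>\<^bsub>GP\<^esub>" using p by simp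
    moreover have "p \<star> c \<star> iv p = g" unfolding c_def using p g by (simp add: GP.m_assoc)
    ultimately show False using ne by simp
  qed
  obtain ws where ws: "red ws" "ws \<in> W" "c = cls ws" using cc by (rule red_cases)
  have "ws \<noteq> []" using \<open>c \<noteq> \<one>\<^bsub>GP\<^esub>\<close> ws one_cls by metis
  then obtain u x ys where wl: "ws = (u, x) # ys" by (metis list.exhaust surj_pair)
  have u: "u \<in> V" using ws(2) wl by simp
  have n: "nu u c > 0" using red_nu[OF ws(1), of u] ws(3) wl by simp
  interpret u: graph_prod_vertex V E G u using u by unfold_locales
  interpret Gu: group "G u" using groups u .
  have "ell u c" unfolding c_def using u.T.elliptic_conj[OF p(1) g] e[OF u] unfolding u.elliptic_ell by blast
  then have st: "c \<in> Gs (insert u (lk u))" using u.cmin_elliptic p(2) n unfolding c_def by blast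
  obtain k l where k: "k \<in> carrier (G u)" and l: "l \<in> Gs (lk u)" and kl: "c = emb u k \<star> l"
    using star_decomp[OF st u] by blast
  have lc: "l \<in> carrier GP" using Gs_carrier l .
  have lu: "u \<notin> lk u" using lk_V by blast
  have "k \<noteq> \<one>\<^bsub>G u\<^esub>"
  proof
    assume "k = \<one>\<^bsub>G u\<^esub>"
    then have "c = l" using kl emb_one u lc by simp
    then show False using n Gs_nu[OF l lu] by simp
  qed
  moreover have "gp_retr G u c = k"
  proof -
    interpret h: group_hom GP "G u" "gp_retr G u" by unfold_locales (rule retr_hom[OF u])
    have "gp_retr G u (emb u k) = k" unfolding emb_def using retr_cls[OF u, of "[(u, k)]"] u k by simp
    then show ?thesis using kl h.hom_mult[of "emb u k" l] retr_Gs[OF u l lu] u k lc by simp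
  qed
  ultimately have "gp_retr G u c \<noteq> \<one>\<^bsub>G u\<^esub>" by simp
  then have "gp_retr G u g \<noteq> \<one>\<^bsub>G u\<^esub>"
  proof (rule contrapos_nn)
    interpret h: group_hom GP "G u" "gp_retr G u" by unfold_locales (rule retr_hom[OF u])
    assume "gp_retr G u g = \<one>\<^bsub>G u\<^esub>"
    then show "gp_retr G u c = \<one>\<^bsub>G u\<^esub>" unfolding c_def using p g by simp
  qed
  then show ?thesis unfolding pinned_def using u p st c_def by blast
qed

text \<open>Being pinned at \<open>w\<close> is visible in the retraction to \<open>G w\<close>,
  which kills all conjugates of subgroups on vertex sets avoiding \<open>w\<close>.\<close>

lemma pinned_star:
  assumes b: "b \<in> carrier GP" and p: "p \<in> carrier GP" and s: "iv p \<star> b \<star> p \<in> Gs (insert u (lk u))"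
    and w: "pinned w b"
  shows "w \<in> insert u (lk u)"
proof (rule ccontr)
  assume n: "w \<notin> insert u (lk u)"
  have wV: "w \<in> V" using w pinned_def by blast
  have "gp_retr G w (iv p \<star> b \<star> p) = \<one>\<^bsub>G w\<^esub>" using retr_Gs[OF wV s n] .
  then show False using retr_conj[OF wV b p] w unfolding pinned_def by blast
qed

lemma Gs_gp_sub:
  assumes a: "a \<in> Gs Y"
  shows "a \<in> gp_sub V E G Y"
proof -
  obtain xs where xs: "red xs" "xs \<in> W" "a = cls xs" using red_cases[OF Gs_carrier[OF a]] by blast
  have "fst ` set xs \<subseteq> Y" using Gs_red[OF xs(1)] a xs(3) by simp
  then have "cls xs \<in> gp_sub V E G Y" using xs(2)
  proof (induction xs)
    case Nil
    then show ?case unfolding gp_sub_def using generate.one[of GP] one_cls by simp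
  next
    case (Cons l xs)
    obtain u x where l: "l = (u, x)" by (cases l)
    have w: "[(u, x)] \<in> W" "xs \<in> W" "u \<in> Y" "x \<in> carrier (G u)" using Cons.prems l by auto
    have "cls [(u, x)] = gp_emb V E G u x" unfolding gp_emb_def cls_def ..
    then have "cls [(u, x)] \<in> gp_sub V E G Y" unfolding gp_sub_def using w by (auto intro: generate.incl)
    then have "cls [(u, x)] \<star> cls xs \<in> gp_sub V E G Y"
      using Cons w unfolding gp_sub_def by (auto intro: generate.eng)
    then show ?case using mult_cls[OF w(1,2)] l by simp
  qed
  then show ?thesis using xs by simp
qed

text \<open>Translation length at least \<tau> on the tree of \<open>u\<close>, spelled out without
  the tree locale because \<open>u\<close> varies.\<close>

definition hyp :: "'v \<Rightarrow> ('v \<times> 'g) list set \<Rightarrow> int \<Rightarrow> bool" where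
  "hyp u g \<tau> \<longleftrightarrow> (\<exists>A \<sigma>. ((\<forall>i. bs_adj u (A i) (A (i + 1)) \<and> A i \<noteq> A (i + 2)) \<and> \<sigma> > 0 \<and>
     (\<forall>i. bs_act g (A i) = A (i + \<sigma>))) \<and> \<sigma> \<ge> \<tau>)"

lemma hyp_mono: "hyp u g \<tau> \<Longrightarrow> \<sigma> \<le> \<tau> \<Longrightarrow> hyp u g \<sigma>"
  unfolding hyp_def using order_trans by blast

lemma nu_le_glen: "a \<in> carrier GP \<Longrightarrow> nu u a \<le> glen a"
  by (erule red_cases) (simp add: red_nu red_glen cnt_def)

end

context graph_prod_vertex
begin

lemma hyp_iff: "hyp v g \<tau> \<longleftrightarrow> (\<exists>A \<sigma>. T.is_axis g A \<sigma> \<and> \<sigma> \<ge> \<tau>)"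
  unfolding hyp_def T.is_axis_def T.line_def ..

lemma td_base: "g \<in> carrier GP \<Longrightarrow> td (vA v \<one>\<^bsub>GP\<^esub>) (bs_act g (vA v \<one>\<^bsub>GP\<^esub>)) \<le> 2 * glen g"
  using td_A[of "\<one>\<^bsub>GP\<^esub>" g] bs_act_v(1)[of g "\<one>\<^bsub>GP\<^esub>" v] nu_inv[of g v] nu_le_glen[of g v] by simp

end

context graph_prod
begin

text \<open>An element moves the base vertex of any tree by at most twice its word length, so one
  bound serves all trees.\<close>

lemma hyp_bound:
  assumes "u \<in> V" "g \<in> carrier GP" "hyp u g \<tau>"
  shows "\<tau> \<le> int (2 * glen g)"
proof -
  interpret u: graph_prod_vertex V E G u using assms(1) by unfold_locales
  obtain A \<sigma> where A: "u.T.is_axis g A \<sigma>" "\<sigma> \<ge> \<tau>" using assms(3) u.hyp_iff by blast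
  have "\<sigma> \<le> int (u.td (vA u \<one>\<^bsub>GP\<^esub>) (bs_act g (vA u \<one>\<^bsub>GP\<^esub>)))"
    using u.T.axis_period_le[OF assms(2) A(1)] by simp
  then show ?thesis using A(2) u.td_base[OF assms(2)] by linarith
qed

lemma hyp_of_not_ell:
  assumes "u \<in> V" "g \<in> carrier GP" "\<not> ell u g"
  shows "hyp u g 1"
proof -
  interpret u: graph_prod_vertex V E G u using assms(1) by unfold_locales
  obtain A \<sigma> where A: "u.T.is_axis g A \<sigma>"
    using u.T.elliptic_or_axis[OF assms(2), of "vA u \<one>\<^bsub>GP\<^esub>"] assms(3) u.elliptic_ell by auto
  then show ?thesis using u.hyp_iff u.T.is_axisD(2)[OF A] by (metis int_one_le_iff_zero_less)
qed

text \<open>The condition on \<open>Q\<close> is free of \<open>u\<close>: word lengths replace the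
  displacement in the individual tree.\<close>

lemma hyp_jword_right:
  assumes N: "\<And>S. clique V E S \<Longrightarrow> finite S \<and> card S \<le> N"
    and u: "u \<in> V" and b: "b \<in> carrier GP" and t: "t \<in> carrier GP" and h: "hyp u t \<tau>"
    and Q: "Q \<ge> 4 * (2 * glen (b [^]\<^bsub>GP\<^esub> P) + 2 * glen (b [^]\<^bsub>GP\<^esub> (2 * P))) + 2 * (4 * N + 2) + 5"
  shows "hyp u (jword GP P Q b t) (2 * \<tau>)"
proof -
  interpret u: graph_prod_vertex V E G u using u by unfold_locales
  obtain A \<sigma> where A: "u.T.is_axis t A \<sigma>" "\<sigma> \<ge> \<tau>" using h u.hyp_iff by blast
  have l: "u.td (vA u \<one>\<^bsub>GP\<^esub>) (bs_act (b [^]\<^bsub>GP\<^esub> P) (vA u \<one>\<^bsub>GP\<^esub>)) \<le> 2 * glen (b [^]\<^bsub>GP\<^esub> P) + 2 * glen (b [^]\<^bsub>GP\<^esub> (2 * P))"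
    "u.td (vA u \<one>\<^bsub>GP\<^esub>) (bs_act (b [^]\<^bsub>GP\<^esub> (2 * P)) (vA u \<one>\<^bsub>GP\<^esub>)) \<le> 2 * glen (b [^]\<^bsub>GP\<^esub> P) + 2 * glen (b [^]\<^bsub>GP\<^esub> (2 * P))"
    using u.td_base[of "b [^]\<^bsub>GP\<^esub> P"] u.td_base[of "b [^]\<^bsub>GP\<^esub> (2 * P)"] b by (auto intro: le_trans)
  have o: "vA u \<one>\<^bsub>GP\<^esub> \<in> bs_verts u" by simp
  obtain B \<sigma>' where B: "u.T.is_axis (jword GP P Q b t) B \<sigma>'" "\<sigma>' \<ge> 2 * \<sigma>"
    using u.T.jword_axis_right[OF u.rigid_axes_bs[OF N] b t A(1) o l Q] by blast
  then have "\<sigma>' \<ge> 2 * \<tau>" using A(2) by linarith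
  then show ?thesis using u.hyp_iff B(1) by blast
qed

lemma hyp_jword_left:
  assumes N: "\<And>S. clique V E S \<Longrightarrow> finite S \<and> card S \<le> N"
    and u: "u \<in> V" and b: "b \<in> carrier GP" and t: "t \<in> carrier GP" and h: "\<not> ell u b"
    and P: "P \<ge> 2 * (4 * N + 2) + 4"
    and Q: "Q \<ge> 4 * (2 * glen (b [^]\<^bsub>GP\<^esub> P) + 2 * glen (b [^]\<^bsub>GP\<^esub> (2 * P))) + 2 * (4 * N + 2) + 5"
  shows "hyp u (jword GP P Q b t) 1"
proof (cases "ell u t")
  case False
  then have "hyp u (jword GP P Q b t) (2 * 1)" using hyp_jword_right[OF N u b t _ Q] hyp_of_not_ell u t by blast
  then show ?thesis by (rule hyp_mono) simp
next
  case True
  interpret u: graph_prod_vertex V E G u using u by unfold_locales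
  obtain A \<sigma> where "u.T.is_axis b A \<sigma>" using hyp_of_not_ell[OF u b h] u.hyp_iff by blast
  moreover have "u.T.elliptic t" using True u.elliptic_ell by simp
  ultimately obtain B \<sigma>' where B: "u.T.is_axis (jword GP P Q b t) B \<sigma>'"
    using u.T.jword_axis_left[OF u.rigid_axes_bs[OF N] b t _ _ P] by blast
  then show ?thesis using u.hyp_iff u.T.is_axisD(2)[OF B] by (metis int_one_le_iff_zero_less)
qed

end

section \<open>Homomorphisms from locally compact groups\<close>

text \<open>Finitely many of the equations are solved by starting with \<open>e\<close> far out and
  applying the maps backwards; the sets \<open>U n\<close> keep these partial solutions in
  \<open>K\<close>. The equations are closed conditions in a compact product.\<close>

lemma inverse_sequence:
  assumes K: "compactin M K" and H: "Hausdorff_space M" and F: "\<And>n. continuous_map M M (F n)"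
    and U: "\<And>n. U n \<subseteq> K" "\<And>n. e \<in> U n" "\<And>n y. y \<in> U (Suc n) \<Longrightarrow> F n y \<in> U n"
  shows "\<exists>y. \<forall>n::nat. y n \<in> K \<and> y n = F n (y (Suc n))"
proof -
  define Z where "Z = product_topology (\<lambda>n::nat. subtopology M K) UNIV"
  have KX: "K \<subseteq> topspace M" using compactin_subset_topspace K by blast
  have "compact_space (subtopology M K)" using K compact_space_subtopology by blast
  then have Zc: "compact_space Z" unfolding Z_def by (simp add: compact_space_product_topology)
  have tZ: "topspace Z = {y. \<forall>n. y n \<in> K}" unfolding Z_def using KX by auto
  have proj: "continuous_map Z M (\<lambda>y. y n)" for n
    using continuous_map_product_projection[of n UNIV "\<lambda>n. subtopology M K"] unfolding Z_def
    by (simp add: continuous_map_in_subtopology)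
  define C where "C j = (\<Inter>n\<in>{..<j}. {y \<in> topspace Z. y n = F n (y (Suc n))}) \<inter> topspace Z" for j
  have cl: "closedin Z {y \<in> topspace Z. y n = F n (y (Suc n))}" for n
    by (rule closedin_continuous_maps_eq[OF H proj]) (use continuous_map_compose[OF proj[of "Suc n"] F[of n]] in \<open>simp add: o_def\<close>)
  have closed: "closedin Z (C j)" for j
  proof (cases j)
    case 0
    then show ?thesis unfolding C_def by simp
  next
    case (Suc i)
    then have "closedin Z (\<Inter>n\<in>{..<j}. {y \<in> topspace Z. y n = F n (y (Suc n))})" using cl by (intro closedin_INT) auto
    then show ?thesis unfolding C_def by (intro closedin_Int) auto
  qed
  have ne: "C j \<noteq> {}" for j
  proof -
    \<comment> \<open>\<open>cmp k i\<close> is the entry at index \<open>i\<close> of the solution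
      that starts with \<open>e\<close> at index \<open>i + k\<close>.\<close>
    define cmp where "cmp = rec_nat (\<lambda>i. e) (\<lambda>k c i. F i (c (Suc i)))"
    have cmp: "cmp 0 i = e" "cmp (Suc k) i = F i (cmp k (Suc i))" for i k unfolding cmp_def by auto
    have cU: "cmp k i \<in> U i" for k i by (induction k arbitrary: i) (auto simp: cmp U)
    define w where "w n = cmp (j - n) n" for n
    have "w n = F n (w (Suc n))" if "n < j" for n
      using cmp(2)[of "j - Suc n" n] that unfolding w_def by (simp add: Suc_diff_Suc)
    moreover have "w \<in> topspace Z" unfolding tZ using cU U(1) unfolding w_def by blast
    ultimately have "w \<in> C j" unfolding C_def by blast
    then show ?thesis by blast
  qed
  have "(\<Inter>j. C j) \<noteq> {}"
  proof (rule compact_space_imp_nest[OF Zc closed ne])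
    show "decseq C" unfolding C_def decseq_def by force
  qed
  then obtain y where y: "\<And>j. y \<in> C j" by blast
  have "y n \<in> K \<and> y n = F n (y (Suc n))" for n
  proof
    have "y \<in> topspace Z" using y[of 0] unfolding C_def by blast
    then show "y n \<in> K" unfolding tZ by blast
    show "y n = F n (y (Suc n))" using y[of "Suc n"] unfolding C_def by blast
  qed
  then show ?thesis by blast
qed

section \<open>Continuity in topological groups\<close>

locale top_group =
  fixes L :: "'a monoid" (structure) and T :: "'a topology"
  assumes tg: "topological_group L T"
begin

sublocale group L using tg unfolding topological_group_def by (rule conjunct1)

lemma topsp [simp]: "topspace T = carrier L"
  using tg unfolding topological_group_def by simp

lemma cont_mult:
  assumes "continuous_map M T f" "continuous_map M T g"
  shows "continuous_map M T (\<lambda>x. f x \<otimes> g x)"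
proof -
  have "continuous_map (prod_topology T T) T (\<lambda>(x, y). x \<otimes> y)" using tg unfolding topological_group_def by simp
  from continuous_map_compose[OF continuous_map_pairedI[OF assms] this]
  show ?thesis by (simp add: o_def)
qed

lemma cont_const: "a \<in> carrier L \<Longrightarrow> continuous_map M T (\<lambda>x. a)"
  by simp

lemma cont_pow: "continuous_map M T f \<Longrightarrow> continuous_map M T (\<lambda>x. f x [^] (n::nat))"
proof (induction n)
  case 0
  then show ?case by (simp add: nat_pow_def)
next
  case (Suc n)
  then show ?case using cont_mult[of M "\<lambda>x. f x [^] n" f] by simp
qed

lemma cont_jword: "x \<in> carrier L \<Longrightarrow> continuous_map T T (\<lambda>y. jword L P Q x y)"
  unfolding jword_def by (intro cont_mult cont_pow cont_const) auto

lemma open_vimage: "continuous_map T T f \<Longrightarrow> openin T U \<Longrightarrow> openin T {x \<in> carrier L. f x \<in> U}"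
  using openin_continuous_map_preimage[of T T f U] by simp

lemma continuous_of_kernel:
  assumes H: "group H" and h: "\<phi> \<in> hom L H" and U: "openin T U" "\<one> \<in> U" and k: "\<And>x. x \<in> U \<Longrightarrow> \<phi> x = \<one>\<^bsub>H\<^esub>"
  shows "continuous_map T (discrete_topology (carrier H)) \<phi>"
proof -
  interpret h: group_hom L H \<phi> using H h by (simp add: group_hom_def group_hom_axioms_def is_group)
  have "openin T {x \<in> topspace T. \<phi> x \<in> C}" for C
  proof (subst openin_subopen, intro ballI)
    fix x assume x: "x \<in> {x \<in> topspace T. \<phi> x \<in> C}"
    then have xc: "x \<in> carrier L" by simp
    let ?S = "{y \<in> carrier L. inv x \<otimes> y \<in> U}"
    have "openin T ?S" using xc U(1) by (intro open_vimage cont_mult cont_const) auto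
    moreover have "x \<in> ?S" using xc U(2) by simp
    moreover have "?S \<subseteq> {x \<in> topspace T. \<phi> x \<in> C}"
    proof
      fix y assume y: "y \<in> ?S"
      then have yc: "y \<in> carrier L" by blast
      have "y = x \<otimes> (inv x \<otimes> y)" using xc yc by (simp add: m_assoc[symmetric])
      then have "\<phi> y = \<phi> x \<otimes>\<^bsub>H\<^esub> \<phi> (inv x \<otimes> y)" using h.hom_mult[of x "inv x \<otimes> y"] xc yc by simp
      then have "\<phi> y = \<phi> x" using k[of "inv x \<otimes> y"] y xc by simp
      then show "y \<in> {x \<in> topspace T. \<phi> x \<in> C}" using x yc by simp
    qed
    ultimately show "\<exists>S. openin T S \<and> x \<in> S \<and> S \<subseteq> {x \<in> topspace T. \<phi> x \<in> C}" by blast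
  qed
  then show ?thesis unfolding continuous_map_def by auto
qed

end

lemma jword_hom:
  assumes "group_hom L H \<phi>" "x \<in> carrier L" "y \<in> carrier L"
  shows "\<phi> (jword L P Q x y) = jword H P Q (\<phi> x) (\<phi> y)" "jword L P Q x y \<in> carrier L"
proof -
  interpret group_hom L H \<phi> by (fact assms(1))
  show "\<phi> (jword L P Q x y) = jword H P Q (\<phi> x) (\<phi> y)" "jword L P Q x y \<in> carrier L"
    unfolding jword_def using assms(2,3) by (simp_all add: hom_nat_pow)
qed

text \<open>This value decides how small the first argument must be; it involves \<open>P\<close>
  but not \<open>Q\<close>.\<close>

lemma jword_one:
  assumes "group L" "x \<in> carrier L"
  shows "jword L P Q x \<one>\<^bsub>L\<^esub> = x [^]\<^bsub>L\<^esub> (6 * P)"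
proof -
  interpret group L by (fact assms(1))
  have "jword L P Q x \<one>\<^bsub>L\<^esub> = x [^]\<^bsub>L\<^esub> P \<otimes>\<^bsub>L\<^esub> x [^]\<^bsub>L\<^esub> P \<otimes>\<^bsub>L\<^esub> (x [^]\<^bsub>L\<^esub> (2 * P) \<otimes>\<^bsub>L\<^esub> x [^]\<^bsub>L\<^esub> (2 * P))"
    unfolding jword_def using assms(2) by simp
  also have "\<dots> = x [^]\<^bsub>L\<^esub> (P + P + (2 * P + 2 * P))" using assms(2) by (simp add: nat_pow_mult)
  also have "P + P + (2 * P + 2 * P) = 6 * P" by simp
  finally show ?thesis .
qed

section \<open>Elements close to the identity\<close>

locale graph_prod_map = graph_prod V E G + top_group L T
  for V :: "'v set" and E :: "'v set set" and G :: "'v \<Rightarrow> 'g monoid"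
    and L :: "'a monoid" (structure) and T :: "'a topology" +
  fixes \<phi> :: "'a \<Rightarrow> ('v \<times> 'g) list set" and N :: nat
  assumes hom: "\<phi> \<in> hom L (graph_product V E G)"
    and N: "\<And>S. clique V E S \<Longrightarrow> finite S \<and> card S \<le> N"
    and Haus: "Hausdorff_space T" and lcomp: "locally_compact_space T"
begin

sublocale \<phi>: group_hom L GP \<phi>
  by (simp add: group_hom_def group_hom_axioms_def is_group group_GP hom)

lemma uniform_elliptic: "\<exists>U. openin T U \<and> \<one> \<in> U \<and> (\<forall>x\<in>U. \<forall>v\<in>V. ell v (\<phi> x))"
proof (rule ccontr)
  assume "\<not> ?thesis"
  then have contra: "\<exists>x\<in>U. \<exists>v\<in>V. \<not> ell v (\<phi> x)" if "openin T U" "\<one> \<in> U" for U using that by blast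
  define P where "P = 2 * (4 * N + 2) + 4"
  \<comment> \<open>Depends on \<open>x\<close>, through the displacements that both powers of
    \<open>x\<close> can cause; \<open>P\<close> had to be fixed before.\<close>
  define Q where "Q x = 4 * (2 * glen (\<phi> x [^]\<^bsub>GP\<^esub> P) + 2 * glen (\<phi> x [^]\<^bsub>GP\<^esub> (2 * P))) + 2 * (4 * N + 2) + 5" for x
  define F where "F x y = jword L P (Q x) x y" for x y
  have "\<one> \<in> topspace T" by simp
  then obtain U0 K where K: "openin T U0" "compactin T K" "\<one> \<in> U0" "U0 \<subseteq> K"
    using lcomp unfolding locally_compact_space_def by blast
  \<comment> \<open>The condition on \<open>x [^] (6 * P)\<close> says that \<open>F x\<close> maps
    the identity into \<open>U\<close>, so some smaller neighbourhood is mapped into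
    \<open>U\<close> too.\<close>
  define good where "good s \<longleftrightarrow> (case s of (U, x, v) \<Rightarrow> openin T U \<and> \<one> \<in> U \<and> U \<subseteq> K \<and> x \<in> carrier L \<and>
    v \<in> V \<and> x [^] (6 * P) \<in> U \<and> \<not> ell v (\<phi> x))" for s
  have pick: "\<exists>x v. good (U, x, v)" if U: "openin T U" "\<one> \<in> U" "U \<subseteq> K" for U
  proof -
    let ?U = "{x \<in> carrier L. x [^] (6 * P) \<in> U}"
    have "openin T ?U" by (rule open_vimage[OF cont_pow U(1)]) simp
    moreover have "\<one> \<in> ?U" using U(2) by simp
    ultimately obtain x v where "x \<in> ?U" "v \<in> V" "\<not> ell v (\<phi> x)" using contra by blast
    then show ?thesis unfolding good_def using U by auto
  qed
  have "\<exists>s. \<forall>n::nat. good (s n) \<and> (\<forall>y\<in>fst (s (Suc n)). F (fst (snd (s n))) y \<in> fst (s n))"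
  proof (rule dependent_nat_choice[where P = "\<lambda>n. good" and Q = "\<lambda>n s s'. \<forall>y\<in>fst s'. F (fst (snd s)) y \<in> fst s"])
    show "\<exists>s. good s" using pick[OF K(1,3,4)] by blast
    fix s :: "'a set \<times> 'a \<times> 'v" and n :: nat
    assume g: "good s"
    obtain U x v where s: "s = (U, x, v)" by (cases s)
    have gs: "openin T U" "\<one> \<in> U" "U \<subseteq> K" "x \<in> carrier L" "x [^] (6 * P) \<in> U" using g unfolding good_def s by auto
    let ?U = "U \<inter> {y \<in> carrier L. F x y \<in> U}"
    have "openin T ?U" unfolding F_def using gs by (intro openin_Int open_vimage cont_jword)
    moreover have "\<one> \<in> ?U" using gs jword_one[OF is_group gs(4)] unfolding F_def by simp
    ultimately obtain x' v' where "good (?U, x', v')" using pick gs(3) by blast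
    then show "\<exists>s'. good s' \<and> (\<forall>y\<in>fst s'. F (fst (snd s)) y \<in> fst s)"
      unfolding s by (intro exI[of _ "(?U, x', v')"]) auto
  qed
  then obtain s where s: "\<And>n::nat. good (s n)" "\<And>n y. y \<in> fst (s (Suc n)) \<Longrightarrow> F (fst (snd (s n))) y \<in> fst (s n)"
    by blast
  define x where "x n = fst (snd (s n))" for n
  define v where "v n = snd (snd (s n))" for n
  have sn: "\<one> \<in> fst (s n)" "fst (s n) \<subseteq> K" "x n \<in> carrier L" "v n \<in> V" "\<not> ell (v n) (\<phi> (x n))" for n
    using s(1)[of n] unfolding good_def x_def v_def by (auto split: prod.splits)
  have "\<exists>y. \<forall>n. y n \<in> K \<and> y n = F (x n) (y (Suc n))"
  proof (rule inverse_sequence[OF K(2) Haus, where U = "\<lambda>n. fst (s n)" and e = \<one>])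
    show "continuous_map T T (F (x n))" for n unfolding F_def using cont_jword[OF sn(3)] .
    show "F (x n) y \<in> fst (s n)" if "y \<in> fst (s (Suc n))" for n y using s(2)[OF that] unfolding x_def .
  qed (use sn in auto)
  then obtain y where y: "\<And>n. y n \<in> K" "\<And>n. y n = F (x n) (y (Suc n))" by blast
  have yc: "y n \<in> carrier L" for n using y(1) compactin_subset_topspace[OF K(2)] by auto
  have xc: "\<phi> (x n) \<in> carrier GP" "\<phi> (y n) \<in> carrier GP" for n using sn(3) yc by auto
  have step: "\<phi> (y n) = jword GP P (Q (x n)) (\<phi> (x n)) (\<phi> (y (Suc n)))" for n
    using jword_hom(1)[OF \<phi>.group_hom_axioms sn(3)[of n] yc[of "Suc n"], of P "Q (x n)"] y(2)[of n] unfolding F_def by simp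
  \<comment> \<open>On the tree of \<open>v n\<close> hyperbolicity comes from \<open>x n\<close>,
    whatever \<open>y (Suc n)\<close> does there.\<close>
  have base: "hyp (v n) (\<phi> (y n)) 1" for n
    unfolding step[of n]
    by (rule hyp_jword_left[OF N sn(4) xc sn(5)]) (auto simp: P_def Q_def)
  have double: "hyp u (\<phi> (y n)) (2 * \<tau>)" if "u \<in> V" "hyp u (\<phi> (y (Suc n))) \<tau>" for u n \<tau>
    unfolding step[of n]
    by (rule hyp_jword_right[OF N that(1) xc that(2)]) (simp_all add: Q_def)
  \<comment> \<open>Each of the \<open>n\<close> words between index \<open>n\<close> and index
    \<open>0\<close> doubles the translation length.\<close>
  have "hyp u (\<phi> (y 0)) (2 ^ n)" if "u \<in> V" "hyp u (\<phi> (y n)) 1" for u n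
  proof -
    have "hyp u (\<phi> (y (n - k))) (2 ^ k)" if "k \<le> n" for k
      using that
    proof (induction k)
      case 0
      then show ?case using \<open>hyp u (\<phi> (y n)) 1\<close> by simp
    next
      case (Suc k)
      then have e: "Suc (n - Suc k) = n - k" by simp
      have "hyp u (\<phi> (y (Suc (n - Suc k)))) (2 ^ k)" unfolding e using Suc by simp
      then show ?case using double[OF \<open>u \<in> V\<close>] by simp
    qed
    from this[of n] show ?thesis by simp
  qed
  then have "hyp (v n) (\<phi> (y 0)) (2 ^ n)" for n using base sn(4) by blast
  then have "2 ^ n \<le> int (2 * glen (\<phi> (y 0)))" for n using hyp_bound[OF sn(4) xc(2)] by blast
  moreover have "int n < 2 ^ n" for n using of_nat_less_two_power by blast
  ultimately show False by (metis not_less)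
qed

definition active :: "'v \<Rightarrow> bool" where
  "active u \<longleftrightarrow> u \<in> V \<and> (\<forall>U. openin T U \<longrightarrow> \<one> \<in> U \<longrightarrow> (\<exists>x\<in>U. pinned u (\<phi> x)))"

text \<open>Products of two small elements are included because \<open>pinned_shared\<close> asks
  for ellipticity of \<open>a \<star> b\<close>.\<close>

lemma small_nbhd:
  "\<exists>W. openin T W \<and> \<one> \<in> W \<and> W \<subseteq> carrier L \<and>
    (\<forall>x\<in>W. \<forall>v\<in>V. ell v (\<phi> x)) \<and> (\<forall>x\<in>W. \<forall>y\<in>W. \<forall>v\<in>V. ell v (\<phi> (x \<otimes> y)))"
proof -
  obtain U where U: "openin T U" "\<one> \<in> U" "\<forall>x\<in>U. \<forall>v\<in>V. ell v (\<phi> x)" using uniform_elliptic by blast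
  define M where "M = {z \<in> topspace (prod_topology T T). (\<lambda>(x, y). x \<otimes> y) z \<in> U}"
  have "continuous_map (prod_topology T T) T (\<lambda>(x, y). x \<otimes> y)" using tg unfolding topological_group_def by simp
  then have "openin (prod_topology T T) M" unfolding M_def using U(1) by (rule openin_continuous_map_preimage)
  moreover have "(\<one>, \<one>) \<in> M" unfolding M_def using U(2) by simp
  ultimately have "\<exists>A B. openin T A \<and> openin T B \<and> \<one> \<in> A \<and> \<one> \<in> B \<and> A \<times> B \<subseteq> M"
    unfolding openin_prod_topology_alt by simp
  then obtain A B where AB: "openin T A" "openin T B" "\<one> \<in> A" "\<one> \<in> B" "A \<times> B \<subseteq> M" by blast
  have "openin T (A \<inter> B \<inter> U)" using AB U by (intro openin_Int)
  moreover have "A \<inter> B \<inter> U \<subseteq> carrier L" using openin_subset[OF U(1)] by auto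
  moreover have "x \<otimes> y \<in> U" if "x \<in> A \<inter> B \<inter> U" "y \<in> A \<inter> B \<inter> U" for x y
  proof -
    have "(x, y) \<in> M" using AB(5) that by blast
    then show ?thesis unfolding M_def by simp
  qed
  ultimately show ?thesis using AB U by (intro exI[of _ "A \<inter> B \<inter> U"]) blast
qed

text \<open>Without active vertices, a clique of vertices pinned by elements of \<open>W\<close> can
  always be enlarged. Some element of \<open>W\<close> pinned at none of them has a nontrivial
  image, which is pinned at a new vertex \<open>u\<close>. The image also fixes the coset belonging
  to each earlier \<open>u'\<close>, so it lies in a conjugate of the star subgroup of
  \<open>u'\<close>, and \<open>u\<close> is adjacent to \<open>u'\<close>.\<close>

lemma exists_active:
  assumes nc: "\<not> continuous_map T (discrete_topology (carrier GP)) \<phi>"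
  shows "\<exists>u. active u"
proof (rule ccontr)
  assume "\<not> ?thesis"
  then have "\<forall>u. \<exists>U. u \<in> V \<longrightarrow> openin T U \<and> \<one> \<in> U \<and> (\<forall>x\<in>U. \<not> pinned u (\<phi> x))"
    unfolding active_def by blast
  then obtain U where U: "\<And>u. u \<in> V \<Longrightarrow> openin T (U u) \<and> \<one> \<in> U u \<and> (\<forall>x\<in>U u. \<not> pinned u (\<phi> x))" by metis
  obtain W where W: "openin T W" "\<one> \<in> W" "W \<subseteq> carrier L" "\<And>x v. x \<in> W \<Longrightarrow> v \<in> V \<Longrightarrow> ell v (\<phi> x)"
    "\<And>x y v. x \<in> W \<Longrightarrow> y \<in> W \<Longrightarrow> v \<in> V \<Longrightarrow> ell v (\<phi> (x \<otimes> y))" using small_nbhd by blast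
  have "\<exists>C. clique V E C \<and> finite C \<and> card C = n \<and> (\<forall>u\<in>C. \<exists>x\<in>W. pinned u (\<phi> x))" for n
  proof (induction n)
    case 0
    then show ?case by (intro exI[of _ "{}"]) (simp add: clique_def)
  next
    case (Suc n)
    then obtain C where C: "clique V E C" "finite C" "card C = n" "\<And>u. u \<in> C \<Longrightarrow> \<exists>x\<in>W. pinned u (\<phi> x)" by blast
    have CV: "C \<subseteq> V" using C(1) unfolding clique_def by blast
    define S where "S = W \<inter> (\<Inter>u\<in>C. {x \<in> carrier L. x \<in> U u})"
    have So: "openin T S"
    proof (cases "C = {}")
      case True
      then show ?thesis unfolding S_def using W by simp
    next
      case False
      have "openin T {x \<in> carrier L. x \<in> U u}" if "u \<in> C" for u
        using open_vimage[of "\<lambda>x. x" "U u"] U CV that by auto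
      then show ?thesis unfolding S_def using W False C(2) by (intro openin_Int openin_INT2) auto
    qed
    have S1: "\<one> \<in> S" unfolding S_def using W U CV by auto
    obtain x where x: "x \<in> S" "\<phi> x \<noteq> \<one>\<^bsub>GP\<^esub>" using continuous_of_kernel[OF group_GP hom So S1] nc by blast
    have xW: "x \<in> W" "x \<in> carrier L" using x W unfolding S_def by auto
    have xc: "\<phi> x \<in> carrier GP" using xW by simp
    obtain u where u: "pinned u (\<phi> x)" using elliptic_pinned[OF xc x(2)] W(4)[OF xW(1)] by blast
    have uC: "u \<notin> C"
    proof
      assume uC: "u \<in> C"
      then have "x \<in> U u" using x(1) unfolding S_def by blast
      then show False using U uC CV u by blast
    qed
    have adj: "{u', u} \<in> E" if u': "u' \<in> C" for u'
    proof -
      obtain x' where x': "x' \<in> W" "pinned u' (\<phi> x')" using C(4)[OF u'] by blast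
      have x'c: "x' \<in> carrier L" "\<phi> x' \<in> carrier GP" using x' W by auto
      have u'V: "u' \<in> V" using u' CV by blast
      interpret u': graph_prod_vertex V E G u' using u'V by unfold_locales
      obtain h where h: "h \<in> carrier GP" "bs_act (\<phi> x') (vS u' h) = vS u' h"
        "\<forall>y\<in>bs_verts u'. bs_act (\<phi> x') y = y \<longrightarrow> y = vS u' h" using u'.pinned_vertex[OF x'c(2) x'(2)] by blast
      have "ell u' (\<phi> x' \<star> \<phi> x)" using W(5)[OF x'(1) xW(1) u'V] x'c xW by simp
      then have "bs_act (\<phi> x) (vS u' h) = vS u' h"
        using u'.pinned_shared[OF x'c(2) xc h] W(4)[OF xW(1) u'V] by blast
      then have "iv h \<star> \<phi> x \<star> h \<in> Gs (insert u' (lk u'))" using u'.fix_S xc h(1) by blast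
      then have "u \<in> insert u' (lk u')" using pinned_star[OF xc h(1) _ u] by blast
      then show ?thesis using uC u' unfolding lk_def by blast
    qed
    have "u \<in> V" using u unfolding pinned_def by blast
    then have "clique V E (insert u C)" using C(1) adj edge_sym unfolding clique_def by blast
    moreover have "\<forall>w\<in>insert u C. \<exists>x\<in>W. pinned w (\<phi> x)" using C(4) u xW by blast
    ultimately show ?case using C uC by (intro exI[of _ "insert u C"]) auto
  qed
  from this[of "Suc N"] obtain C where "clique V E C" "card C = Suc N" by blast
  then show False using N by fastforce
qed

text \<open>Fixing the coset on \<open>W\<close> is not enough, as \<open>W\<close> need not
  generate \<open>L\<close>. For any \<open>l\<close>, activity gives a pinned \<open>y\<close> in
  \<open>W\<close> with \<open>inv l \<otimes> y \<otimes> l\<close> in \<open>W\<close> as well.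
  Both images fix the coset, so that of \<open>y\<close> fixes also its translate by
  \<open>\<phi> l\<close>, which by uniqueness is the coset itself.\<close>

lemma active_conj:
  assumes a: "active u"
  shows "\<exists>g\<in>carrier GP. \<forall>l\<in>carrier L. iv g \<star> \<phi> l \<star> g \<in> Gs (insert u (lk u))"
proof -
  have uV: "u \<in> V" using a unfolding active_def by blast
  interpret u: graph_prod_vertex V E G u using uV by unfold_locales
  obtain W where W: "openin T W" "\<one> \<in> W" "W \<subseteq> carrier L" "\<And>x v. x \<in> W \<Longrightarrow> v \<in> V \<Longrightarrow> ell v (\<phi> x)"
    "\<And>x y v. x \<in> W \<Longrightarrow> y \<in> W \<Longrightarrow> v \<in> V \<Longrightarrow> ell v (\<phi> (x \<otimes> y))" using small_nbhd by blast
  obtain x where x: "x \<in> W" "pinned u (\<phi> x)" using a W(1,2) unfolding active_def by blast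
  have xc: "x \<in> carrier L" "\<phi> x \<in> carrier GP" using x W by auto
  obtain h where h: "h \<in> carrier GP" "bs_act (\<phi> x) (vS u h) = vS u h"
    "\<forall>y\<in>bs_verts u. bs_act (\<phi> x) y = y \<longrightarrow> y = vS u h" using u.pinned_vertex[OF xc(2) x(2)] by blast
  have fW: "bs_act (\<phi> y) (vS u h) = vS u h" if y: "y \<in> W" for y
  proof -
    have yc: "y \<in> carrier L" "\<phi> y \<in> carrier GP" using y W by auto
    have "ell u (\<phi> x \<star> \<phi> y)" using W(5)[OF x(1) y uV] xc yc by simp
    then show ?thesis using u.pinned_shared[OF xc(2) yc(2) h] W(4)[OF y uV] by blast
  qed
  have hv: "vS u h \<in> bs_verts u" using h(1) by simp
  have "bs_act (\<phi> l) (vS u h) = vS u h" if l: "l \<in> carrier L" for l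
  proof -
    let ?S = "W \<inter> {y \<in> carrier L. inv l \<otimes> y \<otimes> l \<in> W}"
    have "openin T ?S" using W(1) l by (intro openin_Int open_vimage cont_mult cont_const) auto
    moreover have "\<one> \<in> ?S" using W l by simp
    ultimately obtain y where y: "y \<in> ?S" "pinned u (\<phi> y)" using a unfolding active_def by blast
    have yc: "y \<in> carrier L" "\<phi> y \<in> carrier GP" "\<phi> l \<in> carrier GP" using y l by auto
    have r: "gp_retr G u (\<phi> y) \<noteq> \<one>\<^bsub>G u\<^esub>" using y(2) unfolding pinned_def by blast
    have "bs_act (\<phi> (inv l \<otimes> y \<otimes> l)) (vS u h) = vS u h" using fW y by blast
    then have "bs_act (iv (\<phi> l) \<star> \<phi> y \<star> \<phi> l) (vS u h) = vS u h" using yc l by simp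
    then have "bs_act (\<phi> l) (bs_act (iv (\<phi> l) \<star> \<phi> y \<star> \<phi> l) (vS u h)) = bs_act (\<phi> l) (vS u h)" by simp
    moreover have "bs_act (\<phi> l) (bs_act (iv (\<phi> l) \<star> \<phi> y \<star> \<phi> l) (vS u h)) = bs_act (\<phi> y) (bs_act (\<phi> l) (vS u h))"
      using yc hv by (simp add: u.T.act_mult)
    ultimately have "bs_act (\<phi> y) (bs_act (\<phi> l) (vS u h)) = bs_act (\<phi> l) (vS u h)" by simp
    then show ?thesis
      using u.pinned_unique[OF yc(2) r h(1) fW] y(1) u.T.act_closed[OF yc(3) hv] by blast
  qed
  then have "iv h \<star> \<phi> l \<star> h \<in> Gs (insert u (lk u))" if "l \<in> carrier L" for l
    using u.fix_S[of "\<phi> l" h] that h(1) by simp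
  then show ?thesis using h(1) by blast
qed

end

text \<open>A single active vertex \<open>u\<close> serves as the clique. If the composites with the
  retractions are continuous, elements near the identity retract trivially to \<open>G u\<close>, so
  they are not pinned and \<open>u\<close> is not active.\<close>

theorem theoremB:
  fixes V :: "'v set" and E :: "'v set set" and G :: "'v \<Rightarrow> 'g monoid"
    and L :: "'a monoid" and T :: "'a topology"
    and \<phi> :: "'a \<Rightarrow> ('v \<times> 'g) list set"
  assumes graph: "simplicial_graph V E"
    and fin_dim: "finite_dimension V E"
    and groups: "\<And>v. v \<in> V \<Longrightarrow> group (G v)"
    and nontriv: "\<And>v. v \<in> V \<Longrightarrow> carrier (G v) \<noteq> {\<one>\<^bsub>G v\<^esub>}"
    and lc: "locally_compact_group L T"
    and hom: "\<phi> \<in> hom L (graph_product V E G)"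
  shows "(continuous_map T (discrete_topology (carrier (graph_product V E G))) \<phi> \<or>
          (\<exists>S g. S \<noteq> {} \<and> clique V E S \<and> g \<in> carrier (graph_product V E G) \<and>
             \<phi> ` carrier L \<subseteq>
               (\<lambda>h. g \<otimes>\<^bsub>graph_product V E G\<^esub> h \<otimes>\<^bsub>graph_product V E G\<^esub>
                       inv\<^bsub>graph_product V E G\<^esub> g) ` gp_sub V E G (S \<union> link V E S)))
       \<and> ((\<forall>v\<in>V. continuous_map T (discrete_topology (carrier (G v))) (gp_retr G v \<circ> \<phi>))
           \<longrightarrow> continuous_map T (discrete_topology (carrier (graph_product V E G))) \<phi>)"
proof -
  obtain N where N: "\<And>S. clique V E S \<Longrightarrow> finite S \<and> card S \<le> N"
    using fin_dim unfolding finite_dimension_def by blast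
  interpret graph_prod_map V E G L T \<phi> N
    using graph groups lc hom N unfolding locally_compact_group_def
    by (intro graph_prod_map.intro graph_prod.intro top_group.intro graph_prod_map_axioms.intro) simp_all
  have act: "\<exists>S g. S \<noteq> {} \<and> clique V E S \<and> g \<in> carrier GP \<and>
      \<phi> ` carrier L \<subseteq> (\<lambda>h. g \<star> h \<star> iv g) ` gp_sub V E G (S \<union> link V E S)" if a: "active u" for u
  proof -
    have uV: "u \<in> V" using a unfolding active_def by blast
    obtain g where g: "g \<in> carrier GP" "\<And>l. l \<in> carrier L \<Longrightarrow> iv g \<star> \<phi> l \<star> g \<in> Gs (insert u (lk u))"
      using active_conj[OF a] by blast
    have "\<phi> l \<in> (\<lambda>h. g \<star> h \<star> iv g) ` gp_sub V E G ({u} \<union> link V E {u})" if l: "l \<in> carrier L" for l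
    proof
      show "\<phi> l = g \<star> (iv g \<star> \<phi> l \<star> g) \<star> iv g" using g(1) l by (simp add: GP.m_assoc)
      show "iv g \<star> \<phi> l \<star> g \<in> gp_sub V E G ({u} \<union> link V E {u})"
        using Gs_gp_sub[OF g(2)[OF l]] lk_link[OF uV] by simp
    qed
    then show ?thesis using g(1) uV by (intro exI[of _ "{u}"] exI[of _ g]) (auto simp: clique_def)
  qed
  have ret: "continuous_map T (discrete_topology (carrier GP)) \<phi>"
    if r: "\<forall>v\<in>V. continuous_map T (discrete_topology (carrier (G v))) (gp_retr G v \<circ> \<phi>)"
  proof (rule ccontr)
    assume "\<not> ?thesis"
    then obtain u where a: "active u" using exists_active by blast
    have uV: "u \<in> V" using a unfolding active_def by blast
    interpret Gu: group "G u" using groups uV .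
    interpret r: group_hom GP "G u" "gp_retr G u" by unfold_locales (rule retr_hom[OF uV])
    let ?U = "{x \<in> topspace T. (gp_retr G u \<circ> \<phi>) x \<in> {\<one>\<^bsub>G u\<^esub>}}"
    have "openin T ?U" by (rule openin_continuous_map_preimage[OF bspec[OF r uV]]) simp
    moreover have "\<one>\<^bsub>L\<^esub> \<in> ?U" by simp
    ultimately obtain x where "x \<in> ?U" "pinned u (\<phi> x)" using a unfolding active_def by blast
    then show False unfolding pinned_def by simp
  qed
  show ?thesis using act exists_active ret by blast
qed

end
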